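(* Let $d=1$, $R>0$ and $1<\alpha<2$. For each $\lambda>0$ let $u=u^{(\lambda)}$ be the unique mild solution of $$\partial_t u_t(x)=\mathcal{L}u_t(x)+\lambda\,\sigma(u_t(x))\,\dot w(t,x)\quad (x\in B(0,R),\ t>0),\qquad u_t(x)=0\ \text{ for all } x\in B(0,R)^c,$$ with initial function $u_0$, where $\dot w$ is space-time white noise on $(0,\infty)\times B(0,R)$. Then the excitation index of $u$ is $\frac{2\alpha}{\alpha-1}$; that is, for every $t>0$, $$e(t):=\lim_{\lambda\to\infty}\frac{\log\log\mathcal{E}_t(\lambda)}{\log\lambda}=\frac{2\alpha}{\alpha-1},\qquad\text{where } \mathcal{E}_t(\lambda):=\sqrt{\int_{B(0,R)}\mathrm{E}|u_t(x)|^2\,dx}.$$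
   Context: Here $d=1$, so $B(0,R)=(-R,R)$. $\mathcal{L}$ is the generator of the (isotropic) $\alpha$-stable process killed upon exiting $B(0,R)$, i.e. the fractional Laplacian $-(-\Delta)^{\alpha/2}$ with Dirichlet exterior condition, and $p_D(t,x,y)$ denotes its transition density (the Dirichlet heat kernel of the killed process). Assumptions on the data: $u_0:B(0,R)\to[0,\infty)$ is a nonrandom nonnegative function which is strictly positive on a set of positive measure in $B(0,R)$; $\sigma:\mathbf{R}\to\mathbf{R}$ is Lipschitz continuous with $\sigma(0)=0$ and $0<l_\sigma\le L_\sigma<\infty$, where $l_\sigma:=\inf_{x\ne0}|\sigma(x)/x|$ and $L_\sigma:=\sup_{x\neq 0}|\sigma(x)/x|$. The data $u_0,\sigma$ do not depend on $\lambda$. A mild solution is a (predictable) random field satisfying, in the sense of Walsh's stochastic integral, $$u_t(x)=\int_{B(0,R)}u_0(y)p_D(t,x,y)\,dy+\lambda\int_{B(0,R)}\int_0^t p_D(t-s,x,y)\,\sigma(u_s(y))\,w(ds\,dy).$$ It is known that there is a unique mild solution satisfying $\sup_{x\in B(0,R)}\sup_{t\in[0,T]}\mathrm{E}|u_t(x)|^k<\infty$ for all $T>0$ and all $k\ge 2$; this is the solution meant. *)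

theory Defs
  imports "HOL-Probability.Probability"
begin

section \<open>The killed isotropic stable process and its transition density\<close>

text \<open>
  The isotropic \<open>\<alpha>\<close>-stable process on the line, started at \<open>0\<close>: the Levy process with
  characteristic exponent \<open>\<bar>\<xi>\<bar> powr \<alpha>\<close>, i.e. with generator \<open>-(-\<Delta>)\<close> to the power \<open>\<alpha>/2\<close>.
  Only times \<open>t \<ge> 0\<close> matter.
\<close>

definition stable_process :: "'b measure \<Rightarrow> real \<Rightarrow> (real \<Rightarrow> 'b \<Rightarrow> real) \<Rightarrow> bool" where
  "stable_process N \<alpha> X \<longleftrightarrow>
     prob_space N \<and>
     (\<forall>t\<ge>0. X t \<in> borel_measurable N) \<and>
     (\<forall>\<omega>\<in>space N. X 0 \<omega> = 0) \<and>
     (\<forall>n ts. 0 \<le> ts 0 \<and> mono ts \<longrightarrow>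
        prob_space.indep_vars N (\<lambda>_. borel)
          (\<lambda>i \<omega>. X (ts (Suc i)) \<omega> - X (ts i) \<omega>) {..<n::nat}) \<and>
     (\<forall>s t \<xi>. 0 \<le> s \<and> s \<le> t \<longrightarrow>
        char (distr N borel (\<lambda>\<omega>. X t \<omega> - X s \<omega>)) \<xi>
          = complex_of_real (exp (- (t - s) * \<bar>\<xi>\<bar> powr \<alpha>))) \<and>
     (\<forall>\<omega>\<in>space N. \<forall>t\<ge>0.
        ((\<lambda>s. X s \<omega>) \<longlongrightarrow> X t \<omega>) (at_right t) \<and>
        (0 < t \<longrightarrow> (\<exists>l. ((\<lambda>s. X s \<omega>) \<longlongrightarrow> l) (at_left t))))"

text \<open>First exit time from \<open>D\<close> of the process started at \<open>x\<close> (\<open>\<infinity>\<close> if it never exits).\<close>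

definition exit_time :: "(real \<Rightarrow> 'b \<Rightarrow> real) \<Rightarrow> real set \<Rightarrow> real \<Rightarrow> 'b \<Rightarrow> ereal" where
  "exit_time X D x \<omega> = Inf (ereal ` {s. 0 < s \<and> x + X s \<omega> \<notin> D})"

text \<open>
  \<open>p\<close> is a jointly measurable transition density of \<open>x + X\<close> killed upon exiting \<open>D\<close>.
  Its values outside \<open>(0,\<infinity>) \<times> D \<times> D\<close> are irrelevant. The completion of \<open>N\<close> is used because
  \<open>t < exit_time X D x\<close> is an event only up to null sets when \<open>N\<close> is not complete.
\<close>

definition killed_transition_density ::
    "'b measure \<Rightarrow> (real \<Rightarrow> 'b \<Rightarrow> real) \<Rightarrow> real set \<Rightarrow> (real \<Rightarrow> real \<Rightarrow> real \<Rightarrow> real) \<Rightarrow> bool" where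
  "killed_transition_density N X D p \<longleftrightarrow>
     (\<lambda>(t, x, y). p t x y) \<in> borel_measurable (restrict_space borel ({0<..} \<times> D \<times> D)) \<and>
     (\<forall>t>0. \<forall>x\<in>D. \<forall>y\<in>D. 0 \<le> p t x y) \<and>
     (\<forall>t>0. \<forall>x\<in>D. \<forall>A\<in>sets borel. A \<subseteq> D \<longrightarrow>
        emeasure (completion N)
            {\<omega> \<in> space N. x + X t \<omega> \<in> A \<and> ereal t < exit_time X D x \<omega>}
          = (\<integral>\<^sup>+y\<in>A. ennreal (p t x y) \<partial>lborel))"

section \<open>Space-time white noise and the Walsh integral\<close>

text \<open>Centred normal with variance \<open>v\<close>, the degenerate case \<open>v = 0\<close> included.\<close>

definition centred_gaussian :: "'a measure \<Rightarrow> ('a \<Rightarrow> real) \<Rightarrow> real \<Rightarrow> bool" where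
  "centred_gaussian M Y v \<longleftrightarrow>
     Y \<in> borel_measurable M \<and>
     (\<forall>\<theta>. char (distr M borel Y) \<theta> = complex_of_real (exp (- v * \<theta>\<^sup>2 / 2)))"

definition noise_sets :: "real set \<Rightarrow> real set \<Rightarrow> (real \<times> real) set set" where
  "noise_sets S D = {B \<in> sets borel. B \<subseteq> S \<times> D \<and> emeasure lborel B < \<infinity>}"

text \<open>
  White noise on \<open>(0,\<infinity>) \<times> D\<close>: a centred Gaussian process indexed by the Borel sets of finite
  measure, with covariance \<open>E (w A * w B) = \<bar>A \<inter> B\<bar>\<close>, adapted to the filtration \<open>F\<close> and with
  future increments independent of the past. The natural filtration of \<open>w\<close> is one possible
  choice of \<open>F\<close>; the values of \<open>F\<close> at negative times are irrelevant.
\<close>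

definition white_noise ::
    "'a measure \<Rightarrow> (real \<Rightarrow> 'a measure) \<Rightarrow> real set \<Rightarrow> ((real \<times> real) set \<Rightarrow> 'a \<Rightarrow> real) \<Rightarrow> bool" where
  "white_noise M F D w \<longleftrightarrow>
     prob_space M \<and> filtration (space M) F \<and> (\<forall>t. subalgebra M (F t)) \<and>
     (\<forall>n c B. (\<forall>i<n::nat. B i \<in> noise_sets {0<..} D) \<longrightarrow>
        centred_gaussian M (\<lambda>\<omega>. \<Sum>i<n. c i * w (B i) \<omega>)
          (\<Sum>i<n. \<Sum>j<n. c i * c j * measure lborel (B i \<inter> B j))) \<and>
     (\<forall>t\<ge>0. \<forall>B\<in>noise_sets {0<..t} D. w B \<in> borel_measurable (F t)) \<and>
     (\<forall>t\<ge>0. prob_space.indep_set M (sets (F t))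
        (sigma_sets (space M)
          {w B -` A \<inter> space M | A B. A \<in> sets borel \<and> B \<in> noise_sets {t<..} D}))"

text \<open>
  Random fields \<open>f s y \<omega>\<close> are regarded as functions of \<open>(s, \<omega>, y)\<close> on \<open>(0,\<infinity>) \<times> \<Omega> \<times> D\<close>.
\<close>

definition predictable_algebra ::
    "'a measure \<Rightarrow> (real \<Rightarrow> 'a measure) \<Rightarrow> real set \<Rightarrow> (real \<times> 'a \<times> real) measure" where
  "predictable_algebra M F D =
     sigma ({0<..} \<times> space M \<times> D)
       {{a<..b} \<times> G \<times> A | a b G A.
          0 \<le> a \<and> a < b \<and> G \<in> sets (F a) \<and> A \<in> sets borel \<and> A \<subseteq> D}"

definition predictable ::
    "'a measure \<Rightarrow> (real \<Rightarrow> 'a measure) \<Rightarrow> real set \<Rightarrow> (real \<Rightarrow> real \<Rightarrow> 'a \<Rightarrow> real) \<Rightarrow> bool" where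
  "predictable M F D f \<longleftrightarrow>
     (\<lambda>(s, \<omega>, y). f s y \<omega>) \<in> borel_measurable (predictable_algebra M F D)"

text \<open>
  An elementary field is a finite sum of terms \<open>Z(\<omega>) 1\<^bsub>(a,b]\<^esub>(s) 1\<^bsub>A\<^esub>(y)\<close> with \<open>Z\<close> bounded and
  \<open>F a\<close>-measurable; it is represented by the list of the tuples \<open>(Z, a, b, A)\<close>.
\<close>

type_synonym 'a elementary = "(('a \<Rightarrow> real) \<times> real \<times> real \<times> real set) list"

definition is_elementary ::
    "(real \<Rightarrow> 'a measure) \<Rightarrow> real set \<Rightarrow> 'a elementary \<Rightarrow> bool" where
  "is_elementary F D es \<longleftrightarrow>
     (\<forall>(Z, a, b, A) \<in> set es.
        0 \<le> a \<and> a < b \<and> A \<in> sets borel \<and> A \<subseteq> D \<and> emeasure lborel A < \<infinity> \<and>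
        Z \<in> borel_measurable (F a) \<and> (\<exists>C. \<forall>\<omega>\<in>space (F a). \<bar>Z \<omega>\<bar> \<le> C))"

definition elementary_field :: "'a elementary \<Rightarrow> real \<Rightarrow> real \<Rightarrow> 'a \<Rightarrow> real" where
  "elementary_field es s y \<omega> =
     (\<Sum>(Z, a, b, A)\<leftarrow>es. Z \<omega> * indicator {a<..b} s * indicator A y)"

definition elementary_integral ::
    "((real \<times> real) set \<Rightarrow> 'a \<Rightarrow> real) \<Rightarrow> 'a elementary \<Rightarrow> 'a \<Rightarrow> real" where
  "elementary_integral w es \<omega> = (\<Sum>(Z, a, b, A)\<leftarrow>es. Z \<omega> * w ({a<..b} \<times> A) \<omega>)"

text \<open>
  \<open>I\<close> is (a version of) Walsh's stochastic integral of the predictable field \<open>f\<close> over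
  \<open>(0,\<infinity>) \<times> D\<close>: the mean-square limit of the integrals of elementary fields approximating \<open>f\<close>
  in mean square. The relation determines \<open>I\<close> almost surely, and has no solution \<open>I\<close> unless
  \<open>f\<close> is square integrable.
\<close>

definition has_walsh_integral ::
    "'a measure \<Rightarrow> (real \<Rightarrow> 'a measure) \<Rightarrow> real set \<Rightarrow> ((real \<times> real) set \<Rightarrow> 'a \<Rightarrow> real) \<Rightarrow>
     (real \<Rightarrow> real \<Rightarrow> 'a \<Rightarrow> real) \<Rightarrow> ('a \<Rightarrow> real) \<Rightarrow> bool" where
  "has_walsh_integral M F D w f I \<longleftrightarrow>
     predictable M F D f \<and> I \<in> borel_measurable M \<and>
     (\<exists>es :: nat \<Rightarrow> 'a elementary.
        (\<forall>n. is_elementary F D (es n)) \<and>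
        (\<lambda>n. \<integral>\<^sup>+(s, \<omega>, y). ennreal ((elementary_field (es n) s y \<omega> - f s y \<omega>)\<^sup>2)
               \<partial>(restrict_space lborel {0<..} \<Otimes>\<^sub>M M \<Otimes>\<^sub>M restrict_space lborel D)) \<longlonglongrightarrow> 0 \<and>
        (\<lambda>n. \<integral>\<^sup>+\<omega>. ennreal ((elementary_integral w (es n) \<omega> - I \<omega>)\<^sup>2) \<partial>M) \<longlonglongrightarrow> 0)"

section \<open>Mild solutions\<close>

text \<open>
  Here \<open>u t x \<omega>\<close> is the value of the random field at time \<open>t\<close> and position \<open>x\<close>, \<open>p\<close> is the
  Dirichlet heat kernel on \<open>D\<close> and \<open>l\<close> is the noise level. The indicator restricts the Walsh
  integral to \<open>0 < s < t\<close>.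
\<close>

definition mild_solution ::
    "'a measure \<Rightarrow> (real \<Rightarrow> 'a measure) \<Rightarrow> real set \<Rightarrow> ((real \<times> real) set \<Rightarrow> 'a \<Rightarrow> real) \<Rightarrow>
     (real \<Rightarrow> real \<Rightarrow> real \<Rightarrow> real) \<Rightarrow> (real \<Rightarrow> real) \<Rightarrow> (real \<Rightarrow> real) \<Rightarrow> real \<Rightarrow>
     (real \<Rightarrow> real \<Rightarrow> 'a \<Rightarrow> real) \<Rightarrow> bool" where
  "mild_solution M F D w p \<sigma> u0 l u \<longleftrightarrow>
     predictable M F D u \<and>
     (\<forall>x\<in>D. AE \<omega> in M. u 0 x \<omega> = u0 x) \<and>
     (\<forall>t>0. \<forall>x. x \<notin> D \<longrightarrow> (\<forall>\<omega>\<in>space M. u t x \<omega> = 0)) \<and>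
     (\<forall>t>0. \<forall>x\<in>D.
        set_integrable lebesgue D (\<lambda>y. u0 y * p t x y) \<and>
        (\<exists>I. has_walsh_integral M F D w
               (\<lambda>s y \<omega>. indicator {0<..<t} s * (p (t - s) x y * \<sigma> (u s y \<omega>))) I \<and>
             (AE \<omega> in M. u t x \<omega> = (LINT y:D|lebesgue. u0 y * p t x y) + l * I \<omega>)))"

definition locally_bounded_moments ::
    "'a measure \<Rightarrow> real set \<Rightarrow> (real \<Rightarrow> real \<Rightarrow> 'a \<Rightarrow> real) \<Rightarrow> bool" where
  "locally_bounded_moments M D u \<longleftrightarrow>
     (\<forall>T>0. \<forall>k\<ge>2::nat.
        (SUP x\<in>D. SUP t\<in>{0..T}. \<integral>\<^sup>+\<omega>. ennreal (\<bar>u t x \<omega>\<bar> ^ k) \<partial>M) < \<infinity>)"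

text \<open>The energy \<open>\<E>\<^sub>t(\<lambda>)\<close>, as a function of the random field \<open>v = u t\<close>.\<close>

definition energy :: "'a measure \<Rightarrow> real set \<Rightarrow> (real \<Rightarrow> 'a \<Rightarrow> real) \<Rightarrow> real" where
  "energy M D v = sqrt (LINT x:D|lborel. (LINT \<omega>|M. \<bar>v x \<omega>\<bar>\<^sup>2))"

end

theory Submission
  imports Defs
begin

text \<open>
  The second moment \<open>f(t, x) = E \<bar>u\<^sub>t(x)\<bar>\<^sup>2\<close> of the solution at noise level \<open>\<lambda>\<close> satisfies, by Walsh's
  isometry,
  \<open>f(t, x) = (P\<^sub>t u\<^sub>0)(x)\<^sup>2 + \<lambda>\<^sup>2 \<integral> \<integral> p(t - s, x, y)\<^sup>2 E \<sigma>(u\<^sub>s(y))\<^sup>2 dy ds\<close>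
  (\<open>second_moment_identity\<close>), and \<open>E \<sigma>(u\<^sub>s(y))\<^sup>2\<close> lies between two multiples of \<open>f(s, y)\<close>. The
  kernel \<open>p(r, x, y)\<^sup>2\<close> has mass of order \<open>r\<close> to the power \<open>-1/\<alpha>\<close>, so \<open>f\<close> solves a Volterra
  inequality in both directions. The time scale \<open>H\<close> of such an inequality is given by
  \<open>\<lambda>\<^sup>2 H powr (1 - 1/\<alpha>) = const\<close>, that is, \<open>H\<close> is a multiple of \<open>\<lambda> powr (-2\<alpha>/(\<alpha> - 1))\<close>. One
  direction bounds \<open>f\<close> by an exponential function of a rate comparable to \<open>1/H\<close>; the other one makes
  lower bounds of \<open>f\<close> double in every time step \<open>H\<close>. At a fixed time \<open>t\<close> the logarithm of the energy
  is therefore of the order \<open>t / H\<close>, and taking a second logarithm leaves the exponent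
  \<open>2\<alpha>/(\<alpha> - 1)\<close> (\<open>volterra_upper\<close>, \<open>volterra_lower\<close>, \<open>loglog_limit\<close>).

  The two estimates of the kernel come from elementary properties of the process. From above, the
  law of the free process at time \<open>r\<close> has a density bounded by \<open>C r powr (-1/\<alpha>)\<close>, by Fourier
  inversion, and killing only decreases it (\<open>kernel_square_upper\<close>). From below, scaling and symmetry put a fixed amount of mass
  into an interval of length \<open>K r powr (1/\<alpha>)\<close> on either side of the starting point; for small \<open>r\<close>
  hardly any of it is killed, since the paths are right-continuous at \<open>0\<close>; and the Cauchy-Schwarz
  inequality turns mass on a short interval into a lower bound of the integral of the square
  (\<open>kernel_square_lower\<close>). The iteration from below starts from an interval on which \<open>P\<^sub>s u\<^sub>0\<close> is
  bounded below for \<open>s\<close> in a short time interval; it exists because \<open>u\<^sub>0\<close> is bounded below on a set that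
  fills almost all of some short interval (\<open>initial_lower\<close>).

  One point is delicate. The mass of the killed density on a set is the value of
  \<open>emeasure (completion N)\<close> at an event that involves the exit time, and this value would be \<open>0\<close>, by
  convention, if the event were not measurable. By an elementary argument it is measurable for all
  starting points outside a countable set (\<open>exit_event_measurable\<close>), which is enough because a
  countable set of points is not seen by the integrals over space.
\<close>

section \<open>Volterra inequalities with a singular kernel\<close>

text \<open>
  Substitute \<open>r = t - s\<close> and split at \<open>r = 1/\<beta>\<close>: the singularity governs the first part and the
  exponential the second. Both contribute the same power of \<open>\<beta>\<close>.
\<close>

lemma singular_exponential_integral:
  fixes \<gamma> \<beta> t :: real
  assumes \<gamma>: "0 < \<gamma>" "\<gamma> < 1" and \<beta>: "0 < \<beta>"
  shows "(\<integral>\<^sup>+s. indicator {0<..<t} s * ennreal ((t - s) powr (- \<gamma>) * exp (\<beta> * s)) \<partial>lborel)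
    \<le> ennreal (exp (\<beta> * t) * (1 / (1 - \<gamma>) + 1) * \<beta> powr (\<gamma> - 1))"
proof -
  define h where "h = 1 / \<beta>"
  have h: "0 < h" using \<beta> by (simp add: h_def)
  have I1: "(\<integral>\<^sup>+r. ennreal (r powr (- \<gamma>)) * indicator {0..h} r \<partial>lborel) = ennreal (h powr (1 - \<gamma>) / (1 - \<gamma>))"
    using has_integral_powr_from_0[of "- \<gamma>" h] \<gamma> h
    by (intro nn_integral_has_integral_lebesgue') auto
  have I2: "(\<integral>\<^sup>+r. ennreal (exp (- \<beta> * r)) * indicator {0..} r \<partial>lborel) = ennreal (1 / \<beta>)"
    using has_integral_exp_minus_to_infinity[of \<beta> 0] \<beta>
    by (intro nn_integral_has_integral_lebesgue') auto
  have "(\<integral>\<^sup>+s. indicator {0<..<t} s * ennreal ((t - s) powr (- \<gamma>) * exp (\<beta> * s)) \<partial>lborel)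
    = (\<integral>\<^sup>+r. indicator {0<..<t} (t + - 1 * r) * ennreal ((t - (t + - 1 * r)) powr (- \<gamma>) * exp (\<beta> * (t + - 1 * r))) \<partial>lborel)"
    by (subst nn_integral_real_affine[where c="-1" and t=t]) auto
  also have "\<dots> \<le> (\<integral>\<^sup>+r. ennreal (exp (\<beta> * t)) * (ennreal (r powr (- \<gamma>)) * indicator {0..h} r
      + ennreal (h powr (- \<gamma>)) * (ennreal (exp (- \<beta> * r)) * indicator {0..} r)) \<partial>lborel)"
  proof (intro nn_integral_mono)
    fix r :: real
    show "indicator {0<..<t} (t + - 1 * r) * ennreal ((t - (t + - 1 * r)) powr (- \<gamma>) * exp (\<beta> * (t + - 1 * r)))
      \<le> ennreal (exp (\<beta> * t)) * (ennreal (r powr (- \<gamma>)) * indicator {0..h} r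
      + ennreal (h powr (- \<gamma>)) * (ennreal (exp (- \<beta> * r)) * indicator {0..} r))"
    proof (cases "0 < r \<and> r < t")
      case True
      have e: "exp (\<beta> * (t - r)) = exp (\<beta> * t) * exp (- \<beta> * r)"
        by (simp add: exp_add[symmetric] algebra_simps)
      have le1: "exp (- \<beta> * r) \<le> 1" using \<beta> True by simp
      have "r powr (- \<gamma>) * exp (\<beta> * (t - r)) \<le> exp (\<beta> * t) * (r powr (- \<gamma>) * indicator {0..h} r + h powr (- \<gamma>) * exp (- \<beta> * r))"
      proof (cases "r \<le> h")
        case rh: True
        have "r powr (- \<gamma>) * exp (- \<beta> * r) \<le> r powr (- \<gamma>) * 1" using le1 by (intro mult_left_mono) auto
        also have "\<dots> \<le> r powr (- \<gamma>) + h powr (- \<gamma>) * exp (- \<beta> * r)" by simp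
        finally show ?thesis using rh True unfolding e by (simp add: mult_left_mono mult.left_commute)
      next
        case rh: False
        then have "r powr (- \<gamma>) \<le> h powr (- \<gamma>)" using h \<gamma> by (intro powr_mono2') auto
        then show ?thesis using rh unfolding e by (simp add: mult_left_mono mult.left_commute)
      qed
      then have "ennreal (r powr (- \<gamma>) * exp (\<beta> * (t - r))) \<le> ennreal (exp (\<beta> * t) * (r powr (- \<gamma>) * indicator {0..h} r + h powr (- \<gamma>) * exp (- \<beta> * r)))"
        by (rule ennreal_leI)
      also have "\<dots> = ennreal (exp (\<beta> * t)) * (ennreal (r powr (- \<gamma>)) * indicator {0..h} r
      + ennreal (h powr (- \<gamma>)) * (ennreal (exp (- \<beta> * r)) * indicator {0..} r))"
        using True by (simp add: ennreal_mult indicator_def)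
      finally show ?thesis using True by simp
    qed auto
  qed
  also have "\<dots> = ennreal (exp (\<beta> * t)) * (ennreal (h powr (1 - \<gamma>) / (1 - \<gamma>)) + ennreal (h powr (- \<gamma>)) * ennreal (1 / \<beta>))"
    by (simp add: nn_integral_cmult nn_integral_add I1 I2[simplified])
  also have "\<dots> = ennreal (exp (\<beta> * t) * (h powr (1 - \<gamma>) / (1 - \<gamma>) + h powr (- \<gamma>) * (1 / \<beta>)))"
    using \<gamma> \<beta> h by (simp add: ennreal_mult[symmetric] ennreal_plus[symmetric] del: ennreal_plus)
  also have "h powr (1 - \<gamma>) / (1 - \<gamma>) + h powr (- \<gamma>) * (1 / \<beta>) = (1 / (1 - \<gamma>) + 1) * \<beta> powr (\<gamma> - 1)"
  proof -
    have hp: "h powr z = \<beta> powr (- z)" for z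
      using \<beta> by (simp add: h_def powr_divide powr_minus_divide)
    have "h powr (1 - \<gamma>) = \<beta> powr (\<gamma> - 1)" by (simp add: hp)
    moreover have "h powr (- \<gamma>) * (1 / \<beta>) = \<beta> powr (\<gamma> - 1)"
      using \<beta> by (simp add: hp powr_diff)
    ultimately show ?thesis by (simp add: algebra_simps)
  qed
  finally show ?thesis by (simp add: mult.assoc)
qed

abbreviation volterra :: "(real \<Rightarrow> real \<Rightarrow> real \<Rightarrow> ennreal) \<Rightarrow> (real \<Rightarrow> real \<Rightarrow> ennreal) \<Rightarrow> real \<Rightarrow> real \<Rightarrow> ennreal" where
  "volterra k f t x \<equiv> \<integral>\<^sup>+s. indicator {0<..<t} s * (\<integral>\<^sup>+y. k (t - s) x y * f s y \<partial>lborel) \<partial>lborel"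

text \<open>
  A bound \<open>f t x \<le> G exp (\<beta> t)\<close> is improved by the inequality to the constant \<open>c + G/2\<close>. Starting
  from any finite bound, the constants tend to the fixed point \<open>2 c\<close>.
\<close>

lemma volterra_upper:
  fixes f :: "real \<Rightarrow> real \<Rightarrow> ennreal" and k :: "real \<Rightarrow> real \<Rightarrow> real \<Rightarrow> ennreal"
  assumes \<gamma>: "0 < \<gamma>" "\<gamma> < 1" and \<beta>: "0 < \<beta>" and c: "0 \<le> c" and \<Lambda>: "0 \<le> \<Lambda>" and C: "0 \<le> C"
    and km: "\<And>r x. 0 < r \<Longrightarrow> x \<in> D \<Longrightarrow> k r x \<in> borel_measurable borel"
    and k: "\<And>r x. 0 < r \<Longrightarrow> x \<in> D \<Longrightarrow> (\<integral>\<^sup>+y. k r x y \<partial>lborel) \<le> ennreal (C * r powr (- \<gamma>))"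
    and kD: "\<And>r x y. 0 < r \<Longrightarrow> x \<in> D \<Longrightarrow> y \<notin> D \<Longrightarrow> k r x y = 0"
    and bounded: "\<And>t x. 0 < t \<Longrightarrow> t \<le> T \<Longrightarrow> x \<in> D \<Longrightarrow> f t x \<le> ennreal B"
    and ineq: "\<And>t x. 0 < t \<Longrightarrow> t \<le> T \<Longrightarrow> x \<in> D \<Longrightarrow>
      f t x \<le> ennreal c + ennreal \<Lambda> * volterra k f t x"
    and small: "\<Lambda> * C * ((1 / (1 - \<gamma>) + 1) * \<beta> powr (\<gamma> - 1)) \<le> 1 / 2"
    and t: "0 < t" "t \<le> T" and x: "x \<in> D"
  shows "f t x \<le> ennreal (2 * c * exp (\<beta> * t))"
proof -
  have step: "f t x \<le> ennreal ((c + G / 2) * exp (\<beta> * t))"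
    if G: "0 \<le> G" "\<And>t x. 0 < t \<Longrightarrow> t \<le> T \<Longrightarrow> x \<in> D \<Longrightarrow> f t x \<le> ennreal (G * exp (\<beta> * t))"
      and t: "0 < t" "t \<le> T" and x: "x \<in> D" for G t x
  proof -
    have "volterra k f t x
      \<le> (\<integral>\<^sup>+s. ennreal (G * C) * (indicator {0<..<t} s * ennreal ((t - s) powr (- \<gamma>) * exp (\<beta> * s))) \<partial>lborel)"
    proof (intro nn_integral_mono)
      fix s
      show "indicator {0<..<t} s * (\<integral>\<^sup>+y. k (t - s) x y * f s y \<partial>lborel)
        \<le> ennreal (G * C) * (indicator {0<..<t} s * ennreal ((t - s) powr (- \<gamma>) * exp (\<beta> * s)))"
      proof (cases "s \<in> {0<..<t}")
        case True
        then have ts: "0 < t - s" by simp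
        note [measurable] = km[OF ts x]
        have "(\<integral>\<^sup>+y. k (t - s) x y * f s y \<partial>lborel) \<le> (\<integral>\<^sup>+y. k (t - s) x y * ennreal (G * exp (\<beta> * s)) \<partial>lborel)"
        proof (intro nn_integral_mono)
          fix y show "k (t - s) x y * f s y \<le> k (t - s) x y * ennreal (G * exp (\<beta> * s))"
            using kD[OF ts x, of y] G(2)[of s y] True t by (cases "y \<in> D") (auto intro: mult_left_mono)
        qed
        also have "\<dots> = (\<integral>\<^sup>+y. k (t - s) x y \<partial>lborel) * ennreal (G * exp (\<beta> * s))"
          by (rule nn_integral_multc) measurable
        also have "\<dots> \<le> ennreal (C * (t - s) powr (- \<gamma>)) * ennreal (G * exp (\<beta> * s))"
          by (intro mult_right_mono k[OF ts x]) simp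
        also have "\<dots> = ennreal (G * C) * ennreal ((t - s) powr (- \<gamma>) * exp (\<beta> * s))"
          using C G(1) by (simp add: ennreal_mult[symmetric] mult_ac)
        finally show ?thesis using True by simp
      qed simp
    qed
    also have "\<dots> = ennreal (G * C) * (\<integral>\<^sup>+s. indicator {0<..<t} s * ennreal ((t - s) powr (- \<gamma>) * exp (\<beta> * s)) \<partial>lborel)"
      by (rule nn_integral_cmult) measurable
    also have "\<dots> \<le> ennreal (G * C) * ennreal (exp (\<beta> * t) * (1 / (1 - \<gamma>) + 1) * \<beta> powr (\<gamma> - 1))"
      by (intro mult_left_mono singular_exponential_integral \<gamma> \<beta>) simp
    finally have I: "volterra k f t x
      \<le> ennreal (G * C) * ennreal (exp (\<beta> * t) * (1 / (1 - \<gamma>) + 1) * \<beta> powr (\<gamma> - 1))" .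
    let ?w = "(1 / (1 - \<gamma>) + 1) * \<beta> powr (\<gamma> - 1)"
    have "f t x \<le> ennreal c + ennreal \<Lambda> * (ennreal (G * C) * ennreal (exp (\<beta> * t) * (1 / (1 - \<gamma>) + 1) * \<beta> powr (\<gamma> - 1)))"
      by (rule order_trans[OF ineq[OF t x]]) (intro add_left_mono mult_left_mono I, simp)
    also have "\<dots> = ennreal (c + \<Lambda> * C * ?w * (G * exp (\<beta> * t)))"
      using c \<Lambda> C G(1) \<gamma> by (simp add: ennreal_mult[symmetric] ennreal_plus[symmetric] mult_ac del: ennreal_plus)
    also have "\<dots> \<le> ennreal ((c + G / 2) * exp (\<beta> * t))"
    proof (intro ennreal_leI)
      have "c * 1 \<le> c * exp (\<beta> * t)" using c \<beta> t by (intro mult_left_mono) auto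
      moreover have "\<Lambda> * C * ?w * (G * exp (\<beta> * t)) \<le> 1 / 2 * (G * exp (\<beta> * t))"
        using small G(1) by (intro mult_right_mono) auto
      ultimately have "c * 1 + \<Lambda> * C * ?w * (G * exp (\<beta> * t)) \<le> c * exp (\<beta> * t) + 1 / 2 * (G * exp (\<beta> * t))"
        by (rule add_mono)
      also have "\<dots> = (c + G / 2) * exp (\<beta> * t)" unfolding distrib_right[of c "G / 2"] by simp
      finally show "c + \<Lambda> * C * ?w * (G * exp (\<beta> * t)) \<le> (c + G / 2) * exp (\<beta> * t)" by simp
    qed
    finally show ?thesis .
  qed
  have iter: "f t x \<le> ennreal ((2 * c + \<bar>B\<bar> / 2 ^ n) * exp (\<beta> * t))" if "0 < t" "t \<le> T" "x \<in> D" for n t x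
    using that
  proof (induction n arbitrary: t x)
    case 0
    have "B \<le> \<bar>B\<bar> * 1" by simp
    also have "\<dots> \<le> \<bar>B\<bar> * exp (\<beta> * t)" using \<beta> 0 by (intro mult_left_mono) auto
    also have "\<dots> \<le> (2 * c + \<bar>B\<bar> / 2 ^ 0) * exp (\<beta> * t)" using c by (intro mult_right_mono) auto
    finally show ?case using bounded[OF 0] by (meson ennreal_leI order_trans)
  next
    case (Suc n)
    have "f t x \<le> ennreal ((c + (2 * c + \<bar>B\<bar> / 2 ^ n) / 2) * exp (\<beta> * t))"
      by (rule step) (use c Suc in auto)
    also have "c + (2 * c + \<bar>B\<bar> / 2 ^ n) / 2 = 2 * c + \<bar>B\<bar> / 2 ^ Suc n" by (simp add: field_simps)
    finally show ?case .
  qed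
  show ?thesis
  proof (rule LIMSEQ_le_const)
    have "(\<lambda>n. (2 * c + \<bar>B\<bar> / 2 ^ n) * exp (\<beta> * t)) \<longlonglongrightarrow> (2 * c + 0) * exp (\<beta> * t)"
      by (intro tendsto_intros LIMSEQ_divide_realpow_zero) simp
    then show "(\<lambda>n. ennreal ((2 * c + \<bar>B\<bar> / 2 ^ n) * exp (\<beta> * t))) \<longlonglongrightarrow> ennreal (2 * c * exp (\<beta> * t))"
      by (intro tendsto_ennrealI) simp
    show "\<exists>N. \<forall>n\<ge>N. f t x \<le> ennreal ((2 * c + \<bar>B\<bar> / 2 ^ n) * exp (\<beta> * t))"
      using iter[OF t x] by blast
  qed
qed

text \<open>
  A lower bound \<open>m\<close> on one time interval of length \<open>H\<close> implies the lower bound \<open>2 m\<close> on the next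
  one: its times have distance at most \<open>2 H\<close> from those of the former, which therefore contributes the
  factor \<open>\<Lambda> * H * \<kappa> * (2 H) powr (- \<gamma>) \<ge> 2\<close>. The number of intervals between \<open>a\<close> and \<open>t\<close> is at least
  \<open>(t - a) / H - 1\<close>.
\<close>

lemma volterra_lower:
  fixes f :: "real \<Rightarrow> real \<Rightarrow> ennreal" and k :: "real \<Rightarrow> real \<Rightarrow> real \<Rightarrow> ennreal"
  assumes \<gamma>: "0 < \<gamma>" and \<Lambda>: "0 \<le> \<Lambda>" and \<kappa>: "0 < \<kappa>" and E: "countable E"
    and J: "J \<in> sets borel"
    and km: "\<And>r x. 0 < r \<Longrightarrow> x \<in> J - E \<Longrightarrow> k r x \<in> borel_measurable borel"
    and k: "\<And>r x. 0 < r \<Longrightarrow> r \<le> \<tau> \<Longrightarrow> x \<in> J - E \<Longrightarrow> ennreal (\<kappa> * r powr (- \<gamma>)) \<le> (\<integral>\<^sup>+y. k r x y * indicator J y \<partial>lborel)"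
    and ineq: "\<And>t x. 0 < t \<Longrightarrow> x \<in> J - E \<Longrightarrow>
      ennreal \<Lambda> * volterra k f t x \<le> f t x"
    and m: "0 \<le> m" and a: "0 < a" and start: "\<And>s x. a \<le> s \<Longrightarrow> s \<le> a + H \<Longrightarrow> x \<in> J - E \<Longrightarrow> ennreal m \<le> f s x"
    and H: "0 < H" "2 * H \<le> \<tau>" "2 \<le> \<Lambda> * (H * (\<kappa> * (2 * H) powr (- \<gamma>)))"
    and t: "a \<le> t" and x: "x \<in> J - E"
  shows "ennreal (m * 2 powr ((t - a) / H - 1)) \<le> f t x"
proof -
  have step: "ennreal (2 * m) \<le> f t x"
    if b: "0 < b" and m: "0 \<le> m" and low: "\<And>s x. b \<le> s \<Longrightarrow> s \<le> b + H \<Longrightarrow> x \<in> J - E \<Longrightarrow> ennreal m \<le> f s x"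
      and t: "b + H \<le> t" "t \<le> b + 2 * H" and x: "x \<in> J - E" for b m t x
  proof -
    let ?v = "\<kappa> * (2 * H) powr (- \<gamma>)"
    have "ennreal (H * (?v * m)) = (\<integral>\<^sup>+s. ennreal (?v * m) * indicator {b<..<b + H} s \<partial>lborel)"
      using H(1) \<kappa> m by (subst nn_integral_cmult_indicator) (auto simp: ennreal_mult[symmetric] mult_ac)
    also have "\<dots> \<le> volterra k f t x"
    proof (intro nn_integral_mono)
      fix s
      show "ennreal (?v * m) * indicator {b<..<b + H} s \<le> indicator {0<..<t} s * (\<integral>\<^sup>+y. k (t - s) x y * f s y \<partial>lborel)"
      proof (cases "s \<in> {b<..<b + H}")
        case True
        then have ts: "0 < t - s" "t - s \<le> 2 * H" "t - s \<le> \<tau>" using t H by auto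
        note [measurable] = km[OF ts(1) x] J
        have "(2 * H) powr (- \<gamma>) \<le> (t - s) powr (- \<gamma>)"
          using ts \<gamma> by (intro powr_mono2') auto
        then have "ennreal (?v * m) \<le> ennreal (\<kappa> * (t - s) powr (- \<gamma>) * m)"
          using \<kappa> m by (intro ennreal_leI mult_right_mono mult_left_mono) auto
        also have "\<dots> = ennreal (\<kappa> * (t - s) powr (- \<gamma>)) * ennreal m" using \<kappa> m by (intro ennreal_mult) auto
        also have "\<dots> \<le> (\<integral>\<^sup>+y. k (t - s) x y * indicator J y \<partial>lborel) * ennreal m"
          by (intro mult_right_mono k[OF ts(1,3) x]) simp
        also have "\<dots> = (\<integral>\<^sup>+y. (k (t - s) x y * indicator J y) * ennreal m \<partial>lborel)"
          by (rule nn_integral_multc[symmetric]) measurable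
        also have "\<dots> \<le> (\<integral>\<^sup>+y. k (t - s) x y * f s y \<partial>lborel)"
        proof (rule nn_integral_mono_AE)
          have "AE y in lborel. y \<notin> E"
            by (rule AE_not_in) (rule countable_imp_null_set_lborel[OF E])
          then show "AE y in lborel. k (t - s) x y * indicator J y * ennreal m \<le> k (t - s) x y * f s y"
          proof eventually_elim
            case (elim y)
            then show ?case using low[of s y] True
              by (cases "y \<in> J") (auto intro: mult_left_mono)
          qed
        qed
        finally show ?thesis using True b t H by simp
      qed simp
    qed
    finally have "ennreal \<Lambda> * ennreal (H * (?v * m)) \<le> f t x"
      using ineq[of t x] b t H x by (meson add_pos_pos less_le_trans mult_left_mono order_trans zero_le)
    moreover have "2 * m \<le> \<Lambda> * (H * ?v) * m" using H(3) m by (rule mult_right_mono)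
    then have "ennreal (2 * m) \<le> ennreal \<Lambda> * ennreal (H * (?v * m))"
      using \<Lambda> H(1) \<kappa> m by (simp add: ennreal_mult[symmetric] mult_ac ennreal_leI)
    ultimately show ?thesis by (rule order_trans[rotated])
  qed
  have iter: "ennreal (m * 2 ^ n) \<le> f s y" if "a + n * H \<le> s" "s \<le> a + n * H + H" "y \<in> J - E" for n :: nat and s y
    using that
  proof (induction n arbitrary: s y)
    case 0
    then show ?case using start by simp
  next
    case (Suc n)
    have "ennreal (2 * (m * 2 ^ n)) \<le> f s y"
      by (rule step[of "a + n * H"]) (use a m H Suc in \<open>auto simp: algebra_simps add_pos_nonneg\<close>)
    then show ?case by (simp add: mult_ac)
  qed
  \<comment> \<open>The time \<open>t\<close> lies in the interval with number \<open>n\<close>.\<close>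
  define n where "n = nat \<lfloor>(t - a) / H\<rfloor>"
  have nn: "0 \<le> (t - a) / H" using t H by simp
  then have n: "real n \<le> (t - a) / H" "(t - a) / H \<le> real n + 1"
    unfolding n_def by linarith+
  have "m * 2 powr ((t - a) / H - 1) \<le> m * 2 powr real n"
    using n m by (intro mult_left_mono powr_mono) auto
  also have "\<dots> = m * 2 ^ n" by (simp add: powr_realpow)
  finally have "ennreal (m * 2 powr ((t - a) / H - 1)) \<le> ennreal (m * 2 ^ n)" by (rule ennreal_leI)
  also have "\<dots> \<le> f t x"
  proof (rule iter[OF _ _ x])
    show "a + real n * H \<le> t" "t \<le> a + real n * H + H" using n H(1) by (auto simp: field_simps)
  qed
  finally show ?thesis .
qed

text \<open>
  \<open>ln (A l powr Q + B) = Q ln l + ln (A + B l powr (-Q))\<close>, and the last term converges.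
\<close>

lemma loglog_limit:
  fixes g :: "real \<Rightarrow> real"
  assumes Q: "0 < Q" and A: "0 < A1" "0 < A2"
    and lower: "eventually (\<lambda>l. A1 * l powr Q + B1 \<le> g l) at_top"
    and upper: "eventually (\<lambda>l. g l \<le> A2 * l powr Q + B2) at_top"
  shows "((\<lambda>l. ln (g l) / ln l) \<longlongrightarrow> Q) at_top"
proof -
  have lnl: "filterlim (\<lambda>l::real. ln l) at_top at_top" by (rule ln_at_top)
  have pos: "eventually (\<lambda>l. 0 < A + B * l powr (- Q)) at_top" 
    and lim: "((\<lambda>l. ln (A * l powr Q + B) / ln l) \<longlongrightarrow> Q) at_top" if "0 < A" for A B :: real
  proof -
    have "((\<lambda>l::real. l powr (- Q)) \<longlongrightarrow> 0) at_top"
      using Q by (intro tendsto_neg_powr filterlim_ident) auto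
    then have AB: "((\<lambda>l. A + B * l powr (- Q)) \<longlongrightarrow> A + B * 0) at_top"
      by (intro tendsto_intros)
    then show pos: "eventually (\<lambda>l. 0 < A + B * l powr (- Q)) at_top"
      using that by (intro order_tendstoD(1)) auto
    have "((\<lambda>l. Q + ln (A + B * l powr (- Q)) / ln l) \<longlongrightarrow> Q + 0) at_top"
    proof (intro tendsto_add tendsto_const)
      show "((\<lambda>l. ln (A + B * l powr (- Q)) / ln l) \<longlongrightarrow> 0) at_top"
        using AB that by (intro tendsto_divide_0[OF tendsto_ln] filterlim_at_top_imp_at_infinity lnl) auto
    qed
    moreover have "eventually (\<lambda>l. Q + ln (A + B * l powr (- Q)) / ln l = ln (A * l powr Q + B) / ln l) at_top"
      using pos eventually_gt_at_top[of 1]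
    proof eventually_elim
      case (elim l)
      have "A * l powr Q + B = l powr Q * (A + B * l powr (- Q))"
        using elim by (simp add: algebra_simps powr_add[symmetric])
      then have "ln (A * l powr Q + B) = Q * ln l + ln (A + B * l powr (- Q))"
        using elim by (simp add: ln_mult)
      then show ?case using elim by (simp add: add_divide_distrib)
    qed
    ultimately show "((\<lambda>l. ln (A * l powr Q + B) / ln l) \<longlongrightarrow> Q) at_top"
      by (simp add: filterlim_cong)
  qed
  have low_pos: "eventually (\<lambda>l. 0 < A1 * l powr Q + B1) at_top"
    using pos[OF A(1), of B1] eventually_gt_at_top[of 1]
  proof eventually_elim
    case (elim l)
    have "A1 * l powr Q + B1 = l powr Q * (A1 + B1 * l powr (- Q))"
      using elim by (simp add: algebra_simps powr_add[symmetric])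
    then show ?case using elim by simp
  qed
  show ?thesis
  proof (rule tendsto_sandwich[OF _ _ lim[OF A(1), of B1] lim[OF A(2), of B2]])
    show "eventually (\<lambda>l. ln (A1 * l powr Q + B1) / ln l \<le> ln (g l) / ln l) at_top"
      using low_pos lower eventually_gt_at_top[of 1]
      by eventually_elim (auto intro!: divide_right_mono)
    show "eventually (\<lambda>l. ln (g l) / ln l \<le> ln (A2 * l powr Q + B2) / ln l) at_top"
      using low_pos lower upper eventually_gt_at_top[of 1]
      by eventually_elim (auto intro!: divide_right_mono)
  qed
qed

section \<open>Gaussian variables and mean-square limits\<close>

text \<open>
  The characteristic function identifies the law with that of \<open>sqrt v\<close> times a standard normal
  variable, which covers \<open>v = 0\<close> without a case distinction.
\<close>

lemma centred_gaussian_moments: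
  assumes "prob_space M" and Y: "centred_gaussian M Y v"
  shows "integrable M (\<lambda>\<omega>. (Y \<omega>)\<^sup>2)" "integrable M Y" "(\<integral>\<omega>. Y \<omega> \<partial>M) = 0" "(\<integral>\<omega>. (Y \<omega>)\<^sup>2 \<partial>M) = v"
proof -
  interpret prob_space M by fact
  have Ym [measurable]: "Y \<in> borel_measurable M"
    and ch: "\<And>\<theta>. char (distr M borel Y) \<theta> = complex_of_real (exp (- v * \<theta>\<^sup>2 / 2))"
    using Y by (auto simp: centred_gaussian_def)
  interpret D: real_distribution "distr M borel Y" by (rule real_distribution_distr) simp
  have "exp (- v / 2) \<le> 1"
    using D.cmod_char_le_1[of 1] unfolding ch by simp
  then have v: "0 \<le> v" by simp
  let ?S = "std_normal_distribution"
  interpret S: real_distribution ?S by (rule real_dist_normal_dist)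
  interpret G: real_distribution "distr ?S borel (\<lambda>x. sqrt v * x)"
    by (rule S.real_distribution_distr) simp
  have "char (distr ?S borel (\<lambda>x. sqrt v * x)) = char (distr M borel Y)"
  proof
    fix \<theta>
    have "char (distr ?S borel (\<lambda>x. sqrt v * x)) \<theta> = char ?S (sqrt v * \<theta>)"
      by (simp add: char_def integral_distr mult_ac)
    also have "\<dots> = char (distr M borel Y) \<theta>"
      using v by (simp add: ch char_std_normal_distribution power_mult_distrib)
    finally show "char (distr ?S borel (\<lambda>x. sqrt v * x)) \<theta> = char (distr M borel Y) \<theta>" .
  qed
  then have eq: "distr M borel Y = distr ?S borel (\<lambda>x. sqrt v * x)"
    by (intro Levy_uniqueness D.real_distribution_axioms G.real_distribution_axioms) simp
  have "integrable (distr M borel Y) (\<lambda>x. x\<^sup>2)"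
    unfolding eq using integrable_std_normal_distribution_moment[of 2]
    by (subst integrable_distr_eq) (simp_all add: power_mult_distrib)
  then show i2: "integrable M (\<lambda>\<omega>. (Y \<omega>)\<^sup>2)" by (subst (asm) integrable_distr_eq) simp_all
  have iS: "integrable ?S (\<lambda>x. x)"
    using integrable_std_normal_distribution_moment[of 1] by (simp only: power_one_right)
  have "integrable (distr ?S borel (\<lambda>x. sqrt v * x)) (\<lambda>x. x)"
    by (rule integrable_distr_eq[THEN iffD2]) (simp, simp, rule integrable_mult_right, rule iS)
  then show "integrable M Y" unfolding eq[symmetric]
    by (rule integrable_distr_eq[THEN iffD1, rotated 2]) simp_all
  have "(\<integral>\<omega>. Y \<omega> \<partial>M) = (\<integral>x. x \<partial>distr M borel Y)"
    by (rule integral_distr[symmetric]) simp_all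
  also have "\<dots> = (\<integral>x. sqrt v * x \<partial>?S)"
    unfolding eq by (rule integral_distr) simp_all
  also have "\<dots> = sqrt v * (\<integral>x. x \<partial>?S)" by (rule integral_mult_right_zero)
  also have "\<dots> = 0" using integral_std_normal_distribution_moment_odd[of 1] by (simp only: power_one_right odd_one mult_zero_right simp_thms)
  finally show "(\<integral>\<omega>. Y \<omega> \<partial>M) = 0" .
  have "(\<integral>\<omega>. (Y \<omega>)\<^sup>2 \<partial>M) = (\<integral>x. x\<^sup>2 \<partial>distr M borel Y)" by (subst integral_distr) simp_all
  also have "\<dots> = (\<integral>x. v * x\<^sup>2 \<partial>?S)" unfolding eq
    using v by (subst integral_distr) (simp_all add: power_mult_distrib)
  also have "\<dots> = v" using std_normal_distribution_even_moments(1)[of 1]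
    by (simp add: fact_numeral)
  finally show "(\<integral>\<omega>. (Y \<omega>)\<^sup>2 \<partial>M) = v" .
qed

lemma square_integrable_mult:
  fixes X Y :: "'a \<Rightarrow> real"
  assumes [measurable]: "X \<in> borel_measurable M" "Y \<in> borel_measurable M"
    and "integrable M (\<lambda>x. (X x)\<^sup>2)" "integrable M (\<lambda>x. (Y x)\<^sup>2)"
  shows "integrable M (\<lambda>x. X x * Y x)"
proof (rule Bochner_Integration.integrable_bound)
  show "integrable M (\<lambda>x. (X x)\<^sup>2 + (Y x)\<^sup>2)" using assms by simp
  show "AE x in M. norm (X x * Y x) \<le> norm ((X x)\<^sup>2 + (Y x)\<^sup>2)"
  proof (intro AE_I2)
    fix x
    have "0 \<le> (\<bar>X x\<bar> - \<bar>Y x\<bar>)\<^sup>2" by simp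
    then have "2 * (\<bar>X x\<bar> * \<bar>Y x\<bar>) \<le> (X x)\<^sup>2 + (Y x)\<^sup>2" by (simp add: power2_diff)
    moreover have "0 \<le> \<bar>X x\<bar> * \<bar>Y x\<bar>" by simp
    ultimately show "norm (X x * Y x) \<le> norm ((X x)\<^sup>2 + (Y x)\<^sup>2)"
      unfolding real_norm_def abs_mult by linarith
  qed
qed simp

lemma square_sum_le:
  fixes x y :: real
  assumes "0 < \<epsilon>"
  shows "(x + y)\<^sup>2 \<le> (1 + \<epsilon>) * x\<^sup>2 + (1 + 1 / \<epsilon>) * y\<^sup>2"
proof -
  have "0 \<le> (\<epsilon> * x - y)\<^sup>2 / \<epsilon>" using assms by simp
  also have "(\<epsilon> * x - y)\<^sup>2 / \<epsilon> = \<epsilon> * x\<^sup>2 + y\<^sup>2 / \<epsilon> - 2 * x * y"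
    using assms by (simp add: power2_diff field_simps power2_eq_square)
  finally show ?thesis by (simp add: power2_sum algebra_simps)
qed

lemma nn_integral_square_le:
  fixes f g :: "'a \<Rightarrow> real"
  assumes [measurable]: "f \<in> borel_measurable M" "g \<in> borel_measurable M" and e: "0 < \<epsilon>"
  shows "(\<integral>\<^sup>+x. ennreal ((g x)\<^sup>2) \<partial>M) \<le> ennreal (1 + \<epsilon>) * (\<integral>\<^sup>+x. ennreal ((f x)\<^sup>2) \<partial>M)
           + ennreal (1 + 1 / \<epsilon>) * (\<integral>\<^sup>+x. ennreal ((f x - g x)\<^sup>2) \<partial>M)"
proof -
  have "(\<integral>\<^sup>+x. ennreal ((g x)\<^sup>2) \<partial>M) \<le>
    (\<integral>\<^sup>+x. ennreal (1 + \<epsilon>) * ennreal ((f x)\<^sup>2) + ennreal (1 + 1 / \<epsilon>) * ennreal ((f x - g x)\<^sup>2) \<partial>M)"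
  proof (intro nn_integral_mono)
    fix x
    have "(g x)\<^sup>2 \<le> (1 + \<epsilon>) * (f x)\<^sup>2 + (1 + 1 / \<epsilon>) * (f x - g x)\<^sup>2"
      using square_sum_le[OF e, of "f x" "g x - f x"] by (simp add: power2_commute)
    then show "ennreal ((g x)\<^sup>2) \<le> ennreal (1 + \<epsilon>) * ennreal ((f x)\<^sup>2) + ennreal (1 + 1 / \<epsilon>) * ennreal ((f x - g x)\<^sup>2)"
      using e by (simp add: ennreal_mult[symmetric] ennreal_plus[symmetric] del: ennreal_plus)
  qed
  also have "\<dots> = ennreal (1 + \<epsilon>) * (\<integral>\<^sup>+x. ennreal ((f x)\<^sup>2) \<partial>M)
           + ennreal (1 + 1 / \<epsilon>) * (\<integral>\<^sup>+x. ennreal ((f x - g x)\<^sup>2) \<partial>M)"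
    by (subst nn_integral_add) (auto simp: nn_integral_cmult)
  finally show ?thesis .
qed

text \<open>
  The inequality \<open>(x + y)\<^sup>2 \<le> (1 + \<epsilon>) x\<^sup>2 + (1 + 1/\<epsilon>) y\<^sup>2\<close> replaces the triangle inequality of the
  norm and can be integrated directly, also when an integral is infinite.
\<close>

lemma L2_limit_norm_le:
  fixes f :: "'a \<Rightarrow> real" and g :: "'b \<Rightarrow> real"
  assumes [measurable]: "\<And>n. fn n \<in> borel_measurable P" "f \<in> borel_measurable P"
    "\<And>n. gn n \<in> borel_measurable Q" "g \<in> borel_measurable Q"
    and f: "(\<lambda>n. \<integral>\<^sup>+x. ennreal ((fn n x - f x)\<^sup>2) \<partial>P) \<longlonglongrightarrow> 0"
    and g: "(\<lambda>n. \<integral>\<^sup>+x. ennreal ((gn n x - g x)\<^sup>2) \<partial>Q) \<longlonglongrightarrow> 0"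
    and eq: "\<And>n. (\<integral>\<^sup>+x. ennreal ((gn n x)\<^sup>2) \<partial>Q) \<le> (\<integral>\<^sup>+x. ennreal ((fn n x)\<^sup>2) \<partial>P)"
  shows "(\<integral>\<^sup>+x. ennreal ((g x)\<^sup>2) \<partial>Q) \<le> (\<integral>\<^sup>+x. ennreal ((f x)\<^sup>2) \<partial>P)" (is "?G \<le> ?F")
proof (cases "?F = \<infinity>")
  case False
  then obtain r where r: "?F = ennreal r" "0 \<le> r" by (cases ?F) auto
  let ?a = "\<lambda>n. \<integral>\<^sup>+x. ennreal ((fn n x - f x)\<^sup>2) \<partial>P" and ?b = "\<lambda>n. \<integral>\<^sup>+x. ennreal ((gn n x - g x)\<^sup>2) \<partial>Q"
  have sw: "(f x - fn n x)\<^sup>2 = (fn n x - f x)\<^sup>2" for n x by (rule power2_commute)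
  have *: "?G \<le> ennreal (1 + \<epsilon>) * (ennreal (1 + \<epsilon>) * ?F)" if e: "0 < \<epsilon>" for \<epsilon> :: real
  proof (rule LIMSEQ_le_const)
    let ?c = "ennreal (1 + \<epsilon>)" and ?d = "ennreal (1 + 1 / \<epsilon>)"
    have "(\<lambda>n. ?c * (?c * ?F + ?d * ?a n) + ?d * ?b n) \<longlonglongrightarrow> ?c * (?c * ?F + ?d * 0) + ?d * 0"
      by (intro tendsto_add ennreal_tendsto_cmult tendsto_const f g) auto
    then show "(\<lambda>n. ?c * (?c * ?F + ?d * ?a n) + ?d * ?b n) \<longlonglongrightarrow> ?c * (?c * ?F)" by simp
    have "?G \<le> ?c * (?c * ?F + ?d * ?a n) + ?d * ?b n" for n
    proof -
      have "?G \<le> ?c * (\<integral>\<^sup>+x. ennreal ((gn n x)\<^sup>2) \<partial>Q) + ?d * ?b n"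
        by (rule nn_integral_square_le) (use e in auto)
      also have "\<dots> \<le> ?c * (\<integral>\<^sup>+x. ennreal ((fn n x)\<^sup>2) \<partial>P) + ?d * ?b n"
        by (intro add_mono mult_left_mono eq) auto
      also have "(\<integral>\<^sup>+x. ennreal ((fn n x)\<^sup>2) \<partial>P) \<le> ?c * ?F + ?d * ?a n"
        using nn_integral_square_le[of f P "fn n" \<epsilon>] e unfolding sw by simp
      finally show ?thesis by (simp add: add_mono mult_left_mono)
    qed
    then show "\<exists>N. \<forall>n\<ge>N. ?G \<le> ?c * (?c * ?F + ?d * ?a n) + ?d * ?b n" by blast
  qed
  show ?thesis
  proof (rule LIMSEQ_le_const)
    have "(\<lambda>n. (1 + 1 / Suc n) * ((1 + 1 / Suc n) * r)) \<longlonglongrightarrow> (1 + 0) * ((1 + 0) * r)"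
      by (intro tendsto_intros LIMSEQ_Suc lim_1_over_n)
    then show "(\<lambda>n. ennreal ((1 + 1 / Suc n) * ((1 + 1 / Suc n) * r))) \<longlonglongrightarrow> ?F"
      unfolding r by (intro tendsto_ennrealI) simp
    show "\<exists>N. \<forall>n\<ge>N. ?G \<le> ennreal ((1 + 1 / Suc n) * ((1 + 1 / Suc n) * r))"
      using *[of "1 / Suc n" for n] r(2) unfolding r(1)
      by (auto simp del: ennreal_plus simp: ennreal_mult intro!: exI[of _ 0])
  qed
qed simp

lemma L2_limit_norm_eq:
  fixes f :: "'a \<Rightarrow> real" and g :: "'b \<Rightarrow> real"
  assumes "\<And>n. fn n \<in> borel_measurable P" "f \<in> borel_measurable P"
    "\<And>n. gn n \<in> borel_measurable Q" "g \<in> borel_measurable Q"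
    and "(\<lambda>n. \<integral>\<^sup>+x. ennreal ((fn n x - f x)\<^sup>2) \<partial>P) \<longlonglongrightarrow> 0"
    and "(\<lambda>n. \<integral>\<^sup>+x. ennreal ((gn n x - g x)\<^sup>2) \<partial>Q) \<longlonglongrightarrow> 0"
    and eq: "\<And>n. (\<integral>\<^sup>+x. ennreal ((gn n x)\<^sup>2) \<partial>Q) = (\<integral>\<^sup>+x. ennreal ((fn n x)\<^sup>2) \<partial>P)"
  shows "(\<integral>\<^sup>+x. ennreal ((g x)\<^sup>2) \<partial>Q) = (\<integral>\<^sup>+x. ennreal ((f x)\<^sup>2) \<partial>P)"
  using L2_limit_norm_le[of fn P f gn Q g] L2_limit_norm_le[of gn Q g fn P f] assms
  by (intro antisym) simp_all

section \<open>White noise\<close>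

locale white_noise_space = prob_space M for M :: "'a measure" +
  fixes F :: "real \<Rightarrow> 'a measure" and D :: "real set" and w :: "(real \<times> real) set \<Rightarrow> 'a \<Rightarrow> real"
  assumes noise: "white_noise M F D w" and D_borel [measurable]: "D \<in> sets borel"
begin

lemma w_combination:
  assumes "\<And>i. i < n \<Longrightarrow> B i \<in> noise_sets {0<..} D"
  shows "centred_gaussian M (\<lambda>\<omega>. \<Sum>i<n::nat. c i * w (B i) \<omega>)
          (\<Sum>i<n. \<Sum>j<n. c i * c j * measure lborel (B i \<inter> B j))"
  using noise assms unfolding white_noise_def by blast

lemma w_gaussian:
  assumes "B \<in> noise_sets {0<..} D"
  shows "centred_gaussian M (w B) (measure lborel B)"
  using w_combination[of 1 "\<lambda>_. B" "\<lambda>_. 1"] assms by simp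

lemma w_measurable [measurable]: "B \<in> noise_sets {0<..} D \<Longrightarrow> w B \<in> borel_measurable M"
  using w_gaussian by (simp add: centred_gaussian_def)

lemmas w_moments = centred_gaussian_moments[OF prob_space_axioms w_gaussian]

text \<open>
  Polarization of the variance of \<open>w B + w C\<close>.
\<close>

lemma w_covariance:
  assumes B: "B \<in> noise_sets {0<..} D" and C: "C \<in> noise_sets {0<..} D"
  shows "integrable M (\<lambda>\<omega>. w B \<omega> * w C \<omega>)"
    and "(\<integral>\<omega>. w B \<omega> * w C \<omega> \<partial>M) = measure lborel (B \<inter> C)"
proof -
  note [measurable] = w_measurable[OF B] w_measurable[OF C]
  show int: "integrable M (\<lambda>\<omega>. w B \<omega> * w C \<omega>)"
    by (intro square_integrable_mult w_moments(1) B C) simp_all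
  have "centred_gaussian M (\<lambda>\<omega>. \<Sum>i<2::nat. 1 * w ((\<lambda>i. if i = 0 then B else C) i) \<omega>)
    (\<Sum>i<2::nat. \<Sum>j<2::nat. 1 * 1 * measure lborel ((\<lambda>i. if i = 0 then B else C) i \<inter> (\<lambda>i. if i = 0 then B else C) j))"
    by (intro w_combination) (use B C in auto)
  then have g: "centred_gaussian M (\<lambda>\<omega>. w B \<omega> + w C \<omega>) (measure lborel B + measure lborel C + 2 * measure lborel (B \<inter> C))"
    by (simp add: numeral_2_eq_2 Int_commute algebra_simps)
  have "measure lborel B + measure lborel C + 2 * measure lborel (B \<inter> C) = (\<integral>\<omega>. (w B \<omega> + w C \<omega>)\<^sup>2 \<partial>M)"
    using centred_gaussian_moments(4)[OF prob_space_axioms g] by simp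
  also have "\<dots> = (\<integral>\<omega>. (w B \<omega>)\<^sup>2 + (w C \<omega>)\<^sup>2 + 2 * (w B \<omega> * w C \<omega>) \<partial>M)"
    by (simp add: power2_sum algebra_simps)
  also have "\<dots> = measure lborel B + measure lborel C + 2 * (\<integral>\<omega>. w B \<omega> * w C \<omega> \<partial>M)"
    using int w_moments(1,4)[OF B] w_moments(1,4)[OF C] by simp
  finally show "(\<integral>\<omega>. w B \<omega> * w C \<omega> \<partial>M) = measure lborel (B \<inter> C)" by simp
qed

text \<open>
  The combination \<open>w (B \<union> C) - w B - w C\<close> is Gaussian with variance \<open>0\<close>.
\<close>

lemma w_additive:
  assumes B: "B \<in> noise_sets {0<..} D" and C: "C \<in> noise_sets {0<..} D" and "B \<inter> C = {}"
  shows "AE \<omega> in M. w (B \<union> C) \<omega> = w B \<omega> + w C \<omega>"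
proof -
  have bc: "B \<in> sets lborel" "C \<in> sets lborel" "emeasure lborel B < \<infinity>" "emeasure lborel C < \<infinity>"
    using B C by (auto simp: noise_sets_def)
  have BC: "B \<union> C \<in> noise_sets {0<..} D"
  proof -
    have "emeasure lborel (B \<union> C) \<le> emeasure lborel B + emeasure lborel C"
      using bc by (intro emeasure_subadditive) auto
    also have "\<dots> < \<infinity>" using bc by simp
    finally show ?thesis using B C by (auto simp: noise_sets_def)
  qed
  have meas: "measure lborel (B \<union> C) = measure lborel B + measure lborel C"
    using bc assms(3) by (intro measure_Union) auto
  define E where "E i = (if i = 0 then B \<union> C else if i = 1 then B else C)" for i :: nat
  define c where "c i = (if i = 0 then 1 else - 1 :: real)" for i :: nat
  have E: "E 0 = B \<union> C" "E 1 = B" "E 2 = C" and c: "c 0 = 1" "c 1 = -1" "c 2 = -1"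
    by (auto simp: E_def c_def)
  have sum3: "(\<Sum>i<3. f i) = f 0 + f 1 + f 2" for f :: "nat \<Rightarrow> real"
    by (simp add: eval_nat_numeral)
  have "centred_gaussian M (\<lambda>\<omega>. \<Sum>i<3. c i * w (E i) \<omega>)
    (\<Sum>i<3. \<Sum>j<3. c i * c j * measure lborel (E i \<inter> E j))"
    by (rule w_combination) (simp add: E_def B C BC)
  moreover have "(\<Sum>i<3. c i * w (E i) \<omega>) = w (B \<union> C) \<omega> - w B \<omega> - w C \<omega>" for \<omega>
    unfolding sum3 E c by simp
  moreover have "(B \<union> C) \<inter> B = B" "(B \<union> C) \<inter> C = C" "B \<inter> (B \<union> C) = B" "C \<inter> (B \<union> C) = C"
      "B \<inter> C = {}" "C \<inter> B = {}" "(B \<union> C) \<inter> (B \<union> C) = B \<union> C" "B \<inter> B = B" "C \<inter> C = C"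
    using assms(3) by auto
  then have "(\<Sum>i<3. \<Sum>j<3. c i * c j * measure lborel (E i \<inter> E j)) = 0"
    unfolding sum3 E c by (simp only: meas measure_empty) simp
  ultimately have g: "centred_gaussian M (\<lambda>\<omega>. w (B \<union> C) \<omega> - w B \<omega> - w C \<omega>) 0" by simp
  note [measurable] = w_measurable[OF B] w_measurable[OF C] w_measurable[OF BC]
  have "AE \<omega> in M. (w (B \<union> C) \<omega> - w B \<omega> - w C \<omega>)\<^sup>2 = 0"
    using centred_gaussian_moments(1,4)[OF prob_space_axioms g]
    by (subst integral_nonneg_eq_0_iff_AE[symmetric]) simp_all
  then show ?thesis by eventually_elim (simp add: algebra_simps)
qed

text \<open>
  The information carried by the noise after time \<open>t\<close>.
\<close>

definition future_algebra :: "real \<Rightarrow> 'a measure" where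
  "future_algebra t = sigma (space M)
     {w B -` A \<inter> space M | A B. A \<in> sets borel \<and> B \<in> noise_sets {t<..} D}"

lemma noise_sets_mono: "B \<in> noise_sets S D \<Longrightarrow> S \<subseteq> S' \<Longrightarrow> B \<in> noise_sets S' D"
  unfolding noise_sets_def by blast

lemma w_future_measurable:
  "B \<in> noise_sets {t<..} D \<Longrightarrow> w B \<in> borel_measurable (future_algebra t)"
  unfolding future_algebra_def
  by (rule measurableI) (auto simp: sets_measure_of_conv space_measure_of_conv)

lemma past_measurable:
  assumes "0 \<le> t" and "Z \<in> borel_measurable (F t)"
  shows "Z \<in> borel_measurable M"
  using noise assms unfolding white_noise_def by (meson measurable_from_subalg)

lemma w_past_measurable:
  "0 \<le> t \<Longrightarrow> B \<in> noise_sets {0<..t} D \<Longrightarrow> w B \<in> borel_measurable (F t)"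
  using noise unfolding white_noise_def by blast

lemma filtration_measurable:
  assumes "s \<le> t" and "Z \<in> borel_measurable (F s)"
  shows "Z \<in> borel_measurable (F t)"
proof -
  have "filtration (space M) F" using noise by (simp add: white_noise_def)
  then have "subalgebra (F t) (F s)"
    using assms(1) by (auto simp: filtration_def subalgebra_def)
  then show ?thesis using assms(2) by (rule measurable_from_subalg)
qed

lemma past_future_indep:
  assumes t: "0 \<le> t" and Z: "Z \<in> borel_measurable (F t)" and Y: "Y \<in> borel_measurable (future_algebra t)"
  shows "indep_var borel Z borel Y"
proof -
  let ?G = "{w B -` A \<inter> space M | A B. A \<in> sets borel \<and> B \<in> noise_sets {t<..} D}"
  have G: "?G \<subseteq> sets M"
    using t noise_sets_mono[of _ "{t<..}" "{0<..}"] by (auto intro!: measurable_sets w_measurable)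
  have sub: "subalgebra M (future_algebra t)"
    unfolding subalgebra_def future_algebra_def
    using sets.sigma_sets_subset[OF G] by (auto simp: space_measure_of_conv sets_measure_of_conv)
  have ind: "indep_set (sets (F t)) (sigma_sets (space M) ?G)"
    using noise t unfolding white_noise_def by blast
  have spF: "space (F t) = space M" using noise unfolding white_noise_def subalgebra_def by blast
  show ?thesis unfolding indep_var_eq
  proof (intro conjI)
    show "random_variable borel Z" by (rule past_measurable[OF t Z])
    show "random_variable borel Y" using measurable_from_subalg[OF sub] Y by blast
    let ?A = "sigma_sets (space M) {Z -` A \<inter> space M |A. A \<in> sets borel}"
    let ?B = "sigma_sets (space M) {Y -` A \<inter> space M |A. A \<in> sets borel}"
    have A: "?A \<subseteq> sets (F t)"
      unfolding spF[symmetric] using measurable_sets[OF Z] by (intro sets.sigma_sets_subset) auto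
    have spG: "space (future_algebra t) = space M"
      using sub by (auto simp: subalgebra_def)
    have "?B \<subseteq> sets (future_algebra t)"
      unfolding spG[symmetric] using measurable_sets[OF Y] by (intro sets.sigma_sets_subset) auto
    also have "\<dots> = sigma_sets (space M) ?G"
      unfolding future_algebra_def by (rule sets_measure_of) auto
    finally have B: "?B \<subseteq> sigma_sets (space M) ?G" .
    show "indep_set ?A ?B"
      using indep_setD_ev1[OF ind] indep_setD_ev2[OF ind] A B
      by (intro indep_setI indep_setD[OF ind]) blast+
  qed
qed

section \<open>The isometry of the Walsh integral\<close>

lemma rectangle_noise_set:
  assumes "0 \<le> t" "t \<le> a" "A \<in> sets borel" "A \<subseteq> D" "emeasure lborel A < \<infinity>"
  shows "{a<..b} \<times> A \<in> noise_sets {t<..} D" "{a<..b} \<times> A \<in> noise_sets {t<..b} D"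
proof -
  have s: "{a<..b} \<times> A \<in> sets (lborel \<Otimes>\<^sub>M lborel)"
    by (rule pair_measureI) (use assms in auto)
  then have "{a<..b} \<times> A \<in> sets (borel :: (real \<times> real) measure)"
    unfolding lborel_prod by (simp only: sets_lborel)
  moreover have "emeasure (lborel :: (real \<times> real) measure) ({a<..b} \<times> A) = emeasure lborel {a<..b} * emeasure lborel A"
    unfolding lborel_prod[symmetric]
    by (rule lborel.emeasure_pair_measure_Times) (use assms in auto)
  then have "emeasure (lborel :: (real \<times> real) measure) ({a<..b} \<times> A) < \<infinity>"
    using assms by (cases "a \<le> b") (auto simp: ennreal_mult_less_top)
  ultimately show "{a<..b} \<times> A \<in> noise_sets {t<..} D" "{a<..b} \<times> A \<in> noise_sets {t<..b} D"
    using assms by (auto simp: noise_sets_def)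
qed

definition simple_term :: "('a \<Rightarrow> real) \<times> real \<times> real \<times> real set \<Rightarrow> bool" where
  "simple_term e \<longleftrightarrow> is_elementary F D [e]"

definition term_integral :: "('a \<Rightarrow> real) \<times> real \<times> real \<times> real set \<Rightarrow> 'a \<Rightarrow> real" where
  "term_integral e \<omega> = elementary_integral w [e] \<omega>"

definition term_field :: "('a \<Rightarrow> real) \<times> real \<times> real \<times> real set \<Rightarrow> real \<Rightarrow> real \<Rightarrow> 'a \<Rightarrow> real" where
  "term_field e s y \<omega> = elementary_field [e] s y \<omega>"

definition term_set :: "('a \<Rightarrow> real) \<times> real \<times> real \<times> real set \<Rightarrow> (real \<times> real) set" where
  "term_set e = (case e of (Z, a, b, A) \<Rightarrow> {a<..b} \<times> A)"

lemma elementary_alt: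
  assumes "is_elementary F D es"
  shows "\<And>e. e \<in> set es \<Longrightarrow> simple_term e"
    "elementary_integral w es \<omega> = (\<Sum>i<length es. term_integral (es ! i) \<omega>)"
    "elementary_field es s y \<omega> = (\<Sum>i<length es. term_field (es ! i) s y \<omega>)"
  using assms
  by (auto simp: simple_term_def is_elementary_def elementary_integral_def term_integral_def
      term_field_def elementary_field_def sum_list_sum_nth atLeast0LessThan)

lemma simple_termD:
  assumes "simple_term (Z, a, b, A)"
  shows "0 \<le> a" "a < b" "A \<in> sets borel" "A \<subseteq> D" "emeasure lborel A < \<infinity>" "Z \<in> borel_measurable (F a)"
    "Z \<in> borel_measurable M" "\<exists>C. \<forall>\<omega>\<in>space M. \<bar>Z \<omega>\<bar> \<le> C" 
    "{a<..b} \<times> A \<in> noise_sets {0<..} D" "{a<..b} \<times> A \<in> noise_sets {a<..} D"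
proof -
  have sp: "space (F a) = space M" using noise unfolding white_noise_def subalgebra_def by blast
  show *: "0 \<le> a" "a < b" "A \<in> sets borel" "A \<subseteq> D" "emeasure lborel A < \<infinity>" "Z \<in> borel_measurable (F a)"
    "\<exists>C. \<forall>\<omega>\<in>space M. \<bar>Z \<omega>\<bar> \<le> C" 
    using assms by (auto simp: simple_term_def is_elementary_def sp)
  show "Z \<in> borel_measurable M" using past_measurable * by blast
  show "{a<..b} \<times> A \<in> noise_sets {0<..} D" "{a<..b} \<times> A \<in> noise_sets {a<..} D"
    using rectangle_noise_set(1)[of 0 a A b] rectangle_noise_set(1)[of a a A b] * by auto
qed

lemma bounded_mult_integrable:
  assumes f: "integrable M f" and [measurable]: "Z \<in> borel_measurable M" and C: "\<And>\<omega>. \<omega> \<in> space M \<Longrightarrow> \<bar>Z \<omega>\<bar> \<le> (C::real)"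
  shows "integrable M (\<lambda>\<omega>. Z \<omega> * f \<omega>)"
proof (rule Bochner_Integration.integrable_bound)
  note [measurable] = borel_measurable_integrable[OF f]
  show "integrable M (\<lambda>\<omega>. C * f \<omega>)" using f by simp
  show "(\<lambda>\<omega>. Z \<omega> * f \<omega>) \<in> borel_measurable M" by simp
  show "AE \<omega> in M. norm (Z \<omega> * f \<omega>) \<le> norm (C * f \<omega>)"
    using C by (intro AE_I2) (force simp: abs_mult intro!: mult_right_mono)
qed

text \<open>
  Split the earlier rectangle at time \<open>a'\<close>, where the later one starts. The part before \<open>a'\<close>
  belongs to the past and contributes \<open>0\<close>, because the later noise is centred and independent of it.
  The part after \<open>a'\<close> is noise of the future of \<open>a'\<close>, as is the later rectangle, so that the product
  of the two noises separates from the product of the two coefficients.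
\<close>

lemma term_covariance_ordered:
  assumes e: "simple_term (Z, a, b, A)" and e': "simple_term (Z', a', b', A')" and le: "a \<le> a'"
  shows "has_bochner_integral M (\<lambda>\<omega>. (Z \<omega> * w ({a<..b} \<times> A) \<omega>) * (Z' \<omega> * w ({a'<..b'} \<times> A') \<omega>))
    ((\<integral>\<omega>. Z \<omega> * Z' \<omega> \<partial>M) * measure lborel (({a<..b} \<times> A) \<inter> ({a'<..b'} \<times> A')))"
proof -
  note E = simple_termD[OF e] and E' = simple_termD[OF e']
  let ?B = "{a<..b} \<times> A" and ?B1 = "{a<..min b a'} \<times> A" and ?B2 = "{a'<..b} \<times> A" and ?B' = "{a'<..b'} \<times> A'"
  have B1: "?B1 \<in> noise_sets {0<..} D" "?B1 \<in> noise_sets {0<..a'} D"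
    using rectangle_noise_set[of 0 a A "min b a'"] E(1-5) by (auto simp: noise_sets_def)
  have B2: "?B2 \<in> noise_sets {0<..} D" "?B2 \<in> noise_sets {a'<..} D"
    using rectangle_noise_set(1)[of 0 a' A b] rectangle_noise_set(1)[of a' a' A b] E(1-5) E'(1) by auto
  note [measurable] = E(7) E'(7) w_measurable[OF B1(1)] w_measurable[OF B2(1)]
    w_measurable[OF E(9)] w_measurable[OF E'(9)]
  obtain C C' where C: "\<And>\<omega>. \<omega> \<in> space M \<Longrightarrow> \<bar>Z \<omega>\<bar> \<le> C" "\<And>\<omega>. \<omega> \<in> space M \<Longrightarrow> \<bar>Z' \<omega>\<bar> \<le> C'"
    using E(8) E'(8) by blast
  have Z0: "Z \<in> borel_measurable (F a')" by (rule filtration_measurable[OF le E(6)])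
  have ZZ: "\<And>\<omega>. \<omega> \<in> space M \<Longrightarrow> \<bar>Z \<omega> * Z' \<omega>\<bar> \<le> C * C'"
    using C by (fastforce simp: abs_mult intro!: mult_mono intro: order_trans[OF abs_ge_zero])
  have iZZ: "integrable M (\<lambda>\<omega>. Z \<omega> * Z' \<omega>)"
    by (rule integrable_const_bound[of _ "C * C'"]) (use ZZ in auto)
  let ?V = "\<lambda>\<omega>. (Z \<omega> * Z' \<omega>) * w ?B1 \<omega>"
  have V: "?V \<in> borel_measurable (F a')"
    using Z0 E'(6) w_past_measurable[OF E'(1) B1(2)] by measurable
  have iV: "integrable M ?V"
    by (rule bounded_mult_integrable[OF w_moments(2)[OF B1(1)] _ ZZ]) simp_all
  have ind1: "indep_var borel ?V borel (w ?B')"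
    by (rule past_future_indep[OF E'(1) V w_future_measurable[OF E'(10)]])
  have first: "has_bochner_integral M (\<lambda>\<omega>. ?V \<omega> * w ?B' \<omega>) 0"
    using indep_var_integrable[OF ind1 iV w_moments(2)[OF E'(9)]]
      indep_var_lebesgue_integral[OF ind1 iV w_moments(2)[OF E'(9)]] w_moments(3)[OF E'(9)]
    by (simp add: has_bochner_integral_iff)
  have ind2: "indep_var borel (\<lambda>\<omega>. Z \<omega> * Z' \<omega>) borel (\<lambda>\<omega>. w ?B2 \<omega> * w ?B' \<omega>)"
    by (rule past_future_indep[OF E'(1)])
      (use Z0 E'(6) w_future_measurable[OF B2(2)] w_future_measurable[OF E'(10)] in measurable)
  have second: "has_bochner_integral M (\<lambda>\<omega>. (Z \<omega> * Z' \<omega>) * (w ?B2 \<omega> * w ?B' \<omega>))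
     ((\<integral>\<omega>. Z \<omega> * Z' \<omega> \<partial>M) * measure lborel (?B2 \<inter> ?B'))"
    using indep_var_integrable[OF ind2 iZZ w_covariance(1)[OF B2(1) E'(9)]]
      indep_var_lebesgue_integral[OF ind2 iZZ w_covariance(1)[OF B2(1) E'(9)]]
      w_covariance(2)[OF B2(1) E'(9)]
    by (simp add: has_bochner_integral_iff)
  \<comment> \<open>If \<open>b \<le> a'\<close>, the part \<open>?B2\<close> is empty, and the same formulas hold.\<close>
  have "?B = ?B1 \<union> ?B2" "?B1 \<inter> ?B2 = {}" using le by auto
  then have AE: "AE \<omega> in M. w ?B \<omega> = w ?B1 \<omega> + w ?B2 \<omega>"
    using w_additive[OF B1(1) B2(1)] by simp
  have "?B \<inter> ?B' = ?B2 \<inter> ?B'" using le by auto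
  moreover have "has_bochner_integral M (\<lambda>\<omega>. (Z \<omega> * w ?B \<omega>) * (Z' \<omega> * w ?B' \<omega>))
     (0 + (\<integral>\<omega>. Z \<omega> * Z' \<omega> \<partial>M) * measure lborel (?B2 \<inter> ?B'))"
  proof (subst has_bochner_integral_cong_AE)
    show "AE \<omega> in M. (Z \<omega> * w ?B \<omega>) * (Z' \<omega> * w ?B' \<omega>) = ?V \<omega> * w ?B' \<omega> + (Z \<omega> * Z' \<omega>) * (w ?B2 \<omega> * w ?B' \<omega>)"
      using AE by eventually_elim (simp add: algebra_simps)
  qed (use has_bochner_integral_add[OF first second] in simp_all)
  ultimately show ?thesis by simp
qed

lemma term_covariance:
  assumes e: "simple_term e" and e': "simple_term e'"
  shows "has_bochner_integral M (\<lambda>\<omega>. term_integral e \<omega> * term_integral e' \<omega>)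
    ((\<integral>\<omega>. fst e \<omega> * fst e' \<omega> \<partial>M) * measure lborel (term_set e \<inter> term_set e'))"
proof -
  obtain Z a b A Z' a' b' A' where ee: "e = (Z, a, b, A)" "e' = (Z', a', b', A')"
    by (metis prod_cases4)
  show ?thesis
  proof (cases "a \<le> a'")
    case True
    then show ?thesis
      using term_covariance_ordered[of Z a b A Z' a' b' A'] assms
      by (simp add: ee term_integral_def elementary_integral_def term_set_def)
  next
    case False
    then show ?thesis
      using term_covariance_ordered[of Z' a' b' A' Z a b A] assms
      by (simp add: ee term_integral_def elementary_integral_def term_set_def mult.commute Int_commute)
  qed
qed

lemma term_mean:
  assumes e: "simple_term e"
  shows "has_bochner_integral M (term_integral e) 0"
proof -
  obtain Z a b A where ee: "e = (Z, a, b, A)" by (metis prod_cases4)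
  note E = simple_termD[OF e[unfolded ee]]
  note [measurable] = E(7)
  obtain C where C: "\<And>\<omega>. \<omega> \<in> space M \<Longrightarrow> \<bar>Z \<omega>\<bar> \<le> C" using E(8) by blast
  have iZ: "integrable M Z" by (rule integrable_const_bound[of _ C]) (use C in auto)
  have ind: "indep_var borel Z borel (w ({a<..b} \<times> A))"
    by (rule past_future_indep[OF E(1,6) w_future_measurable[OF E(10)]])
  show ?thesis
    using indep_var_integrable[OF ind iZ w_moments(2)[OF E(9)]]
      indep_var_lebesgue_integral[OF ind iZ w_moments(2)[OF E(9)]] w_moments(3)[OF E(9)]
    by (simp add: has_bochner_integral_iff ee term_integral_def[abs_def] elementary_integral_def)
qed

abbreviation time_space :: "real measure" where
  "time_space \<equiv> restrict_space lborel {0<..}"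

abbreviation domain_space :: "real measure" where
  "domain_space \<equiv> restrict_space lborel D"

abbreviation sq_mean :: "('a \<Rightarrow> real) \<Rightarrow> ennreal" where
  "sq_mean Y \<equiv> \<integral>\<^sup>+\<omega>. ennreal ((Y \<omega>)\<^sup>2) \<partial>M"

abbreviation field_space :: "(real \<times> 'a \<times> real) measure" where
  "field_space \<equiv> time_space \<Otimes>\<^sub>M M \<Otimes>\<^sub>M domain_space"

lemma sigma_finite_time: "sigma_finite_measure time_space"
  by (intro sigma_finite_measure_restrict_space sigma_finite_lborel) simp

lemma sigma_finite_domain: "sigma_finite_measure domain_space"
  by (intro sigma_finite_measure_restrict_space sigma_finite_lborel) simp

text \<open>
  The two orders of integration that are needed: with the probability space outermost for the
  isometry of elementary fields, and innermost for the second moment of the solution.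
\<close>

lemma nn_integral_field_space:
  assumes [measurable]: "(\<lambda>(s, \<omega>, y). g s \<omega> y) \<in> borel_measurable field_space"
  shows "(\<integral>\<^sup>+(s, \<omega>, y). g s \<omega> y \<partial>field_space) = (\<integral>\<^sup>+\<omega>. \<integral>\<^sup>+s. \<integral>\<^sup>+y. g s \<omega> y \<partial>domain_space \<partial>time_space \<partial>M)"
    and "(\<integral>\<^sup>+(s, \<omega>, y). g s \<omega> y \<partial>field_space) = (\<integral>\<^sup>+s. \<integral>\<^sup>+y. \<integral>\<^sup>+\<omega>. g s \<omega> y \<partial>M \<partial>domain_space \<partial>time_space)"
proof -
  interpret T: sigma_finite_measure time_space by (rule sigma_finite_time)
  interpret S: sigma_finite_measure domain_space by (rule sigma_finite_domain)
  interpret MS: pair_sigma_finite M domain_space ..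
  interpret TM: pair_sigma_finite time_space M ..
  have m: "(\<lambda>z. g s (fst z) (snd z)) \<in> borel_measurable (M \<Otimes>\<^sub>M domain_space)" if "s \<in> space time_space" for s
  proof -
    have "(\<lambda>z. (\<lambda>(s, \<omega>, y). g s \<omega> y) (s, z)) \<in> borel_measurable (M \<Otimes>\<^sub>M domain_space)"
      using that by measurable
    then show ?thesis by (simp add: case_prod_beta)
  qed
  have "(\<integral>\<^sup>+(s, \<omega>, y). g s \<omega> y \<partial>field_space) = (\<integral>\<^sup>+s. \<integral>\<^sup>+z. g s (fst z) (snd z) \<partial>(M \<Otimes>\<^sub>M domain_space) \<partial>time_space)"
    using MS.P.nn_integral_fst[OF assms] by (simp add: case_prod_beta)
  also have "\<dots> = (\<integral>\<^sup>+s. \<integral>\<^sup>+\<omega>. \<integral>\<^sup>+y. g s \<omega> y \<partial>domain_space \<partial>M \<partial>time_space)"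
    using S.nn_integral_fst[OF m] by (intro nn_integral_cong) simp
  finally have eq: "(\<integral>\<^sup>+(s, \<omega>, y). g s \<omega> y \<partial>field_space) = (\<integral>\<^sup>+s. \<integral>\<^sup>+\<omega>. \<integral>\<^sup>+y. g s \<omega> y \<partial>domain_space \<partial>M \<partial>time_space)" .
  have "(\<lambda>(s, \<omega>). \<integral>\<^sup>+y. (\<lambda>(s, \<omega>, y). g s \<omega> y) (s, \<omega>, y) \<partial>domain_space) \<in> borel_measurable (time_space \<Otimes>\<^sub>M M)"
    by measurable
  then show "(\<integral>\<^sup>+(s, \<omega>, y). g s \<omega> y \<partial>field_space) = (\<integral>\<^sup>+\<omega>. \<integral>\<^sup>+s. \<integral>\<^sup>+y. g s \<omega> y \<partial>domain_space \<partial>time_space \<partial>M)"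
    unfolding eq by (intro TM.Fubini'[symmetric]) simp
  have "(\<integral>\<^sup>+\<omega>. \<integral>\<^sup>+y. g s \<omega> y \<partial>domain_space \<partial>M) = (\<integral>\<^sup>+y. \<integral>\<^sup>+\<omega>. g s \<omega> y \<partial>M \<partial>domain_space)"
    if "s \<in> space time_space" for s
    using m[OF that] by (intro MS.Fubini'[symmetric]) (simp add: case_prod_beta)
  then show "(\<integral>\<^sup>+(s, \<omega>, y). g s \<omega> y \<partial>field_space) = (\<integral>\<^sup>+s. \<integral>\<^sup>+y. \<integral>\<^sup>+\<omega>. g s \<omega> y \<partial>M \<partial>domain_space \<partial>time_space)"
    unfolding eq by (intro nn_integral_cong)
qed

lemma predictable_imp_measurable:
  assumes "predictable M F D f"
  shows "(\<lambda>(s, \<omega>, y). f s y \<omega>) \<in> borel_measurable field_space"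
proof -
  have sF: "sets (F a) \<subseteq> sets M" for a
    using noise unfolding white_noise_def subalgebra_def by blast
  have "subalgebra field_space (predictable_algebra M F D)"
    unfolding subalgebra_def
  proof
    show "space (predictable_algebra M F D) = space field_space"
      by (simp add: predictable_algebra_def space_measure_of_conv space_pair_measure)
    let ?G = "{{a<..b} \<times> G \<times> A | a b G A.
          0 \<le> a \<and> a < b \<and> G \<in> sets (F a) \<and> A \<in> sets borel \<and> A \<subseteq> D}"
    have G: "?G \<subseteq> sets field_space"
    proof clarify
      fix a b :: real and G A
      assume a: "0 \<le> a" "a < b" "G \<in> sets (F a)" "A \<in> sets borel" "A \<subseteq> D"
      have "{a<..b} \<in> sets time_space" using a by (subst sets_restrict_space_iff) auto
      moreover have "A \<in> sets domain_space" using a by (subst sets_restrict_space_iff) auto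
      ultimately show "{a<..b} \<times> G \<times> A \<in> sets field_space"
        using a sF[of a] by (intro pair_measureI) auto
    qed
    have "sigma_sets (space field_space) ?G \<subseteq> sets field_space"
      by (rule sets.sigma_sets_subset[OF G])
    moreover have "?G \<subseteq> Pow ({0<..} \<times> space M \<times> D)"
      using order_trans[OF G sets.space_closed] by (simp add: space_pair_measure)
    ultimately show "sets (predictable_algebra M F D) \<subseteq> sets field_space"
      unfolding predictable_algebra_def by (simp add: space_pair_measure)
  qed
  then show ?thesis
    using assms unfolding predictable_def by (rule measurable_from_subalg)
qed

lemma simple_term_coefficient:
  assumes "simple_term e"
  shows "fst e \<in> borel_measurable M" "\<exists>C. \<forall>\<omega>\<in>space M. \<bar>fst e \<omega>\<bar> \<le> C" "integrable M (fst e)"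
    "term_set e \<in> noise_sets {0<..} D"
proof -
  obtain Z a b A where e: "e = (Z, a, b, A)" by (metis prod_cases4)
  note E = simple_termD[OF assms[unfolded e]]
  show "fst e \<in> borel_measurable M" "\<exists>C. \<forall>\<omega>\<in>space M. \<bar>fst e \<omega>\<bar> \<le> C" "term_set e \<in> noise_sets {0<..} D"
    using E(7-9) by (simp_all add: e term_set_def)
  then obtain C where "\<And>\<omega>. \<omega> \<in> space M \<Longrightarrow> \<bar>fst e \<omega>\<bar> \<le> C" by blast
  with \<open>fst e \<in> borel_measurable M\<close> show "integrable M (fst e)"
    by (intro integrable_const_bound[of _ C]) auto
qed

text \<open>
  For each fixed \<open>\<omega>\<close> the squared field integrates over time and space to the quadratic form
  \<open>\<Sum> Z i * Z j * \<bar>B i \<inter> B j\<bar>\<close>; its expectation is the second moment of the integral by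
  \<open>term_covariance\<close>. Overlapping rectangles are covered, since the form records all
  intersections.
\<close>

lemma elementary_isometry:
  assumes es: "is_elementary F D es"
  shows "(\<lambda>(s, \<omega>, y). elementary_field es s y \<omega>) \<in> borel_measurable field_space"
    and "elementary_integral w es \<in> borel_measurable M"
    and "integrable M (elementary_integral w es)" "(\<integral>\<omega>. elementary_integral w es \<omega> \<partial>M) = 0"
    and "sq_mean (elementary_integral w es) < \<infinity>"
    and "(\<integral>\<^sup>+(s, \<omega>, y). ennreal ((elementary_field es s y \<omega>)\<^sup>2) \<partial>field_space)
         = sq_mean (elementary_integral w es)"
proof -
  define n Z B where "n = length es" and "Z i = fst (es ! i)" and "B i = term_set (es ! i)" for i
  define m where "m i j = measure lborel (B i \<inter> B j)" for i j
  have st: "simple_term (es ! i)" if "i < n" for i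
    using elementary_alt(1)[OF es] that by (simp add: n_def)
  note Z = simple_term_coefficient[OF st, folded Z_def B_def]
  have field: "term_field (es ! i) s y \<omega> = Z i \<omega> * indicator (B i) (s, y)" for i s y \<omega>
    by (simp add: Z_def B_def term_field_def term_set_def elementary_field_def indicator_def split: prod.split)
  have ZZ: "integrable M (\<lambda>\<omega>. Z i \<omega> * Z j \<omega>)" if ij: "i < n" "j < n" for i j
  proof -
    obtain C where "\<And>\<omega>. \<omega> \<in> space M \<Longrightarrow> \<bar>Z i \<omega>\<bar> \<le> C" using Z(2)[OF ij(1)] by blast
    then show ?thesis using Z(3)[OF ij(2)] Z(1)[OF ij(1)] by (intro bounded_mult_integrable) auto
  qed
  have Bs: "B i \<in> sets borel" "B i \<in> sets lborel" "B i \<subseteq> {0<..} \<times> D" "emeasure lborel (B i) < \<infinity>" if "i < n" for i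
    using Z(4)[OF that] by (auto simp: noise_sets_def)
  have Ef: "elementary_field es s y \<omega> = (\<Sum>i<n. Z i \<omega> * indicator (B i) (s, y))" for s y \<omega>
    by (simp add: elementary_alt(3)[OF es] field n_def)
  have "(\<lambda>(s, \<omega>, y). indicator (B i) (s, y) :: real) \<in> borel_measurable field_space" if "i < n" for i
  proof -
    have t: "(\<lambda>z. fst z) \<in> field_space \<rightarrow>\<^sub>M borel"
      by (rule measurable_compose[OF measurable_fst]) (simp add: measurable_restrict_space1)
    have d: "(\<lambda>z. snd (snd z)) \<in> field_space \<rightarrow>\<^sub>M borel"
      by (rule measurable_compose[OF measurable_snd], rule measurable_compose[OF measurable_snd]) (simp add: measurable_restrict_space1)
    have "(\<lambda>z. (fst z, snd (snd z))) \<in> field_space \<rightarrow>\<^sub>M borel \<Otimes>\<^sub>M borel"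
      by (rule measurable_Pair[OF t d])
    then have "(\<lambda>z. (fst z, snd (snd z))) \<in> field_space \<rightarrow>\<^sub>M borel" unfolding borel_prod .
    from measurable_compose[OF this borel_measurable_indicator[OF Bs(1)[OF that]]]
    show ?thesis by (simp add: case_prod_beta')
  qed
  note [measurable] = this
  show mE [measurable]: "(\<lambda>(s, \<omega>, y). elementary_field es s y \<omega>) \<in> borel_measurable field_space"
  proof -
    have "(\<lambda>z. \<Sum>i<n. Z i (fst (snd z)) * (\<lambda>(s, \<omega>, y). indicator (B i) (s, y)) z) \<in> borel_measurable field_space"
    proof (intro borel_measurable_sum borel_measurable_times)
      fix i assume "i \<in> {..<n}"
      then have "Z i \<in> borel_measurable M" using Z by simp
      then show "(\<lambda>z. Z i (fst (snd z))) \<in> borel_measurable field_space" by measurable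
    qed simp
    then show ?thesis by (simp add: Ef case_prod_beta')
  qed
  have int: "has_bochner_integral M (\<lambda>\<omega>. (elementary_integral w es \<omega>)\<^sup>2) (\<Sum>i<n. \<Sum>j<n. (\<integral>\<omega>. Z i \<omega> * Z j \<omega> \<partial>M) * m i j)"
    unfolding elementary_alt(2)[OF es] power2_eq_square sum_product n_def[symmetric]
    by (intro has_bochner_integral_sum) (use term_covariance[OF st st] in \<open>simp add: Z_def m_def B_def\<close>)
  have mean: "has_bochner_integral M (elementary_integral w es) (\<Sum>i<n. 0)"
    unfolding elementary_alt(2)[OF es, abs_def] n_def[symmetric]
    by (intro has_bochner_integral_sum) (use term_mean[OF st] in simp)
  then show "integrable M (elementary_integral w es)" "(\<integral>\<omega>. elementary_integral w es \<omega> \<partial>M) = 0"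
    by (auto simp: has_bochner_integral_iff)
  then show "elementary_integral w es \<in> borel_measurable M" by simp
  have I: "sq_mean (elementary_integral w es) = ennreal (\<Sum>i<n. \<Sum>j<n. (\<integral>\<omega>. Z i \<omega> * Z j \<omega> \<partial>M) * m i j)"
    using int by (subst nn_integral_eq_integral) (auto simp: has_bochner_integral_iff)
  then show "sq_mean (elementary_integral w es) < \<infinity>" by simp
  have inner: "0 \<le> (\<Sum>i<n. \<Sum>j<n. Z i \<omega> * Z j \<omega> * m i j) \<and>
    (\<integral>\<^sup>+s. \<integral>\<^sup>+y. ennreal ((elementary_field es s y \<omega>)\<^sup>2) \<partial>domain_space \<partial>time_space)
      = ennreal (\<Sum>i<n. \<Sum>j<n. Z i \<omega> * Z j \<omega> * m i j)" for \<omega>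
  proof -
    let ?f = "\<lambda>z. (\<Sum>i<n. Z i \<omega> * indicator (B i) z)\<^sup>2 :: real"
    have sq: "?f z = (\<Sum>i<n. \<Sum>j<n. Z i \<omega> * Z j \<omega> * indicator (B i \<inter> B j) z)" for z
      unfolding power2_eq_square sum_product indicator_inter_arith
      by (intro sum.cong) (simp_all only: mult_ac)
    have hb: "has_bochner_integral lborel ?f (\<Sum>i<n. \<Sum>j<n. Z i \<omega> * Z j \<omega> * m i j)"
      unfolding sq
    proof (intro has_bochner_integral_sum has_bochner_integral_mult_right)
      fix i j assume ij: "i \<in> {..<n}" "j \<in> {..<n}"
      have "emeasure lborel (B i \<inter> B j) \<le> emeasure lborel (B i)"
        using ij Bs by (intro emeasure_mono) auto
      also have "\<dots> < \<infinity>" using Bs ij by auto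
      finally show "has_bochner_integral lborel (\<lambda>z. indicator (B i \<inter> B j) z) (m i j)"
        unfolding m_def using ij Bs by (intro has_bochner_integral_real_indicator) auto
    qed
    have F: "(\<integral>\<^sup>+z. ennreal (?f z) \<partial>lborel) = ennreal (\<Sum>i<n. \<Sum>j<n. Z i \<omega> * Z j \<omega> * m i j)"
      unfolding has_bochner_integral_integral_eq[OF hb, symmetric]
      by (rule nn_integral_eq_integral[OF integrable.intros[OF hb]]) simp
    have nn: "0 \<le> (\<Sum>i<n. \<Sum>j<n. Z i \<omega> * Z j \<omega> * m i j)"
      unfolding has_bochner_integral_integral_eq[OF hb, symmetric]
      by (rule Bochner_Integration.integral_nonneg) simp
    have out: "?f (s, y) = 0" if "s \<notin> {0<..} \<or> y \<notin> D" for s y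
    proof -
      have "indicator (B i) (s, y) = (0::real)" if "i < n" for i
        using Bs(3)[OF that] \<open>s \<notin> {0<..} \<or> y \<notin> D\<close> by (auto simp: indicator_def)
      then show ?thesis by simp
    qed
    have m1: "?f \<in> borel_measurable (borel \<Otimes>\<^sub>M borel)"
      unfolding borel_prod using Bs by (intro borel_measurable_power borel_measurable_sum borel_measurable_times) auto
    have "(\<integral>\<^sup>+s. \<integral>\<^sup>+y. ennreal ((elementary_field es s y \<omega>)\<^sup>2) \<partial>domain_space \<partial>time_space)
      = (\<integral>\<^sup>+s. (\<integral>\<^sup>+y. ennreal (?f (s, y)) * indicator D y \<partial>lborel) * indicator {0<..} s \<partial>lborel)"
      by (simp add: nn_integral_restrict_space Ef)
    also have "\<dots> = (\<integral>\<^sup>+s. \<integral>\<^sup>+y. ennreal (?f (s, y)) \<partial>lborel \<partial>lborel)"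
    proof (intro nn_integral_cong)
      fix s
      show "(\<integral>\<^sup>+y. ennreal (?f (s, y)) * indicator D y \<partial>lborel) * indicator {0<..} s = (\<integral>\<^sup>+y. ennreal (?f (s, y)) \<partial>lborel)"
      proof (cases "s \<in> {0<..}")
        case True
        then show ?thesis using out by (auto intro!: nn_integral_cong simp: indicator_def)
      next
        case False
        then have "?f (s, y) = 0" for y using out by blast
        then show ?thesis using False by simp
      qed
    qed
    also have "\<dots> = (\<integral>\<^sup>+z. ennreal (?f z) \<partial>(lborel \<Otimes>\<^sub>M lborel))"
      using m1 by (intro lborel.nn_integral_fst) simp
    also have "\<dots> = ennreal (\<Sum>i<n. \<Sum>j<n. Z i \<omega> * Z j \<omega> * m i j)"
      unfolding lborel_prod by (rule F)
    finally show ?thesis using nn by blast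
  qed
  have "(\<integral>\<^sup>+(s, \<omega>, y). ennreal ((elementary_field es s y \<omega>)\<^sup>2) \<partial>field_space)
    = (\<integral>\<^sup>+\<omega>. \<integral>\<^sup>+s. \<integral>\<^sup>+y. ennreal ((elementary_field es s y \<omega>)\<^sup>2) \<partial>domain_space \<partial>time_space \<partial>M)"
  proof (rule nn_integral_field_space(1))
    have "(\<lambda>z. ennreal (((\<lambda>(s, \<omega>, y). elementary_field es s y \<omega>) z)\<^sup>2)) \<in> borel_measurable field_space"
      by measurable
    then show "(\<lambda>(s, \<omega>, y). ennreal ((elementary_field es s y \<omega>)\<^sup>2)) \<in> borel_measurable field_space"
      by (simp add: case_prod_beta)
  qed
  also have "\<dots> = (\<integral>\<^sup>+\<omega>. ennreal (\<Sum>i<n. \<Sum>j<n. Z i \<omega> * Z j \<omega> * m i j) \<partial>M)"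
    using inner by simp
  also have "\<dots> = ennreal (\<Sum>i<n. \<Sum>j<n. (\<integral>\<omega>. Z i \<omega> * Z j \<omega> \<partial>M) * m i j)"
  proof -
    have "has_bochner_integral M (\<lambda>\<omega>. \<Sum>i<n. \<Sum>j<n. Z i \<omega> * Z j \<omega> * m i j) (\<Sum>i<n. \<Sum>j<n. (\<integral>\<omega>. Z i \<omega> * Z j \<omega> \<partial>M) * m i j)"
      by (intro has_bochner_integral_sum has_bochner_integral_mult_left)
        (use ZZ in \<open>auto simp: has_bochner_integral_iff\<close>)
    then show ?thesis using inner
      by (subst nn_integral_eq_integral) (auto simp: has_bochner_integral_iff)
  qed
  finally show "(\<integral>\<^sup>+(s, \<omega>, y). ennreal ((elementary_field es s y \<omega>)\<^sup>2) \<partial>field_space)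
         = sq_mean (elementary_integral w es)"
    unfolding I .
qed

text \<open>
  Both sides pass to the mean-square limit. The mean is \<open>0\<close> because it is within the mean-square
  distance of the mean of an elementary integral, which is \<open>0\<close>.
\<close>

lemma walsh_isometry:
  assumes W: "has_walsh_integral M F D w f I"
  shows "integrable M (\<lambda>\<omega>. (I \<omega>)\<^sup>2)" "integrable M I" "(\<integral>\<omega>. I \<omega> \<partial>M) = 0"
    and "sq_mean I = (\<integral>\<^sup>+(s, \<omega>, y). ennreal ((f s y \<omega>)\<^sup>2) \<partial>field_space)"
proof -
  obtain es where es: "\<And>n. is_elementary F D (es n)"
    and fl: "(\<lambda>n. \<integral>\<^sup>+(s, \<omega>, y). ennreal ((elementary_field (es n) s y \<omega> - f s y \<omega>)\<^sup>2) \<partial>field_space) \<longlonglongrightarrow> 0"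
    and Il: "(\<lambda>n. \<integral>\<^sup>+\<omega>. ennreal ((elementary_integral w (es n) \<omega> - I \<omega>)\<^sup>2) \<partial>M) \<longlonglongrightarrow> 0"
    and pr: "predictable M F D f" and Im [measurable]: "I \<in> borel_measurable M"
    using W unfolding has_walsh_integral_def by blast
  note iso = elementary_isometry[OF es]
  note [measurable] = iso(2) predictable_imp_measurable[OF pr]
  have "sq_mean I = (\<integral>\<^sup>+z. ennreal (((\<lambda>(s, \<omega>, y). f s y \<omega>) z)\<^sup>2) \<partial>field_space)"
  proof (rule L2_limit_norm_eq[where fn = "\<lambda>n (s, \<omega>, y). elementary_field (es n) s y \<omega>" and gn = "\<lambda>n. elementary_integral w (es n)"])
    show "(\<lambda>(s, \<omega>, y). elementary_field (es n) s y \<omega>) \<in> borel_measurable field_space" for n by (rule iso(1))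
    show "(\<lambda>(s, \<omega>, y). f s y \<omega>) \<in> borel_measurable field_space" by (rule predictable_imp_measurable[OF pr])
  qed (use iso(6) fl Il in \<open>simp_all add: case_prod_beta'\<close>)
  then show "sq_mean I = (\<integral>\<^sup>+(s, \<omega>, y). ennreal ((f s y \<omega>)\<^sup>2) \<partial>field_space)"
    by (simp add: case_prod_beta')
  have "eventually (\<lambda>n. sq_mean (\<lambda>\<omega>. elementary_integral w (es n) \<omega> - I \<omega>) < 1) sequentially"
    using order_tendstoD(2)[OF Il, of 1] by simp
  then obtain n where n: "sq_mean (\<lambda>\<omega>. elementary_integral w (es n) \<omega> - I \<omega>) < 1"
    by (auto simp: eventually_sequentially)
  have "sq_mean I \<le> ennreal (1 + 1) * sq_mean (elementary_integral w (es n))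
    + ennreal (1 + 1 / 1) * sq_mean (\<lambda>\<omega>. elementary_integral w (es n) \<omega> - I \<omega>)"
    by (rule nn_integral_square_le) simp_all
  also have "\<dots> < \<infinity>" 
    using iso(5)[of n] less_trans[OF n, of \<infinity>] by (simp add: ennreal_mult_less_top del: ennreal_plus)
  finally show I2: "integrable M (\<lambda>\<omega>. (I \<omega>)\<^sup>2)"
    by (intro integrableI_nonneg) simp_all
  show I1: "integrable M I"
    using square_integrable_mult[of I M "\<lambda>_. 1"] I2 by simp
  have sqle: "ennreal ((\<integral>\<omega>. I \<omega> \<partial>M)\<^sup>2) \<le> sq_mean (\<lambda>\<omega>. elementary_integral w (es n) \<omega> - I \<omega>)" for n
  proof (cases "sq_mean (\<lambda>\<omega>. elementary_integral w (es n) \<omega> - I \<omega>) = \<infinity>")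
    case False
    let ?X = "\<lambda>\<omega>. elementary_integral w (es n) \<omega> - I \<omega>"
    have X2: "integrable M (\<lambda>\<omega>. (?X \<omega>)\<^sup>2)"
      by (intro integrableI_nonneg) (use False in \<open>simp_all add: less_top\<close>)
    have X1: "integrable M ?X" using iso(3) I1 by simp
    have EX: "(\<integral>\<omega>. ?X \<omega> \<partial>M) = - (\<integral>\<omega>. I \<omega> \<partial>M)" using iso(3,4) I1 by simp
    have "(\<integral>\<omega>. ?X \<omega> \<partial>M)\<^sup>2 \<le> (\<integral>\<omega>. (?X \<omega>)\<^sup>2 \<partial>M)"
      using variance_eq[OF X1 X2] variance_positive[of ?X] by simp
    then show ?thesis unfolding EX
      by (subst nn_integral_eq_integral[OF X2]) (auto intro: ennreal_leI)
  qed simp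
  have "ennreal ((\<integral>\<omega>. I \<omega> \<partial>M)\<^sup>2) \<le> 0"
    using Il sqle by (intro LIMSEQ_le_const) blast+
  then show "(\<integral>\<omega>. I \<omega> \<partial>M) = 0" by simp
qed


section \<open>The second moment of a mild solution\<close>

lemma predictable_section_measurable:
  assumes f: "predictable M F D f" and s: "0 < s"
  shows "(\<lambda>(\<omega>, y). f s y \<omega>) \<in> borel_measurable (M \<Otimes>\<^sub>M domain_space)"
    and "y \<in> D \<Longrightarrow> f s y \<in> borel_measurable M"
proof -
  note [measurable] = predictable_imp_measurable[OF f]
  have s: "s \<in> space time_space" using s by simp
  have "(\<lambda>z. (\<lambda>(s, \<omega>, y). f s y \<omega>) (s, z)) \<in> borel_measurable (M \<Otimes>\<^sub>M domain_space)"
    using s by measurable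
  then show m: "(\<lambda>(\<omega>, y). f s y \<omega>) \<in> borel_measurable (M \<Otimes>\<^sub>M domain_space)"
    by (simp add: case_prod_beta')
  assume "y \<in> D"
  then have [measurable]: "y \<in> space domain_space" by simp
  have "(\<lambda>\<omega>. (\<lambda>(\<omega>, y). f s y \<omega>) (\<omega>, y)) \<in> borel_measurable M"
    using m by measurable
  then show "f s y \<in> borel_measurable M" by simp
qed

abbreviation square_kernel :: "(real \<Rightarrow> real \<Rightarrow> real \<Rightarrow> real) \<Rightarrow> real \<Rightarrow> real \<Rightarrow> real \<Rightarrow> real \<Rightarrow> ennreal" where
  "square_kernel p L r x y \<equiv> ennreal (L\<^sup>2) * (ennreal ((p r x y)\<^sup>2) * indicator D y)"

text \<open>
  The cross term \<open>2 l (P\<^sub>t u\<^sub>0)(x) E I\<close> vanishes since the stochastic integral is centred.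
\<close>

lemma second_moment_identity:
  assumes sol: "mild_solution M F D w p \<sigma> u0 l u" and \<sigma> [measurable]: "\<sigma> \<in> borel_measurable borel"
    and t: "0 < t" and x: "x \<in> D"
  shows "sq_mean (u t x) = ennreal ((LINT y:D|lebesgue. u0 y * p t x y)\<^sup>2)
    + ennreal (l\<^sup>2) * volterra (square_kernel p 1) (\<lambda>s y. sq_mean (\<lambda>\<omega>. \<sigma> (u s y \<omega>))) t x"
proof -
  let ?c = "LINT y:D|lebesgue. u0 y * p t x y"
  let ?f = "\<lambda>s y \<omega>. indicator {0<..<t} s * (p (t - s) x y * \<sigma> (u s y \<omega>))"
  obtain I where W: "has_walsh_integral M F D w ?f I"
    and uI: "AE \<omega> in M. u t x \<omega> = ?c + l * I \<omega>"
    using sol t x unfolding mild_solution_def by blast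
  have pu: "predictable M F D u" using sol unfolding mild_solution_def by blast
  have pf: "predictable M F D ?f" using W unfolding has_walsh_integral_def by blast
  note iso = walsh_isometry[OF W]
  have sq: "(?c + l * I \<omega>)\<^sup>2 = ?c\<^sup>2 + (2 * ?c * l * I \<omega> + l\<^sup>2 * (I \<omega>)\<^sup>2)" for \<omega>
    by (simp add: power2_sum power_mult_distrib)
  have "sq_mean (u t x) = (\<integral>\<^sup>+\<omega>. ennreal ((?c + l * I \<omega>)\<^sup>2) \<partial>M)"
    using uI by (intro nn_integral_cong_AE) auto
  also have "\<dots> = ennreal (\<integral>\<omega>. (?c + l * I \<omega>)\<^sup>2 \<partial>M)"
  proof (rule nn_integral_eq_integral)
    show "integrable M (\<lambda>\<omega>. (?c + l * I \<omega>)\<^sup>2)" unfolding sq using iso(1,2) by simp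
  qed simp
  also have "(\<integral>\<omega>. (?c + l * I \<omega>)\<^sup>2 \<partial>M) = ?c\<^sup>2 + l\<^sup>2 * (\<integral>\<omega>. (I \<omega>)\<^sup>2 \<partial>M)"
    unfolding sq using iso(1-3) by (simp add: prob_space)
  also have "ennreal \<dots> = ennreal (?c\<^sup>2) + ennreal (l\<^sup>2) * ennreal (\<integral>\<omega>. (I \<omega>)\<^sup>2 \<partial>M)"
    by (simp add: ennreal_mult)
  also have "ennreal (\<integral>\<omega>. (I \<omega>)\<^sup>2 \<partial>M) = sq_mean I"
    using iso(1) by (intro nn_integral_eq_integral[symmetric]) auto
  also have "\<dots> = (\<integral>\<^sup>+s. \<integral>\<^sup>+y. sq_mean (?f s y) \<partial>domain_space \<partial>time_space)"
    unfolding iso(4)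
  proof (rule nn_integral_field_space(2))
    note [measurable] = predictable_imp_measurable[OF pf]
    have "(\<lambda>z. ennreal (((\<lambda>(s, \<omega>, y). ?f s y \<omega>) z)\<^sup>2)) \<in> borel_measurable field_space"
      by measurable
    then show "(\<lambda>(s, \<omega>, y). ennreal ((?f s y \<omega>)\<^sup>2)) \<in> borel_measurable field_space"
      by (simp add: case_prod_beta')
  qed
  also have "\<dots> = (\<integral>\<^sup>+s. (\<integral>\<^sup>+y. sq_mean (?f s y) * indicator D y \<partial>lborel) * indicator {0<..} s \<partial>lborel)"
    by (simp add: nn_integral_restrict_space)
  also have "\<dots> = volterra (square_kernel p 1) (\<lambda>s y. sq_mean (\<lambda>\<omega>. \<sigma> (u s y \<omega>))) t x"
  proof (intro nn_integral_cong)
    fix s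
    have "sq_mean (?f s y) * indicator D y = square_kernel p 1 (t - s) x y * sq_mean (\<lambda>\<omega>. \<sigma> (u s y \<omega>))"
      if s: "s \<in> {0<..<t}" for y
    proof (cases "y \<in> D")
      case True
      have [measurable]: "u s y \<in> borel_measurable M"
        by (rule predictable_section_measurable(2)[OF pu _ True]) (use s in auto)
      have "sq_mean (?f s y) = (\<integral>\<^sup>+\<omega>. ennreal ((p (t - s) x y)\<^sup>2) * ennreal ((\<sigma> (u s y \<omega>))\<^sup>2) \<partial>M)"
        using s by (intro nn_integral_cong) (simp add: power_mult_distrib ennreal_mult)
      also have "\<dots> = ennreal ((p (t - s) x y)\<^sup>2) * sq_mean (\<lambda>\<omega>. \<sigma> (u s y \<omega>))"
        by (rule nn_integral_cmult) simp
      finally show ?thesis using True by simp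
    qed simp
    then show "(\<integral>\<^sup>+y. sq_mean (?f s y) * indicator D y \<partial>lborel) * indicator {0<..} s
      = indicator {0<..<t} s * (\<integral>\<^sup>+y. square_kernel p 1 (t - s) x y * sq_mean (\<lambda>\<omega>. \<sigma> (u s y \<omega>)) \<partial>lborel)"
      by (cases "s \<in> {0<..<t}") auto
  qed
  finally show ?thesis .
qed

lemma sq_mean_mono:
  assumes [measurable]: "Y \<in> borel_measurable M" and "\<And>\<omega>. \<bar>Z \<omega>\<bar> \<le> L * \<bar>Y \<omega>\<bar>"
  shows "sq_mean Z \<le> ennreal (L\<^sup>2) * sq_mean Y"
proof -
  have "sq_mean Z \<le> (\<integral>\<^sup>+\<omega>. ennreal (L\<^sup>2) * ennreal ((Y \<omega>)\<^sup>2) \<partial>M)"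
  proof (intro nn_integral_mono)
    fix \<omega>
    have "\<bar>Z \<omega>\<bar>\<^sup>2 \<le> (L * \<bar>Y \<omega>\<bar>)\<^sup>2" by (intro power_mono assms) simp
    then show "ennreal ((Z \<omega>)\<^sup>2) \<le> ennreal (L\<^sup>2) * ennreal ((Y \<omega>)\<^sup>2)"
      by (simp add: ennreal_mult[symmetric] power_mult_distrib)
  qed
  then show ?thesis by (simp add: nn_integral_cmult)
qed

lemma volterra_mono:
  assumes "\<And>s y. 0 < s \<Longrightarrow> y \<in> D \<Longrightarrow> ennreal (K\<^sup>2) * f s y \<le> ennreal (L\<^sup>2) * g s y"
  shows "volterra (square_kernel p K) f t x \<le> volterra (square_kernel p L) g t x"
proof (intro nn_integral_mono)
  fix s
  show "indicator {0<..<t} s * (\<integral>\<^sup>+y. square_kernel p K (t - s) x y * f s y \<partial>lborel)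
    \<le> indicator {0<..<t} s * (\<integral>\<^sup>+y. square_kernel p L (t - s) x y * g s y \<partial>lborel)"
  proof (cases "s \<in> {0<..<t}")
    case True
    have "square_kernel p K (t - s) x y * f s y \<le> square_kernel p L (t - s) x y * g s y" for y
      using mult_left_mono[OF assms[of s y], of "ennreal ((p (t - s) x y)\<^sup>2)"] True
      by (cases "y \<in> D") (auto simp: mult_ac)
    then show ?thesis by (intro mult_left_mono nn_integral_mono) auto
  qed simp
qed

lemma second_moment_upper:
  assumes sol: "mild_solution M F D w p \<sigma> u0 l u" and \<sigma>: "\<sigma> \<in> borel_measurable borel"
    and L: "\<And>x. \<bar>\<sigma> x\<bar> \<le> L * \<bar>x\<bar>" and tx: "0 < t" "x \<in> D"
    and c: "(LINT y:D|lebesgue. u0 y * p t x y)\<^sup>2 \<le> c"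
  shows "sq_mean (u t x)
    \<le> ennreal c + ennreal (l\<^sup>2) * volterra (square_kernel p L) (\<lambda>s y. sq_mean (u s y)) t x"
proof -
  have pu: "predictable M F D u" using sol unfolding mild_solution_def by blast
  have "volterra (square_kernel p 1) (\<lambda>s y. sq_mean (\<lambda>\<omega>. \<sigma> (u s y \<omega>))) t x
    \<le> volterra (square_kernel p L) (\<lambda>s y. sq_mean (u s y)) t x"
    by (rule volterra_mono)
      (use sq_mean_mono[OF predictable_section_measurable(2)[OF pu]] L in simp)
  then show ?thesis unfolding second_moment_identity[OF sol \<sigma> tx]
    by (intro add_mono mult_left_mono ennreal_leI c) auto
qed

lemma second_moment_lower:
  assumes sol: "mild_solution M F D w p \<sigma> u0 l u" and \<sigma> [measurable]: "\<sigma> \<in> borel_measurable borel"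
    and L: "\<And>x. L * \<bar>x\<bar> \<le> \<bar>\<sigma> x\<bar>" "0 < L" and tx: "0 < t" "x \<in> D"
  shows "ennreal ((LINT y:D|lebesgue. u0 y * p t x y)\<^sup>2) \<le> sq_mean (u t x)"
    and "ennreal (l\<^sup>2) * volterra (square_kernel p L) (\<lambda>s y. sq_mean (u s y)) t x \<le> sq_mean (u t x)"
proof -
  have pu: "predictable M F D u" using sol unfolding mild_solution_def by blast
  note id = second_moment_identity[OF sol \<sigma> tx]
  show "ennreal ((LINT y:D|lebesgue. u0 y * p t x y)\<^sup>2) \<le> sq_mean (u t x)"
    unfolding id by simp
  have "volterra (square_kernel p L) (\<lambda>s y. sq_mean (u s y)) t x
    \<le> volterra (square_kernel p 1) (\<lambda>s y. sq_mean (\<lambda>\<omega>. \<sigma> (u s y \<omega>))) t x"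
  proof (rule volterra_mono)
    fix s y :: real assume sy: "0 < s" "y \<in> D"
    have [measurable]: "u s y \<in> borel_measurable M" by (rule predictable_section_measurable(2)[OF pu sy])
    have "\<bar>u s y \<omega>\<bar> \<le> 1 / L * \<bar>\<sigma> (u s y \<omega>)\<bar>" for \<omega> using L by (simp add: field_simps)
    then have "sq_mean (u s y) \<le> ennreal ((1 / L)\<^sup>2) * sq_mean (\<lambda>\<omega>. \<sigma> (u s y \<omega>))"
      by (intro sq_mean_mono) auto
    then have "ennreal (L\<^sup>2) * sq_mean (u s y) \<le> (ennreal (L\<^sup>2) * ennreal ((1 / L)\<^sup>2)) * sq_mean (\<lambda>\<omega>. \<sigma> (u s y \<omega>))"
      by (simp add: mult.assoc mult_left_mono)
    then show "ennreal (L\<^sup>2) * sq_mean (u s y) \<le> ennreal (1\<^sup>2) * sq_mean (\<lambda>\<omega>. \<sigma> (u s y \<omega>))"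
      using L(2) by (simp add: ennreal_mult[symmetric] power_divide)
  qed
  then have "ennreal (l\<^sup>2) * volterra (square_kernel p L) (\<lambda>s y. sq_mean (u s y)) t x
    \<le> ennreal (l\<^sup>2) * volterra (square_kernel p 1) (\<lambda>s y. sq_mean (\<lambda>\<omega>. \<sigma> (u s y \<omega>))) t x"
    by (rule mult_left_mono) simp
  also have "\<dots> \<le> sq_mean (u t x)" unfolding id by simp
  finally show "ennreal (l\<^sup>2) * volterra (square_kernel p L) (\<lambda>s y. sq_mean (u s y)) t x \<le> sq_mean (u t x)" .
qed

text \<open>
  The energy is defined by Bochner integrals; since the second moments are bounded, these agree
  with the nonnegative integrals.
\<close>

lemma energy_square:
  assumes v: "(\<lambda>(\<omega>, y). v y \<omega>) \<in> borel_measurable (M \<Otimes>\<^sub>M domain_space)"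
    and B: "\<And>x. x \<in> D \<Longrightarrow> sq_mean (v x) \<le> ennreal B" and fin: "emeasure lborel D < \<infinity>"
  shows "ennreal ((energy M D v)\<^sup>2) = (\<integral>\<^sup>+x. sq_mean (v x) * indicator D x \<partial>lborel)"
    and "0 \<le> energy M D v"
proof -
  define g where "g x = sq_mean (v x)" for x
  have v' [measurable]: "(\<lambda>(y, \<omega>). v y \<omega>) \<in> borel_measurable (domain_space \<Otimes>\<^sub>M M)"
    using measurable_pair_swap[OF v] by simp
  have vx [measurable]: "v x \<in> borel_measurable M" if "x \<in> D" for x
  proof -
    have [measurable]: "x \<in> space domain_space" using that by simp
    have "(\<lambda>\<omega>. (\<lambda>(y, \<omega>). v y \<omega>) (x, \<omega>)) \<in> borel_measurable M" by measurable
    then show ?thesis by simp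
  qed
  have gm: "g \<in> borel_measurable domain_space"
  proof -
    have "(\<lambda>y. \<integral>\<^sup>+\<omega>. ennreal (((\<lambda>(y, \<omega>). v y \<omega>) (y, \<omega>))\<^sup>2) \<partial>M) \<in> borel_measurable domain_space" by measurable
    then show ?thesis by (simp add: g_def[abs_def])
  qed
  have inner: "(LINT \<omega>|M. \<bar>v x \<omega>\<bar>\<^sup>2) = enn2real (g x)" if "x \<in> D" for x
    using vx[OF that] unfolding g_def by (subst integral_eq_nn_integral) auto
  have gfin: "g x < \<infinity>" if "x \<in> D" for x
    using B[OF that] unfolding g_def by (rule le_less_trans) simp
  let ?h = "\<lambda>x. indicator D x * enn2real (g x)"
  have hm: "?h \<in> borel_measurable lborel"
  proof -
    have "(\<lambda>x. enn2real (g x)) \<in> borel_measurable domain_space" using gm by measurable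
    then show ?thesis by (subst (asm) borel_measurable_restrict_space_iff) auto
  qed
  have hg: "ennreal (?h x) = g x * indicator D x" for x
    using gfin[of x] by (auto simp: indicator_def ennreal_enn2real)
  have "(LINT x:D|lborel. (LINT \<omega>|M. \<bar>v x \<omega>\<bar>\<^sup>2)) = (\<integral>x. ?h x \<partial>lborel)"
    unfolding set_lebesgue_integral_def
    by (intro Bochner_Integration.integral_cong) (auto simp: indicator_def inner[simplified])
  also have "\<dots> = enn2real (\<integral>\<^sup>+x. ennreal (?h x) \<partial>lborel)"
    using hm by (intro integral_eq_nn_integral) (auto simp: enn2real_nonneg)
  finally have I: "(LINT x:D|lborel. (LINT \<omega>|M. \<bar>v x \<omega>\<bar>\<^sup>2)) = enn2real (\<integral>\<^sup>+x. g x * indicator D x \<partial>lborel)"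
    unfolding hg .
  have "(\<integral>\<^sup>+x. g x * indicator D x \<partial>lborel) \<le> (\<integral>\<^sup>+x. ennreal B * indicator D x \<partial>lborel)"
    using B unfolding g_def by (intro nn_integral_mono) (auto simp: indicator_def)
  also have "\<dots> < \<infinity>" using fin by (simp add: nn_integral_cmult_indicator ennreal_mult_less_top)
  finally have "ennreal (enn2real (\<integral>\<^sup>+x. g x * indicator D x \<partial>lborel)) = (\<integral>\<^sup>+x. g x * indicator D x \<partial>lborel)"
    by (intro ennreal_enn2real) simp
  then show "ennreal ((energy M D v)\<^sup>2) = (\<integral>\<^sup>+x. sq_mean (v x) * indicator D x \<partial>lborel)"
    unfolding energy_def I by (simp add: g_def)
  show "0 \<le> energy M D v" unfolding energy_def I by simp
qed

lemma locally_bounded_momentsD: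
  assumes "locally_bounded_moments M D u" "0 < T"
  obtains B where "\<And>t x. 0 \<le> t \<Longrightarrow> t \<le> T \<Longrightarrow> x \<in> D \<Longrightarrow> sq_mean (u t x) \<le> ennreal B"
proof -
  let ?S = "SUP x\<in>D. SUP t\<in>{0..T}. \<integral>\<^sup>+\<omega>. ennreal (\<bar>u t x \<omega>\<bar> ^ 2) \<partial>M"
  have "?S < \<infinity>" using assms unfolding locally_bounded_moments_def by (metis order_refl)
  then have S: "?S = ennreal (enn2real ?S)" by (simp add: ennreal_enn2real)
  show ?thesis
  proof (rule that[of "enn2real ?S"])
    fix t x assume t: "0 \<le> t" "t \<le> T" "x \<in> D"
    have "(\<integral>\<^sup>+\<omega>. ennreal (\<bar>u t x \<omega>\<bar> ^ 2) \<partial>M) \<le> (SUP t\<in>{0..T}. \<integral>\<^sup>+\<omega>. ennreal (\<bar>u t x \<omega>\<bar> ^ 2) \<partial>M)"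
      using t by (intro SUP_upper) auto
    also have "\<dots> \<le> ?S" using t by (intro SUP_upper) auto
    finally show "sq_mean (u t x) \<le> ennreal (enn2real ?S)" unfolding S[symmetric] by simp
  qed
qed

text \<open>
  The moment bound includes the time \<open>0\<close>, where the solution is deterministic.
\<close>

lemma initial_condition_bounded:
  assumes mom: "locally_bounded_moments M D u" and sol: "mild_solution M F D w p \<sigma> u0 l u"
  obtains c where "1 \<le> c" "\<And>x. x \<in> D \<Longrightarrow> u0 x \<le> c"
proof -
  obtain B where B: "\<And>t x. 0 \<le> t \<Longrightarrow> t \<le> 1 \<Longrightarrow> x \<in> D \<Longrightarrow> sq_mean (u t x) \<le> ennreal B"
    using locally_bounded_momentsD[OF mom zero_less_one] by blast
  show ?thesis
  proof (rule that[of "1 + \<bar>B\<bar>"])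
    fix x assume x: "x \<in> D"
    have "AE \<omega> in M. u 0 x \<omega> = u0 x" using sol x unfolding mild_solution_def by blast
    then have "sq_mean (u 0 x) = (\<integral>\<^sup>+\<omega>. ennreal ((u0 x)\<^sup>2) \<partial>M)"
      by (intro nn_integral_cong_AE) auto
    also have "\<dots> = ennreal ((u0 x)\<^sup>2)" by (simp add: emeasure_space_1)
    finally have "ennreal ((u0 x)\<^sup>2) \<le> ennreal B" using B[of 0 x] x by simp
    then have "ennreal ((u0 x)\<^sup>2) \<le> ennreal \<bar>B\<bar>" by (rule order_trans) (intro ennreal_leI, simp)
    then have "(u0 x)\<^sup>2 \<le> \<bar>B\<bar>" by simp
    also have "\<dots> \<le> (1 + \<bar>B\<bar>)\<^sup>2" by (simp add: power2_eq_square algebra_simps)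
    finally show "u0 x \<le> 1 + \<bar>B\<bar>" by (rule power2_le_imp_le) simp
  qed simp
qed

end

section \<open>Interval covers and densities\<close>

text \<open>
  Cover \<open>A\<close> by non-overlapping dyadic intervals inside an open set of almost the same measure.
\<close>

lemma interval_cover:
  fixes A :: "real set"
  assumes A: "A \<in> sets borel" "A \<subseteq> {a..b}" and "a < b" and \<epsilon>: "0 < \<epsilon>" and \<delta>: "0 < \<delta>"
  obtains c d :: "nat \<Rightarrow> real" where "\<And>n. c n \<le> d n" "\<And>n. d n - c n \<le> \<delta>"
    "A \<subseteq> (\<Union>n. {c n..d n})" "(\<Sum>n. ennreal (d n - c n)) \<le> emeasure lborel A + ennreal \<epsilon>"
proof -
  obtain U where U: "open U" "A \<subseteq> U" "emeasure lborel (U - A) < ennreal \<epsilon>"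
    using outer_regular_lborel[OF A(1) \<epsilon>] by blast
  have "\<exists>r. 0 < r \<and> r \<le> \<delta> / 2 \<and> (x \<in> A \<longrightarrow> ball x r \<subseteq> U)" for x
  proof (cases "x \<in> A")
    case True
    then obtain e where "0 < e" "ball x e \<subseteq> U" using U(1,2) by (meson open_contains_ball subsetD)
    then show ?thesis using \<delta> by (intro exI[of _ "min e (\<delta> / 2)"]) auto
  qed (use \<delta> in \<open>auto intro!: exI[of _ "\<delta> / 2"]\<close>)
  then obtain r where r: "\<And>x. 0 < r x" "\<And>x. r x \<le> \<delta> / 2" "\<And>x. x \<in> A \<Longrightarrow> ball x (r x) \<subseteq> U" by metis
  have g: "gauge (\<lambda>x. ball x (r x))" using r(1) by (simp add: gauge_def)
  have ab: "A \<subseteq> cbox a b" "box a b \<noteq> {}" using A \<open>a < b\<close> by auto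
  obtain \<D> where \<D>: "countable \<D>"
      "\<And>K. K \<in> \<D> \<Longrightarrow> interior K \<noteq> {} \<and> (\<exists>c d. K = cbox c d)"
      "pairwise (\<lambda>A B. interior A \<inter> interior B = {}) \<D>"
      "\<And>K. K \<in> \<D> \<Longrightarrow> \<exists>x\<in>A \<inter> K. K \<subseteq> ball x (r x)" "A \<subseteq> \<Union>\<D>"
    by (rule covering_lemma[OF ab g]) (rule that, assumption+)
  define I where "I = to_nat_on \<D> ` \<D>"
  \<comment> \<open>Enumerate the cover; unused indices get the degenerate interval \<open>{0}\<close> of length \<open>0\<close>.\<close>
  define K where "K n = (if n \<in> I then from_nat_into \<D> n else {0})" for n
  have KI: "n \<in> I \<Longrightarrow> K n \<in> \<D>" for n
    using \<D>(1) by (auto simp: K_def I_def)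
  have "\<exists>c d. K n = {c..d} \<and> c \<le> d \<and> (n \<in> I \<or> c = d)" for n
  proof (cases "n \<in> I")
    case True
    then obtain c d where cd: "K n = {c..d}" using \<D>(2)[OF KI[OF True]] by auto
    then have "c \<le> d" using \<D>(2)[OF KI[OF True]] by (cases "c \<le> d") auto
    then show ?thesis using True cd by blast
  qed (auto simp: K_def intro!: exI[of _ 0])
  then obtain c d where cd: "\<And>n. K n = {c n..d n}" "\<And>n. c n \<le> d n" "\<And>n. n \<in> I \<or> c n = d n" by metis
  show ?thesis
  proof (rule that[of c d])
    show "c n \<le> d n" for n by (rule cd(2))
    show "d n - c n \<le> \<delta>" for n
    proof (cases "n \<in> I")
      case True
      then obtain x where x: "K n \<subseteq> ball x (r x)" using \<D>(4)[OF KI] by blast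
      moreover have "c n \<in> K n" "d n \<in> K n" using cd(2)[of n] unfolding cd(1) by auto
      ultimately have "c n \<in> ball x (r x)" "d n \<in> ball x (r x)" by blast+
      then show ?thesis using r(2)[of x] by (auto simp: dist_real_def abs_if split: if_splits)
    next
      case False
      then show ?thesis using cd(3)[of n] \<delta> by auto
    qed
    show "A \<subseteq> (\<Union>n. {c n..d n})"
    proof
      fix x assume "x \<in> A"
      then obtain L where L: "L \<in> \<D>" "x \<in> L" using \<D>(5) by blast
      then have "K (to_nat_on \<D> L) = L" using \<D>(1) by (simp add: K_def I_def)
      then show "x \<in> (\<Union>n. {c n..d n})" using L cd(1) by blast
    qed
    have sub: "{c n<..<d n} \<subseteq> U" for n
    proof (cases "n \<in> I")
      case True
      then obtain x where "x \<in> A" "K n \<subseteq> ball x (r x)" using \<D>(4)[OF KI] by blast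
      then have "K n \<subseteq> U" using r(3) by blast
      then show ?thesis unfolding cd by auto
    next
      case False
      then show ?thesis using cd(3)[of n] by auto
    qed
    have "disjoint_family (\<lambda>n. {c n<..<d n})"
      unfolding disjoint_family_on_def
    proof (intro ballI impI)
      fix m n :: nat assume "m \<noteq> n"
      show "{c m<..<d m} \<inter> {c n<..<d n} = {}"
      proof (cases "m \<in> I \<and> n \<in> I")
        case True
        then have "K m \<noteq> K n"
          using \<open>m \<noteq> n\<close> \<D>(1) by (auto simp: K_def I_def)
        then have "interior (K m) \<inter> interior (K n) = {}"
          using \<D>(3) KI True by (auto simp: pairwise_def)
        then show ?thesis unfolding cd interior_atLeastAtMost_real .
      next
        case False
        then show ?thesis using cd(3)[of m] cd(3)[of n] by auto
      qed
    qed
    then have "(\<Sum>n. emeasure lborel {c n<..<d n}) = emeasure lborel (\<Union>n. {c n<..<d n})"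
      by (intro suminf_emeasure) auto
    also have "\<dots> \<le> emeasure lborel (A \<union> (U - A))"
      using sub A(1) U(1) by (intro emeasure_mono) auto
    also have "\<dots> \<le> emeasure lborel A + emeasure lborel (U - A)"
      using A(1) U(1) by (intro emeasure_subadditive) auto
    also have "\<dots> \<le> emeasure lborel A + ennreal \<epsilon>"
      using U(3) by (intro add_mono) auto
    finally show "(\<Sum>n. ennreal (d n - c n)) \<le> emeasure lborel A + ennreal \<epsilon>"
      using cd(2) by simp
  qed
qed

text \<open>
  A weak form of the Lebesgue density theorem: if \<open>A\<close> filled at most the fraction
  \<open>1 - \<eta>\<close> of every short interval, then an efficient cover would have too little room for \<open>A\<close>.
\<close>

lemma interval_of_high_density:
  fixes A :: "real set"
  assumes A: "A \<in> sets borel" "A \<subseteq> {a..b}" and pos: "0 < emeasure lborel A"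
    and \<delta>: "0 < \<delta>" and \<eta>: "0 < \<eta>" "\<eta> < 1"
  obtains c d where "c < d" "d - c \<le> \<delta>" "(1 - \<eta>) * (d - c) < measure lborel (A \<inter> {c..d})"
    "measure lborel ({c..d} - A) < \<eta> * (d - c)"
proof -
  have ab: "a < b"
  proof (rule ccontr)
    assume "\<not> a < b"
    then have "A \<subseteq> {a}" using A(2) by auto
    then have "emeasure lborel A \<le> emeasure lborel {a}" by (intro emeasure_mono) auto
    then show False using pos by simp
  qed
  have "emeasure lborel A \<le> emeasure lborel {a..b}" using A by (intro emeasure_mono) auto
  then have fin: "emeasure lborel A < \<infinity>" using ab by (simp add: le_less_trans)
  define v where "v = measure lborel A"
  have v: "emeasure lborel A = ennreal v" "0 < v"
    using fin pos unfolding v_def by (auto simp: emeasure_eq_ennreal_measure less_top zero_less_measure_iff)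
  \<comment> \<open>Then \<open>(1 - \<eta>) * (v + \<epsilon>) = (1 - \<eta>\<^sup>2) * v < v\<close>.\<close>
  define \<epsilon> where "\<epsilon> = \<eta> * v"
  have \<epsilon>: "0 < \<epsilon>" using \<eta> v by (simp add: \<epsilon>_def)
  obtain c d where cd: "\<And>n. c n \<le> d n" "\<And>n. d n - c n \<le> \<delta>"
    "A \<subseteq> (\<Union>n. {c n..d n})" "(\<Sum>n. ennreal (d n - c n)) \<le> emeasure lborel A + ennreal \<epsilon>"
    using interval_cover[OF A ab \<epsilon> \<delta>] by blast
  have "\<exists>n. c n < d n \<and> (1 - \<eta>) * (d n - c n) < measure lborel (A \<inter> {c n..d n})"
  proof (rule ccontr)
    assume H: "\<nexists>n. c n < d n \<and> (1 - \<eta>) * (d n - c n) < measure lborel (A \<inter> {c n..d n})"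
    have le: "emeasure lborel (A \<inter> {c n..d n}) \<le> ennreal (1 - \<eta>) * ennreal (d n - c n)" for n
    proof (cases "c n < d n")
      case True
      have "emeasure lborel (A \<inter> {c n..d n}) = ennreal (measure lborel (A \<inter> {c n..d n}))"
        using A fin by (intro emeasure_eq_ennreal_measure) (metis emeasure_mono inf_le1 leD sets_lborel infinity_ennreal_def)
      also have "\<dots> \<le> ennreal ((1 - \<eta>) * (d n - c n))"
        using H True by (intro ennreal_leI) (meson not_less)
      finally show ?thesis using \<eta> cd(1) by (simp add: ennreal_mult)
    next
      case False
      have "emeasure lborel (A \<inter> {c n..d n}) \<le> emeasure lborel {c n..d n}"
        using A by (intro emeasure_mono) auto
      then show ?thesis using False cd(1)[of n] by simp
    qed
    have "emeasure lborel A \<le> emeasure lborel (\<Union>n. A \<inter> {c n..d n})"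
      using cd(3) A by (intro emeasure_mono) auto
    also have "\<dots> \<le> (\<Sum>n. emeasure lborel (A \<inter> {c n..d n}))"
      using A by (intro emeasure_subadditive_countably) auto
    also have "\<dots> \<le> (\<Sum>n. ennreal (1 - \<eta>) * ennreal (d n - c n))"
      by (intro suminf_le le) auto
    also have "\<dots> = ennreal (1 - \<eta>) * (\<Sum>n. ennreal (d n - c n))" by (rule ennreal_suminf_cmult)
    also have "\<dots> \<le> ennreal (1 - \<eta>) * (ennreal v + ennreal \<epsilon>)"
      using cd(4) unfolding v by (intro mult_left_mono) auto
    also have "\<dots> = ennreal ((1 - \<eta>) * (v + \<epsilon>))"
      using \<eta> v(2) \<epsilon> by (simp add: ennreal_mult)
    finally have "v \<le> (1 - \<eta>) * (v + \<epsilon>)"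
      unfolding v using \<eta> v(2) \<epsilon> by simp
    also have "\<dots> = v - \<eta>\<^sup>2 * v" by (simp add: \<epsilon>_def algebra_simps power2_eq_square)
    finally show False using \<eta> v(2) by (simp add: mult_le_0_iff)
  qed
  then obtain n where n: "c n < d n" "(1 - \<eta>) * (d n - c n) < measure lborel (A \<inter> {c n..d n})" by blast
  have "measure lborel {c n..d n} = measure lborel (A \<inter> {c n..d n}) + measure lborel ({c n..d n} - A)"
  proof -
    have fin': "emeasure lborel X \<noteq> \<infinity>" if "X \<subseteq> {c n..d n}" for X
      using emeasure_mono[OF that, of lborel] cd(1)[of n] by (auto simp: top_unique)
    have "{c n..d n} = (A \<inter> {c n..d n}) \<union> ({c n..d n} - A)" by blast
    also have "measure lborel \<dots> = measure lborel (A \<inter> {c n..d n}) + measure lborel ({c n..d n} - A)"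
      using A fin' by (intro measure_Union) auto
    finally show ?thesis .
  qed
  then have "measure lborel ({c n..d n} - A) < \<eta> * (d n - c n)"
    using n by (simp add: algebra_simps)
  then show ?thesis using that[of "c n" "d n"] n cd(2)[of n] by blast
qed

text \<open>
  The integrand of the inversion formula is bounded by \<open>(b - a) \<bar>\<phi>(t)\<bar>\<close>. The formula itself needs end
  points that are no atoms; these are dense because there are only countably many atoms.
\<close>

lemma (in real_distribution) density_bound_interval:
  assumes int: "integrable lborel (\<lambda>t. norm (char M t))"
    and K: "(\<integral>t. norm (char M t) \<partial>lborel) \<le> 2 * pi * K" and "a \<le> b"
  shows "measure M {a..b} \<le> K * (b - a)"
proof -
  have ci: "measure M {a<..b} \<le> K * (b - a)"
    if ab: "a \<le> b" and at: "measure M {a} = 0" "measure M {b} = 0" for a b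
  proof -
    let ?F = "\<lambda>t. (iexp (- (t * a)) - iexp (- (t * b))) / (\<i> * complex_of_real t) * char M t"
    let ?J = "\<lambda>T::nat. 1 / (2 * pi) * (CLBINT t=-T..T. ?F t)"
    have F: "norm (?F t) \<le> (b - a) * norm (char M t)" for t
    proof (cases "t = 0")
      case True
      then show ?thesis using ab by simp
    next
      case False
      have "cmod ((iexp (t * - a) - iexp (t * - b)) / (\<i> * complex_of_real t)) \<le> - a - - b"
        by (rule Levy_Inversion_aux2) (use ab False in auto)
      then show ?thesis unfolding norm_mult by (intro mult_right_mono) auto
    qed
    have iF: "integrable lborel ?F"
    proof (rule Bochner_Integration.integrable_bound)
      show "integrable lborel (\<lambda>t. (b - a) * norm (char M t))" using int by simp
      show "AE t in lborel. norm (?F t) \<le> norm ((b - a) * norm (char M t))"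
        using F ab by (intro AE_I2) (auto simp: abs_mult intro: order_trans)
    qed measurable
    have "norm (?J T) \<le> K * (b - a)" for T
    proof -
      have "norm (CLBINT t=-T..T. ?F t) = norm (CLBINT t:{-real T..real T}. ?F t)"
        by (simp add: interval_integral_Icc)
      also have "\<dots> \<le> (LINT t:{-real T..real T}|lborel. norm (?F t))"
        using iF by (intro set_integral_norm_bound) (auto simp: set_integrable_def intro!: integrable_mult_indicator)
      also have "\<dots> \<le> (\<integral>t. (b - a) * norm (char M t) \<partial>lborel)"
        unfolding set_lebesgue_integral_def
        using F ab int iF by (intro integral_mono integrable_mult_indicator)
          (auto simp: indicator_def)
      also have "\<dots> \<le> (b - a) * (2 * pi * K)"
        using K ab by (simp add: mult_left_mono)
      finally show ?thesis by (simp add: norm_mult norm_divide field_simps)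
    qed
    moreover have "?J \<longlonglongrightarrow> of_real (measure M {a<..b})"
      using Levy_Inversion[OF ab at] by simp
    ultimately have "norm (of_real (measure M {a<..b}) :: complex) \<le> K * (b - a)"
      by (intro Lim_bounded[OF tendsto_norm]) auto
    then show ?thesis by simp
  qed
  have cnt: "countable {x. measure M {x} \<noteq> 0}" by (rule countable_support)
  have "measure M {a..b} \<le> K * (b - a) + \<epsilon>" if \<epsilon>: "0 < \<epsilon>" for \<epsilon>
  proof -
    define \<delta> where "\<delta> = \<epsilon> / (2 * (\<bar>K\<bar> + 1))"
    have \<delta>: "0 < \<delta>" using \<epsilon> by (simp add: \<delta>_def)
    obtain a' where a': "a' \<in> {a - \<delta><..<a}" "measure M {a'} = 0"
      using open_minus_countable[OF cnt, of "{a - \<delta><..<a}"] \<delta> by auto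
    obtain b' where b': "b' \<in> {b<..<b + \<delta>}" "measure M {b'} = 0"
      using open_minus_countable[OF cnt, of "{b<..<b + \<delta>}"] \<delta> by auto
    have "measure M {a..b} \<le> measure M {a'<..b'}"
      using a' b' by (intro finite_measure_mono) auto
    also have "\<dots> \<le> K * (b' - a')" using a' b' \<open>a \<le> b\<close> by (intro ci) auto
    also have "\<dots> = K * (b - a) + K * ((b' - b) + (a - a'))" by (simp add: algebra_simps)
    also have "K * ((b' - b) + (a - a')) \<le> \<bar>K\<bar> * ((b' - b) + (a - a'))"
      using a' b' by (intro mult_right_mono) auto
    also have "\<dots> \<le> (\<bar>K\<bar> + 1) * (2 * \<delta>)" using a' b' by (intro mult_mono) auto
    also have "(\<bar>K\<bar> + 1) * (2 * \<delta>) = \<epsilon>"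
      unfolding \<delta>_def by (simp add: divide_simps)
    finally show ?thesis by simp
  qed
  then show ?thesis by (rule field_le_epsilon)
qed

text \<open>
  The bound on intervals extends to Borel sets by an efficient cover with intervals.
\<close>

lemma (in real_distribution) density_bound:
  assumes "integrable lborel (\<lambda>t. norm (char M t))"
    and "(\<integral>t. norm (char M t) \<partial>lborel) \<le> 2 * pi * K" and K: "0 \<le> K"
    and A: "A \<in> sets borel" "A \<subseteq> {a..b}" "a < b"
  shows "emeasure M A \<le> ennreal K * emeasure lborel A"
proof (rule ennreal_le_epsilon)
  fix \<epsilon> :: real assume \<epsilon>: "0 < \<epsilon>"
  define \<epsilon>' where "\<epsilon>' = \<epsilon> / (K + 1)"
  have \<epsilon>': "0 < \<epsilon>'" "K * \<epsilon>' \<le> \<epsilon>" using \<epsilon> K by (auto simp: \<epsilon>'_def field_simps)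
  obtain c d where cd: "\<And>n. c n \<le> d n" "\<And>n. d n - c n \<le> (1::real)"
    "A \<subseteq> (\<Union>n. {c n..d n})" "(\<Sum>n. ennreal (d n - c n)) \<le> emeasure lborel A + ennreal \<epsilon>'"
    using interval_cover[OF A \<epsilon>'(1) zero_less_one] by blast
  have "emeasure M A \<le> emeasure M (\<Union>n. {c n..d n})"
    using cd(3) by (intro emeasure_mono) auto
  also have "\<dots> \<le> (\<Sum>n. emeasure M {c n..d n})"
    by (intro emeasure_subadditive_countably) auto
  also have "\<dots> \<le> (\<Sum>n. ennreal K * ennreal (d n - c n))"
    using density_bound_interval[OF assms(1,2) cd(1)] K
    by (intro suminf_le) (auto simp: emeasure_eq_measure ennreal_mult[symmetric] cd(1) intro!: ennreal_leI)
  also have "\<dots> = ennreal K * (\<Sum>n. ennreal (d n - c n))" by (rule ennreal_suminf_cmult)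
  also have "\<dots> \<le> ennreal K * (emeasure lborel A + ennreal \<epsilon>')"
    using cd(4) by (intro mult_left_mono) auto
  also have "\<dots> = ennreal K * emeasure lborel A + ennreal (K * \<epsilon>')"
    using K \<epsilon>' by (simp add: distrib_left ennreal_mult)
  also have "\<dots> \<le> ennreal K * emeasure lborel A + ennreal \<epsilon>"
    using \<epsilon>' by (intro add_left_mono ennreal_leI)
  finally show "emeasure M A \<le> ennreal K * emeasure lborel A + ennreal \<epsilon>" .
qed

section \<open>The stable process\<close>

locale stable = prob_space N for N :: "'b measure" +
  fixes \<alpha> :: real and X :: "real \<Rightarrow> 'b \<Rightarrow> real"
  assumes stable: "stable_process N \<alpha> X" and alpha_pos: "0 < \<alpha>"
begin

lemma X_measurable [measurable]: "0 \<le> t \<Longrightarrow> X t \<in> borel_measurable N"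
  using stable unfolding stable_process_def by blast

lemma X_zero: "\<omega> \<in> space N \<Longrightarrow> X 0 \<omega> = 0"
  using stable unfolding stable_process_def by blast

lemma X_right_cont: "\<omega> \<in> space N \<Longrightarrow> 0 \<le> t \<Longrightarrow> ((\<lambda>s. X s \<omega>) \<longlongrightarrow> X t \<omega>) (at_right t)"
  using stable unfolding stable_process_def by blast

lemma X_distribution: "0 \<le> t \<Longrightarrow> real_distribution (distr N borel (X t))"
  by (rule real_distribution_distr) simp

lemma X_char:
  assumes "0 \<le> t"
  shows "char (distr N borel (X t)) \<xi> = complex_of_real (exp (- t * \<bar>\<xi>\<bar> powr \<alpha>))"
proof -
  have "distr N borel (X t) = distr N borel (\<lambda>\<omega>. X t \<omega> - X 0 \<omega>)"
    using X_zero by (intro distr_cong) auto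
  also have "char \<dots> \<xi> = complex_of_real (exp (- (t - 0) * \<bar>\<xi>\<bar> powr \<alpha>))"
    using stable assms unfolding stable_process_def by blast
  finally show ?thesis by simp
qed

lemma X_scaling:
  assumes c: "c \<noteq> 0" and t: "0 \<le> t"
  shows "distr N borel (\<lambda>\<omega>. c * X t \<omega>) = distr N borel (X (\<bar>c\<bar> powr \<alpha> * t))"
proof (rule Levy_uniqueness)
  have t': "0 \<le> \<bar>c\<bar> powr \<alpha> * t" using t by simp
  show "real_distribution (distr N borel (\<lambda>\<omega>. c * X t \<omega>))"
    by (rule real_distribution_distr) (use t in simp)
  show "real_distribution (distr N borel (X (\<bar>c\<bar> powr \<alpha> * t)))" by (rule X_distribution[OF t'])
  show "char (distr N borel (\<lambda>\<omega>. c * X t \<omega>)) = char (distr N borel (X (\<bar>c\<bar> powr \<alpha> * t)))"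
  proof
    fix \<xi>
    have "char (distr N borel (\<lambda>\<omega>. c * X t \<omega>)) \<xi> = char (distr N borel (X t)) (c * \<xi>)"
      using t by (simp add: char_def integral_distr mult_ac)
    then show "char (distr N borel (\<lambda>\<omega>. c * X t \<omega>)) \<xi> = char (distr N borel (X (\<bar>c\<bar> powr \<alpha> * t))) \<xi>"
      using t t' by (simp add: X_char abs_mult powr_mult mult_ac)
  qed
qed

lemma prob_distr:
  assumes "f \<in> borel_measurable N" "A \<in> sets borel"
  shows "prob {\<omega> \<in> space N. f \<omega> \<in> A} = measure (distr N borel f) A"
  using assms by (subst measure_distr) (auto intro!: arg_cong[where f=prob])

abbreviation hit :: "real \<Rightarrow> real \<Rightarrow> real set \<Rightarrow> 'b set" where
  "hit x t A \<equiv> {\<omega> \<in> space N. x + X t \<omega> \<in> A}"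

text \<open>
  By scaling, one \<open>K\<close> serves all times. Symmetry gives probability at least \<open>1/2\<close> to each half line,
  of which at most \<open>1/8\<close> is lost in the tails.
\<close>

lemma X_small_range:
  obtains K where "0 < K"
    "\<And>r. 0 < r \<Longrightarrow> 3 / 8 \<le> prob {\<omega> \<in> space N. 0 \<le> X r \<omega> \<and> X r \<omega> \<le> K * r powr (1 / \<alpha>)}"
    "\<And>r. 0 < r \<Longrightarrow> 3 / 8 \<le> prob {\<omega> \<in> space N. - (K * r powr (1 / \<alpha>)) \<le> X r \<omega> \<and> X r \<omega> \<le> 0}"
    "\<And>r. 0 < r \<Longrightarrow> prob {\<omega> \<in> space N. \<not> \<bar>X r \<omega>\<bar> \<le> K * r powr (1 / \<alpha>)} \<le> 1 / 8"
proof -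
  have X1 [measurable]: "X 1 \<in> borel_measurable N" by simp
  have "(\<lambda>n. prob {\<omega> \<in> space N. \<bar>X 1 \<omega>\<bar> \<le> real n}) \<longlonglongrightarrow> prob (\<Union>n. {\<omega> \<in> space N. \<bar>X 1 \<omega>\<bar> \<le> real n})"
    by (intro finite_Lim_measure_incseq) (auto simp: incseq_def intro: order_trans)
  also have "(\<Union>n. {\<omega> \<in> space N. \<bar>X 1 \<omega>\<bar> \<le> real n}) = space N"
    using real_arch_simple by auto
  finally have "(\<lambda>n. prob {\<omega> \<in> space N. \<bar>X 1 \<omega>\<bar> \<le> real n}) \<longlonglongrightarrow> 1" by (simp add: prob_space)
  from order_tendstoD(1)[OF this, of "7/8"] obtain n where n: "7/8 < prob {\<omega> \<in> space N. \<bar>X 1 \<omega>\<bar> \<le> real n}"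
    by (auto simp: eventually_sequentially)
  define K where "K = real n + 1"
  have K: "0 < K" by (simp add: K_def)
  have tail: "prob {\<omega> \<in> space N. \<not> \<bar>X r \<omega>\<bar> \<le> K * r powr (1 / \<alpha>)} \<le> 1 / 8" if r: "0 < r" for r
  proof -
    have [measurable]: "X r \<in> borel_measurable N" using r by simp
    let ?A = "{x. \<bar>x\<bar> \<le> K * r powr (1 / \<alpha>)}"
    have A: "?A \<in> sets borel" by measurable
    have "prob {\<omega> \<in> space N. X r \<omega> \<in> ?A} = prob {\<omega> \<in> space N. r powr (1 / \<alpha>) * X 1 \<omega> \<in> ?A}"
      using prob_distr[of "X r" ?A] prob_distr[of "\<lambda>\<omega>. r powr (1 / \<alpha>) * X 1 \<omega>" ?A] A X_scaling[of "r powr (1 / \<alpha>)" 1] r alpha_pos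
      by (simp add: powr_powr)
    also have "\<dots> = prob {\<omega> \<in> space N. \<bar>X 1 \<omega>\<bar> \<le> K}"
      using r by (simp add: abs_mult mult.commute)
    also have "\<dots> \<ge> prob {\<omega> \<in> space N. \<bar>X 1 \<omega>\<bar> \<le> real n}"
      by (intro finite_measure_mono) (auto simp: K_def)
    finally have "7/8 < prob {\<omega> \<in> space N. \<bar>X r \<omega>\<bar> \<le> K * r powr (1 / \<alpha>)}" using n by simp
    moreover have "prob {\<omega> \<in> space N. \<not> \<bar>X r \<omega>\<bar> \<le> K * r powr (1 / \<alpha>)} = 1 - prob {\<omega> \<in> space N. \<bar>X r \<omega>\<bar> \<le> K * r powr (1 / \<alpha>)}"
      by (rule prob_neg) simp
    ultimately show ?thesis by simp
  qed
  have sym: "prob {\<omega> \<in> space N. X r \<omega> \<in> A} = prob {\<omega> \<in> space N. - X r \<omega> \<in> A}" if "0 < r" "A \<in> sets borel" for r A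
    using that X_scaling[of "-1" r] by (simp add: prob_distr)
  have up: "3 / 8 \<le> prob {\<omega> \<in> space N. 0 \<le> X r \<omega> \<and> X r \<omega> \<le> K * r powr (1 / \<alpha>)}" if r: "0 < r" for r
  proof -
    have [measurable]: "X r \<in> borel_measurable N" using r by simp
    have "1 = prob ({\<omega> \<in> space N. 0 \<le> X r \<omega>} \<union> {\<omega> \<in> space N. 0 \<le> - X r \<omega>})"
      by (subst prob_space[symmetric]) (auto intro!: arg_cong[where f=prob])
    also have "\<dots> \<le> prob {\<omega> \<in> space N. 0 \<le> X r \<omega>} + prob {\<omega> \<in> space N. 0 \<le> - X r \<omega>}"
      by (intro measure_Un_le) measurable
    also have "\<dots> = 2 * prob {\<omega> \<in> space N. 0 \<le> X r \<omega>}"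
      using sym[OF r, of "{0..}"] by simp
    finally have "1 / 2 \<le> prob {\<omega> \<in> space N. 0 \<le> X r \<omega>}" by simp
    also have "\<dots> \<le> prob ({\<omega> \<in> space N. 0 \<le> X r \<omega> \<and> X r \<omega> \<le> K * r powr (1 / \<alpha>)} \<union> {\<omega> \<in> space N. \<not> \<bar>X r \<omega>\<bar> \<le> K * r powr (1 / \<alpha>)})"
      by (intro finite_measure_mono) (auto simp: abs_le_iff)
    also have "\<dots> \<le> prob {\<omega> \<in> space N. 0 \<le> X r \<omega> \<and> X r \<omega> \<le> K * r powr (1 / \<alpha>)} + prob {\<omega> \<in> space N. \<not> \<bar>X r \<omega>\<bar> \<le> K * r powr (1 / \<alpha>)}"
      by (intro measure_Un_le) measurable
    finally show ?thesis using tail[OF r] by simp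
  qed
  have "3 / 8 \<le> prob {\<omega> \<in> space N. - (K * r powr (1 / \<alpha>)) \<le> X r \<omega> \<and> X r \<omega> \<le> 0}" if r: "0 < r" for r
    using up[OF r] sym[OF r, of "{0..K * r powr (1 / \<alpha>)}"]
    by (simp add: minus_le_iff conj_commute)
  with that[OF K up _ tail] show ?thesis by blast
qed

text \<open>
  The norm of the characteristic function at time \<open>t\<close> is that at time \<open>1\<close>, rescaled by the factor
  \<open>t powr (1/\<alpha>)\<close>; the latter is dominated by \<open>2 / (1 + \<xi>\<^sup>2)\<close>, since \<open>\<alpha> > 1\<close>.
\<close>

lemma char_integral_bound:
  assumes "1 < \<alpha>"
  obtains C where "0 < C" "\<And>t. 0 < t \<Longrightarrow> integrable lborel (\<lambda>\<xi>. norm (char (distr N borel (X t)) \<xi>))"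
    "\<And>t. 0 < t \<Longrightarrow> (\<integral>\<xi>. norm (char (distr N borel (X t)) \<xi>) \<partial>lborel) \<le> 2 * pi * (C * t powr (- (1 / \<alpha>)))"
proof -
  define f where "f \<xi> = exp (- (\<bar>\<xi>\<bar> powr \<alpha>))" for \<xi> :: real
  have fm [measurable]: "f \<in> borel_measurable borel" unfolding f_def by measurable
  have f: "f \<xi> \<le> 2 * inverse (1 + \<xi>\<^sup>2)" for \<xi>
  proof (cases "\<bar>\<xi>\<bar> \<le> 1")
    case True
    then have "1 + \<xi>\<^sup>2 \<le> 2" by (simp add: abs_square_le_1)
    then have "1 \<le> 2 * inverse (1 + \<xi>\<^sup>2)" by (simp add: field_simps add_pos_nonneg)
    moreover have "f \<xi> \<le> 1" by (simp add: f_def)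
    ultimately show ?thesis by simp
  next
    case False
    then have "\<bar>\<xi>\<bar> powr 1 \<le> \<bar>\<xi>\<bar> powr \<alpha>" using assms by (intro powr_mono) auto
    then have e: "exp \<bar>\<xi>\<bar> \<le> exp (\<bar>\<xi>\<bar> powr \<alpha>)" using False by simp
    have q: "1 + \<bar>\<xi>\<bar> + \<xi>\<^sup>2 / 2 \<le> exp \<bar>\<xi>\<bar>" using exp_lower_Taylor_quadratic[of "\<bar>\<xi>\<bar>"] by simp
    have "(1 + \<xi>\<^sup>2) / 2 \<le> exp (\<bar>\<xi>\<bar> powr \<alpha>)" 
    proof -
      have "(1 + \<xi>\<^sup>2) / 2 \<le> 1 + \<bar>\<xi>\<bar> + \<xi>\<^sup>2 / 2" by (simp add: add_divide_distrib)
      then show ?thesis using q e by (blast intro: order_trans)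
    qed
    then show ?thesis unfolding f_def exp_minus
      by (simp add: field_simps add_pos_nonneg)
  qed
  have "integrable lborel (\<lambda>\<xi>::real. inverse (1 + \<xi>\<^sup>2))"
    using integrable_inverse_1_plus_square by (simp add: set_integrable_def)
  then have i: "integrable lborel f"
    by (rule Bochner_Integration.integrable_bound[OF integrable_mult_right[of 2]])
      (use f in \<open>auto simp: f_def\<close>)
  define C where "C = \<bar>\<integral>\<xi>. f \<xi> \<partial>lborel\<bar> / (2 * pi) + 1"
  have "2 * pi * C = \<bar>\<integral>\<xi>. f \<xi> \<partial>lborel\<bar> + 2 * pi" by (simp add: C_def field_simps)
  then have C: "0 < C" "(\<integral>\<xi>. f \<xi> \<partial>lborel) \<le> 2 * pi * C"
    by (auto simp: C_def add_nonneg_pos intro: order_trans[OF abs_ge_self])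
  have ch: "norm (char (distr N borel (X t)) \<xi>) = f (0 + t powr (1 / \<alpha>) * \<xi>)" if t: "0 < t" for t \<xi>
  proof -
    have "\<bar>t powr (1 / \<alpha>) * \<xi>\<bar> powr \<alpha> = t * \<bar>\<xi>\<bar> powr \<alpha>"
      using t alpha_pos by (simp add: abs_mult powr_mult powr_powr)
    then show ?thesis using t by (simp add: X_char f_def)
  qed
  show ?thesis
  proof (rule that[OF C(1)])
    fix t :: real assume t: "0 < t"
    show "integrable lborel (\<lambda>\<xi>. norm (char (distr N borel (X t)) \<xi>))"
      unfolding ch[OF t] using i t by (intro lborel_integrable_real_affine) auto
    have "(\<integral>\<xi>. f \<xi> \<partial>lborel) = t powr (1 / \<alpha>) * (\<integral>\<xi>. norm (char (distr N borel (X t)) \<xi>) \<partial>lborel)"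
      unfolding ch[OF t] using t lborel_integral_real_affine[of "t powr (1 / \<alpha>)" f 0] by simp
    then have "t powr (1 / \<alpha>) * (\<integral>\<xi>. norm (char (distr N borel (X t)) \<xi>) \<partial>lborel) \<le> 2 * pi * C"
      using C(2) by simp
    then show "(\<integral>\<xi>. norm (char (distr N borel (X t)) \<xi>) \<partial>lborel) \<le> 2 * pi * (C * t powr (- (1 / \<alpha>)))"
      using t by (simp add: powr_minus field_simps)
  qed
qed

lemma X_density_bound:
  assumes "1 < \<alpha>"
  obtains C where "0 < C"
    "\<And>t x a b A. 0 < t \<Longrightarrow> A \<in> sets borel \<Longrightarrow> A \<subseteq> {a..b} \<Longrightarrow> a < b \<Longrightarrow>
       emeasure N (hit x t A) \<le> ennreal (C * t powr (- (1 / \<alpha>))) * emeasure lborel A"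
proof -
  obtain C where C: "0 < C" "\<And>t. 0 < t \<Longrightarrow> integrable lborel (\<lambda>\<xi>. norm (char (distr N borel (X t)) \<xi>))"
    "\<And>t. 0 < t \<Longrightarrow> (\<integral>\<xi>. norm (char (distr N borel (X t)) \<xi>) \<partial>lborel) \<le> 2 * pi * (C * t powr (- (1 / \<alpha>)))"
    using char_integral_bound[OF assms] by blast
  show ?thesis
  proof (rule that[OF C(1)])
    fix t x a b :: real and A :: "real set"
    assume t: "0 < t" and A: "A \<in> sets borel" "A \<subseteq> {a..b}" "a < b"
    interpret D: real_distribution "distr N borel (X t)" using t X_distribution by simp
    define B where "B = (\<lambda>z. x + z) -` A"
    have [measurable]: "B \<in> sets borel"
      using measurable_sets[of "\<lambda>z. x + z" borel borel A] A(1) by (simp add: B_def)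
    have "hit x t A = X t -` B \<inter> space N" by (auto simp: B_def)
    then have "emeasure N (hit x t A) = emeasure (distr N borel (X t)) B"
      using t by (subst emeasure_distr) auto
    also have "\<dots> \<le> ennreal (C * t powr (- (1 / \<alpha>))) * emeasure lborel B"
    proof (rule D.density_bound[OF C(2,3)[OF t]])
      show "B \<subseteq> {a - x..b - x}" using A by (auto simp: B_def)
    qed (use A C(1) in auto)
    also have "emeasure lborel B = emeasure (distr lborel borel (\<lambda>z. x + z)) A"
      using A(1) by (subst emeasure_distr) (auto simp: B_def)
    also have "\<dots> = emeasure lborel A"
      by (simp add: lborel_distr_plus)
    finally show "emeasure N (hit x t A) \<le> ennreal (C * t powr (- (1 / \<alpha>))) * emeasure lborel A" .
  qed
qed

section \<open>Running suprema and the exit time\<close>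

text \<open>
  The supremum is taken over countably many times, for measurability; \<open>\<epsilon>\<close> is \<open>1\<close> or \<open>-1\<close>.
\<close>

definition sup_path :: "real \<Rightarrow> real \<Rightarrow> 'b \<Rightarrow> ereal" where
  "sup_path \<epsilon> q \<omega> = (SUP s\<in>insert q ({0..q} \<inter> \<rat>). ereal (\<epsilon> * X s \<omega>))"

lemma sup_path_measurable [measurable]:
  assumes "0 \<le> q"
  shows "sup_path \<epsilon> q \<in> borel_measurable N"
proof -
  have "countable (insert q ({0..q} \<inter> \<rat>))" by (simp add: countable_rat)
  moreover have "(\<lambda>\<omega>. ereal (\<epsilon> * X s \<omega>)) \<in> borel_measurable N" if "s \<in> insert q ({0..q} \<inter> \<rat>)" for s
    using that assms by auto
  ultimately show ?thesis unfolding sup_path_def[abs_def] by (rule borel_measurable_SUP)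
qed

text \<open>
  A right-continuous path cannot exceed the supremum over the rational times at other times only.
\<close>

lemma le_sup_path:
  assumes \<omega>: "\<omega> \<in> space N" and s: "0 \<le> s" "s \<le> q"
  shows "ereal (\<epsilon> * X s \<omega>) \<le> sup_path \<epsilon> q \<omega>"
proof (cases "s = q")
  case True
  then show ?thesis unfolding sup_path_def by (intro SUP_upper) auto
next
  case False
  then have sq: "s < q" using s by simp
  have lim: "((\<lambda>r. ereal (\<epsilon> * X r \<omega>)) \<longlongrightarrow> ereal (\<epsilon> * X s \<omega>)) (at_right s)"
    by (intro tendsto_intros X_right_cont \<omega> s)
  show ?thesis
  proof (rule ccontr)
    assume "\<not> ?thesis"
    then have "sup_path \<epsilon> q \<omega> < ereal (\<epsilon> * X s \<omega>)" by simp
    from order_tendstoD(1)[OF lim this]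
    obtain b where b: "s < b" "\<And>r. s < r \<Longrightarrow> r < b \<Longrightarrow> sup_path \<epsilon> q \<omega> < ereal (\<epsilon> * X r \<omega>)"
      unfolding eventually_at_right_field by blast
    obtain r where r: "r \<in> \<rat>" "s < r" "r < min b q"
      using Rats_dense_in_real[of s "min b q"] b sq by auto
    have "ereal (\<epsilon> * X r \<omega>) \<le> sup_path \<epsilon> q \<omega>"
      unfolding sup_path_def using r s by (intro SUP_upper) auto
    then show False using b(2)[of r] r by auto
  qed
qed

lemma sup_path_le:
  assumes "0 \<le> q" "\<And>s. 0 \<le> s \<Longrightarrow> s \<le> q \<Longrightarrow> ereal (\<epsilon> * X s \<omega>) \<le> z"
  shows "sup_path \<epsilon> q \<omega> \<le> z"
  unfolding sup_path_def using assms by (intro SUP_least) auto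

text \<open>
  Starting points \<open>x\<close> for which, up to some rational time, the supremum of \<open>X\<close> equals \<open>R - x\<close> or that
  of \<open>-X\<close> equals \<open>R + x\<close> with positive probability. For them the path may approach the boundary
  without reaching it, and it is not clear that the exit time is measurable.
\<close>

definition exceptional :: "real \<Rightarrow> real set" where
  "exceptional R = (\<Union>q\<in>{0<..} \<inter> \<rat>.
     {x. measure (distr N borel (sup_path 1 q)) {ereal (R - x)} \<noteq> 0} \<union>
     {x. measure (distr N borel (sup_path (-1) q)) {ereal (R + x)} \<noteq> 0})"

text \<open>
  A finite measure has only countably many atoms.
\<close>

lemma countable_exceptional: "countable (exceptional R)"
proof -
  have "countable {x. g x \<in> {z. measure (distr N borel (sup_path \<epsilon> q)) {z} \<noteq> 0}}"
    if "0 < q" and g: "inj g" for \<epsilon> q and g :: "real \<Rightarrow> ereal"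
  proof -
    interpret D: finite_measure "distr N borel (sup_path \<epsilon> q)"
      using that by (intro finite_measure_distr) auto
    show ?thesis using D.countable_support g by (rule countable_image_inj)
  qed
  moreover have "inj (\<lambda>x. ereal (R - x))" "inj (\<lambda>x. ereal (R + x))" by (auto simp: inj_def)
  moreover have "countable ({0<..} \<inter> \<rat> :: real set)" by (simp add: countable_rat)
  ultimately show ?thesis unfolding exceptional_def by auto
qed

text \<open>
  The event that the path stays in the open ball lies between the events that the suprema of the
  path are strictly, and weakly, below the distances to the boundary. Outside the exceptional set the
  two differ by a null set.
\<close>

lemma confined_until_measurable:
  assumes q: "0 < q" "q \<in> \<rat>" and x: "x \<notin> exceptional R"
  shows "{\<omega> \<in> space N. \<forall>s\<in>{0<..q}. x + X s \<omega> \<in> ball 0 R} \<in> sets (completion N)" (is "?O \<in> _")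
proof -
  let ?S = "sup_path 1 q" and ?T = "sup_path (-1) q"
  have [measurable]: "?S \<in> borel_measurable N" "?T \<in> borel_measurable N" using q by auto
  let ?U = "{\<omega> \<in> space N. ?S \<omega> < ereal (R - x) \<and> ?T \<omega> < ereal (R + x)}"
  let ?E = "{\<omega> \<in> space N. ?S \<omega> = ereal (R - x)}" and ?G = "{\<omega> \<in> space N. ?T \<omega> = ereal (R + x)}"
  have U: "?U \<subseteq> ?O"
  proof clarify
    fix \<omega> s assume \<omega>: "\<omega> \<in> space N" "?S \<omega> < ereal (R - x)" "?T \<omega> < ereal (R + x)" and s: "s \<in> {0<..q}"
    have "ereal (1 * X s \<omega>) < ereal (R - x)" "ereal (-1 * X s \<omega>) < ereal (R + x)"
      using le_less_trans[OF le_sup_path[OF \<omega>(1), of s q 1] \<omega>(2)]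
        le_less_trans[OF le_sup_path[OF \<omega>(1), of s q "-1"] \<omega>(3)] s by auto
    then show "x + X s \<omega> \<in> ball 0 R" by (simp add: dist_real_def abs_less_iff)
  qed
  have O: "?O \<subseteq> ?U \<union> (?E \<union> ?G)"
  proof
    fix \<omega> assume "\<omega> \<in> ?O"
    then have \<omega>: "\<omega> \<in> space N" and c: "\<forall>s\<in>{0<..q}. x + X s \<omega> \<in> ball 0 R" by auto
    have c2: "\<bar>x + X s \<omega>\<bar> < R" if "0 < s" "s \<le> q" for s
    proof -
      have "x + X s \<omega> \<in> ball 0 R" using c that by simp
      then show ?thesis by simp
    qed
    have c': "\<bar>x + X s \<omega>\<bar> \<le> R" if "0 \<le> s" "s \<le> q" for s
    proof (cases "s = 0")
      case True
      have "((\<lambda>s. \<bar>x + X s \<omega>\<bar>) \<longlongrightarrow> \<bar>x + X 0 \<omega>\<bar>) (at_right 0)"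
        by (intro tendsto_intros X_right_cont \<omega>) simp
      moreover have "eventually (\<lambda>s. \<bar>x + X s \<omega>\<bar> \<le> R) (at_right 0)"
        using q(1) c2 unfolding eventually_at_right_field by (intro exI[of _ q]) (auto intro: less_imp_le)
      ultimately show ?thesis unfolding True by (rule tendsto_upperbound) simp
    next
      case False
      then show ?thesis using c2[of s] that by simp
    qed
    have "1 * X s \<omega> \<le> R - x \<and> -1 * X s \<omega> \<le> R + x" if "0 \<le> s" "s \<le> q" for s
      using c'[OF that] by linarith
    then have "?S \<omega> \<le> ereal (R - x)" "?T \<omega> \<le> ereal (R + x)"
      using q(1) by (intro sup_path_le; simp)+
    then show "\<omega> \<in> ?U \<union> (?E \<union> ?G)" using \<omega> by (auto simp: order_le_less)
  qed
  have null: "{\<omega> \<in> space N. Y \<omega> = z} \<in> null_sets N"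
    if [measurable]: "Y \<in> borel_measurable N" and z: "measure (distr N borel Y) {z} = 0" for Y :: "'b \<Rightarrow> ereal" and z
  proof
    have "measure (distr N borel Y) {z} = prob {\<omega> \<in> space N. Y \<omega> = z}"
      by (subst measure_distr) (auto intro!: arg_cong[where f=prob])
    then show "emeasure N {\<omega> \<in> space N. Y \<omega> = z} = 0" using z by (simp add: emeasure_eq_measure)
  qed measurable
  have "?E \<in> null_sets N" "?G \<in> null_sets N"
    using x q unfolding exceptional_def by (auto intro!: null)
  then have EG: "?E \<union> ?G \<in> null_sets N" by (rule null_sets.Un)
  show ?thesis
  proof (rule sets_completionI[OF _ _ EG])
    show "?O = ?U \<union> (?O - ?U)" using U by blast
    show "?O - ?U \<subseteq> ?E \<union> ?G" using O by blast
    show "?U \<in> sets N" by measurable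
  qed
qed

lemma exit_time_greater_iff:
  assumes "0 < t"
  shows "ereal t < exit_time X D x \<omega> \<longleftrightarrow> (\<exists>q\<in>{t<..} \<inter> \<rat>. \<forall>s\<in>{0<..q}. x + X s \<omega> \<in> D)"
proof
  assume "ereal t < exit_time X D x \<omega>"
  then obtain z where z: "ereal t < z" "z < exit_time X D x \<omega>" using dense by blast
  then obtain z' where z': "z = ereal z'" by (cases z) auto
  obtain q where q: "q \<in> \<rat>" "t < q" "q < z'" using Rats_dense_in_real[of t z'] z z' by auto
  have "x + X s \<omega> \<in> D" if "s \<in> {0<..q}" for s
  proof (rule ccontr)
    assume "x + X s \<omega> \<notin> D"
    then have "exit_time X D x \<omega> \<le> ereal s"
      unfolding exit_time_def using that by (intro Inf_lower) auto
    also have "\<dots> \<le> ereal q" using that by simp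
    also have "\<dots> < z" using q z' by simp
    finally show False using z by simp
  qed
  then show "\<exists>q\<in>{t<..} \<inter> \<rat>. \<forall>s\<in>{0<..q}. x + X s \<omega> \<in> D" using q by (intro bexI[of _ q]) auto
next
  assume "\<exists>q\<in>{t<..} \<inter> \<rat>. \<forall>s\<in>{0<..q}. x + X s \<omega> \<in> D"
  then obtain q where q: "t < q" "\<And>s. s \<in> {0<..q} \<Longrightarrow> x + X s \<omega> \<in> D" by auto
  have "ereal q \<le> exit_time X D x \<omega>"
    unfolding exit_time_def
  proof (rule Inf_greatest, clarify)
    fix s assume "0 < s" "x + X s \<omega> \<notin> D"
    then show "ereal q \<le> ereal s" using q(2)[of s] by force
  qed
  then show "ereal t < exit_time X D x \<omega>" using q(1) less_le_trans[of "ereal t" "ereal q"] by simp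
qed

text \<open>
  The exit comes after \<open>t\<close> if and only if the path is confined up to some rational time later than
  \<open>t\<close>, which is a countable union of events.
\<close>

lemma exit_event_measurable:
  assumes t: "0 < t" and x: "x \<notin> exceptional R"
  shows "{\<omega> \<in> space N. ereal t < exit_time X (ball 0 R) x \<omega>} \<in> sets (completion N)"
proof -
  have "{\<omega> \<in> space N. ereal t < exit_time X (ball 0 R) x \<omega>}
    = (\<Union>q\<in>{t<..} \<inter> \<rat>. {\<omega> \<in> space N. \<forall>s\<in>{0<..q}. x + X s \<omega> \<in> ball 0 R})"
    unfolding exit_time_greater_iff[OF t] by blast
  moreover have "countable ({t<..} \<inter> \<rat>)" by (simp add: countable_rat)
  ultimately show ?thesis
    using confined_until_measurable[OF _ _ x] t by (auto intro!: sets.countable_UN'')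
qed

abbreviation large_move :: "real \<Rightarrow> real \<Rightarrow> 'b set" where
  "large_move q \<eta> \<equiv> {\<omega> \<in> space N. \<not> (sup_path 1 q \<omega> < ereal \<eta> \<and> sup_path (-1) q \<omega> < ereal \<eta>)}"

text \<open>
  Every path starts at \<open>0\<close> and is right-continuous there.
\<close>

lemma small_oscillation:
  assumes \<eta>: "0 < \<eta>" and \<epsilon>: "0 < \<epsilon>"
  obtains q where "0 < q"
    "prob (large_move q \<eta>) \<le> \<epsilon>"
proof -
  define q where "q n = 1 / real (Suc n)" for n
  have q: "0 < q n" for n by (simp add: q_def)
  have q_le: "q n \<le> q m" if "m \<le> n" for m n using that by (simp add: q_def field_simps)
  define B where "B n = {\<omega> \<in> space N. sup_path 1 (q n) \<omega> < ereal \<eta> \<and> sup_path (-1) (q n) \<omega> < ereal \<eta>}" for n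
  have [measurable]: "sup_path \<epsilon> (q n) \<in> borel_measurable N" for \<epsilon> n using q[of n] by simp
  have Bm [measurable]: "B n \<in> sets N" for n unfolding B_def by measurable
  have "incseq B"
  proof (intro incseq_SucI subsetI)
    fix n \<omega> assume "\<omega> \<in> B n"
    then have \<omega>: "\<omega> \<in> space N" "sup_path 1 (q n) \<omega> < ereal \<eta>" "sup_path (-1) (q n) \<omega> < ereal \<eta>" by (auto simp: B_def)
    have "sup_path \<epsilon> (q (Suc n)) \<omega> \<le> sup_path \<epsilon> (q n) \<omega>" for \<epsilon>
      using q[of "Suc n"] q_le[of n "Suc n"] by (intro sup_path_le le_sup_path \<omega>(1)) auto
    then show "\<omega> \<in> B (Suc n)" using \<omega> by (auto simp: B_def intro: le_less_trans)
  qed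
  then have lim: "(\<lambda>n. prob (B n)) \<longlonglongrightarrow> prob (\<Union>n. B n)"
    using Bm by (intro finite_Lim_measure_incseq) auto
  have "(\<Union>n. B n) = space N"
  proof
    show "(\<Union>n. B n) \<subseteq> space N" by (auto simp: B_def)
    show "space N \<subseteq> (\<Union>n. B n)"
    proof
      fix \<omega> assume \<omega>: "\<omega> \<in> space N"
      have "((\<lambda>s. \<bar>X s \<omega>\<bar>) \<longlongrightarrow> \<bar>X 0 \<omega>\<bar>) (at_right 0)"
        by (intro tendsto_intros X_right_cont \<omega>) simp
      from order_tendstoD(2)[OF this, of "\<eta> / 2"]
      obtain b where b: "0 < b" "\<And>s. 0 < s \<Longrightarrow> s < b \<Longrightarrow> \<bar>X s \<omega>\<bar> < \<eta> / 2"
        using \<eta> X_zero[OF \<omega>] unfolding eventually_at_right_field by auto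
      obtain n where n: "q n < b" using b(1) nat_approx_posE unfolding q_def by blast
      have "\<bar>X s \<omega>\<bar> \<le> \<eta> / 2" if "0 \<le> s" "s \<le> q n" for s
        using that b(2)[of s] n X_zero[OF \<omega>] \<eta> by (cases "s = 0") auto
      then have "sup_path 1 (q n) \<omega> \<le> ereal (\<eta> / 2)" "sup_path (-1) (q n) \<omega> \<le> ereal (\<eta> / 2)"
        using q[of n] by (intro sup_path_le; fastforce simp: abs_le_iff)+
      moreover have "ereal (\<eta> / 2) < ereal \<eta>" using \<eta> by simp
      ultimately have "\<omega> \<in> B n" using \<omega> unfolding B_def by (auto intro: le_less_trans)
      then show "\<omega> \<in> (\<Union>n. B n)" by blast
    qed
  qed
  then have "(\<lambda>n. prob (B n)) \<longlonglongrightarrow> 1" using lim by (simp add: prob_space)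
  from order_tendstoD(1)[OF this, of "1 - \<epsilon>"] \<epsilon> obtain n where n: "1 - \<epsilon> < prob (B n)"
    by (auto simp: eventually_sequentially)
  have "prob (large_move (q n) \<eta>) = 1 - prob (B n)"
    unfolding B_def by (rule prob_neg) measurable
  then show ?thesis using that[of "q n"] q n by simp
qed

end

section \<open>The killed transition density\<close>

locale killed_stable = stable N \<alpha> X for N :: "'b measure" and \<alpha> X +
  fixes R :: real and p :: "real \<Rightarrow> real \<Rightarrow> real \<Rightarrow> real"
  assumes R: "0 < R" and heat_kernel: "killed_transition_density N X (ball 0 R) p"
begin

abbreviation surviving :: "real \<Rightarrow> real \<Rightarrow> real set \<Rightarrow> 'b set" where
  "surviving x t A \<equiv> {\<omega> \<in> space N. x + X t \<omega> \<in> A \<and> ereal t < exit_time X (ball 0 R) x \<omega>}"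

abbreviation mass :: "real \<Rightarrow> real \<Rightarrow> real set \<Rightarrow> ennreal" where
  "mass t x A \<equiv> \<integral>\<^sup>+y\<in>A. ennreal (p t x y) \<partial>lborel"

abbreviation square_mass :: "real \<Rightarrow> real \<Rightarrow> real set \<Rightarrow> ennreal" where
  "square_mass t x A \<equiv> \<integral>\<^sup>+y\<in>A. ennreal ((p t x y)\<^sup>2) \<partial>lborel"

abbreviation smoothed :: "(real \<Rightarrow> real) \<Rightarrow> real \<Rightarrow> real \<Rightarrow> real" where
  "smoothed u0 t x \<equiv> LINT y:ball 0 R|lebesgue. u0 y * p t x y"

lemma kernel_mass:
  assumes "0 < t" "x \<in> ball 0 R" "A \<in> sets borel" "A \<subseteq> ball 0 R"
  shows "emeasure (completion N) (surviving x t A)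
          = mass t x A"
  using heat_kernel assms unfolding killed_transition_density_def by blast

lemma kernel_nonneg: "0 < t \<Longrightarrow> x \<in> ball 0 R \<Longrightarrow> y \<in> ball 0 R \<Longrightarrow> 0 \<le> p t x y"
  using heat_kernel unfolding killed_transition_density_def by blast

lemma kernel_mass_upper:
  assumes "0 < t" "x \<in> ball 0 R" "A \<in> sets borel" "A \<subseteq> ball 0 R"
  shows "mass t x A \<le> emeasure N (hit x t A)"
proof -
  have [measurable]: "X t \<in> borel_measurable N" "A \<in> sets borel" using assms by auto
  have m: "hit x t A \<in> sets N" by measurable
  have "emeasure (completion N) (surviving x t A)
    \<le> emeasure (completion N) (hit x t A)"
    using m by (intro emeasure_mono) auto
  then show ?thesis using m unfolding kernel_mass[OF assms, symmetric] by simp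
qed

text \<open>
  A path that moves by less than \<open>\<eta>\<close> up to a time \<open>q > t\<close> is not killed by time \<open>t\<close>. Measurability
  of the event on the killed side is what excludes the exceptional points.
\<close>

lemma kernel_mass_lower:
  assumes t: "0 < t" "t < q" and x: "x \<notin> exceptional R" "ball x \<eta> \<subseteq> ball 0 R" "0 < \<eta>"
    and A: "A \<in> sets borel" "A \<subseteq> ball 0 R"
    and \<epsilon>: "prob (large_move q \<eta>) \<le> \<epsilon>"
  shows "ennreal (prob (hit x t A) - \<epsilon>) \<le> mass t x A"
proof -
  have xD: "x \<in> ball 0 R" using x(2,3) centre_in_ball[of x \<eta>] by blast
  let ?A = "hit x t A"
  let ?B = "{\<omega> \<in> space N. sup_path 1 q \<omega> < ereal \<eta> \<and> sup_path (-1) q \<omega> < ereal \<eta>}"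
  let ?C = "large_move q \<eta>"
  have [measurable]: "X t \<in> borel_measurable N" "A \<in> sets borel" "sup_path \<epsilon> q \<in> borel_measurable N" for \<epsilon>
    using t A by auto
  have m: "?A \<in> sets N" "?B \<in> sets N" "?C \<in> sets N" by measurable
  have "prob ?A \<le> prob ((?A \<inter> ?B) \<union> ?C)"
    using m by (intro finite_measure_mono) auto
  also have "\<dots> \<le> prob (?A \<inter> ?B) + prob ?C" using m by (intro measure_Un_le) auto
  finally have "ennreal (prob ?A - \<epsilon>) \<le> ennreal (prob (?A \<inter> ?B))" using \<epsilon> by (intro ennreal_leI) simp
  also have "\<dots> = emeasure (completion N) (?A \<inter> ?B)" using m by (simp add: emeasure_eq_measure)
  also have "\<dots> \<le> emeasure (completion N) (surviving x t A)"
  proof (rule emeasure_mono)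
    have "(surviving x t A)
      = ?A \<inter> {\<omega> \<in> space N. ereal t < exit_time X (ball 0 R) x \<omega>}" by blast
    then show "surviving x t A \<in> sets (completion N)"
      using m(1) exit_event_measurable[OF t(1) x(1)] by auto
    show "?A \<inter> ?B \<subseteq> (surviving x t A)"
    proof clarify
      fix \<omega> assume \<omega>: "\<omega> \<in> space N" "sup_path 1 q \<omega> < ereal \<eta>" "sup_path (-1) q \<omega> < ereal \<eta>"
      have in_D: "x + X s \<omega> \<in> ball 0 R" if s: "0 < s" "s \<le> q" for s
      proof -
        have "ereal (1 * X s \<omega>) < ereal \<eta>" "ereal (-1 * X s \<omega>) < ereal \<eta>"
          using le_less_trans[OF le_sup_path[OF \<omega>(1), of s q 1] \<omega>(2)]
            le_less_trans[OF le_sup_path[OF \<omega>(1), of s q "-1"] \<omega>(3)] s by auto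
        then have "x + X s \<omega> \<in> ball x \<eta>" by (auto simp: dist_real_def abs_less_iff)
        then show ?thesis using x(2) by blast
      qed
      obtain q' where "q' \<in> \<rat>" "t < q'" "q' < q" using Rats_dense_in_real[OF t(2)] by blast
      then show "ereal t < exit_time X (ball 0 R) x \<omega>"
        unfolding exit_time_greater_iff[OF t(1)] using in_D by (intro bexI[of _ q']) auto
    qed
  qed
  finally show ?thesis unfolding kernel_mass[OF t(1) xD A] .
qed

lemma kernel_measurable:
  assumes tx: "0 < t" "x \<in> ball 0 R" and A: "A \<in> sets borel" "A \<subseteq> ball 0 R"
  shows "(\<lambda>y. ennreal (p t x y) * indicator A y) \<in> borel_measurable borel"
    and "(\<lambda>y. ennreal ((p t x y)\<^sup>2) * indicator A y) \<in> borel_measurable borel"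
    and "(\<lambda>y. indicator A y * p t x y) \<in> borel_measurable borel"
proof -
  let ?D = "ball 0 R :: real set"
  have j: "(\<lambda>(t, x, y). p t x y) \<in> borel_measurable (restrict_space borel ({0<..} \<times> ?D \<times> ?D))"
    using heat_kernel unfolding killed_transition_density_def by blast
  have "(\<lambda>y. (t, x, y)) \<in> restrict_space borel A \<rightarrow>\<^sub>M restrict_space borel ({0<..} \<times> ?D \<times> ?D)"
    using tx A by (intro measurable_restrict_space2 measurable_restrict_space1) (auto simp: space_restrict_space)
  from measurable_compose[OF this j]
  have m: "(\<lambda>y. p t x y) \<in> borel_measurable (restrict_space borel A)" by simp
  have D: "A \<inter> space borel \<in> sets borel" using A by simp
  show "(\<lambda>y. ennreal (p t x y) * indicator A y) \<in> borel_measurable borel"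
    "(\<lambda>y. ennreal ((p t x y)\<^sup>2) * indicator A y) \<in> borel_measurable borel"
    using m by (auto simp: borel_measurable_restrict_space_iff_ennreal[OF D, symmetric])
  show "(\<lambda>y. indicator A y * p t x y) \<in> borel_measurable borel"
    using m borel_measurable_restrict_space_iff[OF D, of "p t x"] by simp
qed

lemmas kernel_ball_measurable = kernel_measurable[OF _ _ borel_open[OF open_ball] order_refl]

lemma kernel_total_mass:
  assumes "0 < t" "x \<in> ball 0 R"
  shows "mass t x (ball 0 R) \<le> 1"
  using kernel_mass_upper[OF assms, of "ball 0 R"] emeasure_le_1 order_trans by fastforce

text \<open>
  The density is at most \<open>C t powr (-1/\<alpha>)\<close> almost everywhere and has mass at most \<open>1\<close>.
\<close>

lemma kernel_square_upper:
  assumes "1 < \<alpha>"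
  obtains C where "0 < C" "\<And>t x. 0 < t \<Longrightarrow> x \<in> ball 0 R \<Longrightarrow>
    square_mass t x (ball 0 R) \<le> ennreal (C * t powr (- (1 / \<alpha>)))"
proof -
  obtain C where C: "0 < C" "\<And>t x a b A. 0 < t \<Longrightarrow> A \<in> sets borel \<Longrightarrow> A \<subseteq> {a..b} \<Longrightarrow> a < b \<Longrightarrow>
       emeasure N (hit x t A) \<le> ennreal (C * t powr (- (1 / \<alpha>))) * emeasure lborel A"
    using X_density_bound[OF assms] by blast
  let ?D = "ball 0 R :: real set"
  show ?thesis
  proof (rule that[OF C(1)])
    fix t x :: real assume t: "0 < t" and x: "x \<in> ?D"
    note [measurable] = kernel_ball_measurable[OF t x]
    define c where "c = C * t powr (- (1 / \<alpha>))"
    have c: "0 < c" using C(1) t by (simp add: c_def)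
    define A where "A = {y. c < indicator ?D y * p t x y}"
    have A [measurable]: "A \<in> sets borel" unfolding A_def by measurable
    have AD: "A \<subseteq> ?D" using c by (auto simp: A_def indicator_def split: if_splits)
    then have AR: "A \<subseteq> {-R..R}" by (auto simp: subset_iff abs_less_iff)
    have "emeasure lborel A \<le> emeasure lborel {-R..R}" using AR by (intro emeasure_mono) auto
    then have fin: "ennreal c * emeasure lborel A < \<infinity>"
      using R by (simp add: ennreal_mult_less_top le_less_trans)
    have mm: "(\<lambda>y. ennreal (indicator ?D y * p t x y - c) * indicator A y) \<in> borel_measurable lborel" by measurable
    have "(\<integral>\<^sup>+y. ennreal (indicator ?D y * p t x y - c) * indicator A y \<partial>lborel) + ennreal c * emeasure lborel A
      = (\<integral>\<^sup>+y. ennreal (indicator ?D y * p t x y - c) * indicator A y + ennreal c * indicator A y \<partial>lborel)"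
      using mm by (subst nn_integral_add) (auto simp: nn_integral_cmult)
    also have "\<dots> = mass t x A"
      using c AD by (intro nn_integral_cong) (auto simp: indicator_def A_def ennreal_plus[symmetric] simp del: ennreal_plus)
    also have "\<dots> \<le> ennreal c * emeasure lborel A"
      using order_trans[OF kernel_mass_upper[OF t x A AD] C(2)[OF t A AR]] R by (simp add: c_def)
    finally have "ennreal c * emeasure lborel A + (\<integral>\<^sup>+y. ennreal (indicator ?D y * p t x y - c) * indicator A y \<partial>lborel)
      \<le> ennreal c * emeasure lborel A + 0" by (simp add: add.commute)
    then have "(\<integral>\<^sup>+y. ennreal (indicator ?D y * p t x y - c) * indicator A y \<partial>lborel) = 0"
      using fin unfolding ennreal_add_left_cancel_le by auto
    then have "AE y in lborel. ennreal (indicator ?D y * p t x y - c) * indicator A y = 0"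
      using mm by (subst (asm) nn_integral_0_iff_AE) auto
    then have AE: "AE y in lborel. indicator ?D y * p t x y \<le> c"
      by eventually_elim (auto simp: A_def indicator_def ennreal_eq_0_iff not_less split: if_splits)
    have "square_mass t x ?D \<le> (\<integral>\<^sup>+y. ennreal c * (ennreal (p t x y) * indicator ?D y) \<partial>lborel)"
    proof (rule nn_integral_mono_AE)
      show "AE y in lborel. ennreal ((p t x y)\<^sup>2) * indicator ?D y \<le> ennreal c * (ennreal (p t x y) * indicator ?D y)"
        using AE
      proof eventually_elim
        case (elim y)
        show ?case
        proof (cases "y \<in> ?D")
          case True
          then have "(p t x y)\<^sup>2 \<le> c * p t x y"
            using elim kernel_nonneg[OF t x True] by (simp add: power2_eq_square mult_right_mono)
          then show ?thesis using True c kernel_nonneg[OF t x True]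
            by (simp add: ennreal_mult[symmetric] ennreal_leI)
        qed simp
      qed
    qed
    also have "\<dots> = ennreal c * mass t x ?D"
      by (rule nn_integral_cmult) measurable
    also have "\<dots> \<le> ennreal c * 1" by (intro mult_left_mono kernel_total_mass t x) simp
    finally show "square_mass t x ?D \<le> ennreal (C * t powr (- (1 / \<alpha>)))"
      by (simp add: c_def)
  qed
qed

text \<open>
  The Cauchy-Schwarz inequality on the set \<open>A\<close>.
\<close>

lemma kernel_square_mass:
  assumes tx: "0 < t" "x \<in> ball 0 R" and A: "A \<in> sets borel" "A \<subseteq> ball 0 R"
    and len: "emeasure lborel A \<le> ennreal len" "0 < len"
    and m: "ennreal m \<le> mass t x A" "0 \<le> m"
  shows "ennreal (m\<^sup>2 / len) \<le> square_mass t x A" (is "_ \<le> ?I")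
proof -
  note [measurable] = kernel_measurable[OF tx A] A(1)
  have "ennreal (m\<^sup>2) = (ennreal m)\<^sup>2" using m(2) by (simp add: ennreal_power)
  also have "\<dots> \<le> (mass t x A)\<^sup>2"
    using m(1) by (rule power_mono) simp
  also have "\<dots> = (\<integral>\<^sup>+y. indicator A y * (ennreal (p t x y) * indicator A y) \<partial>lborel)\<^sup>2"
    by (intro arg_cong[where f="\<lambda>z. z\<^sup>2"] nn_integral_cong) (auto simp: indicator_def)
  also have "\<dots> \<le> (\<integral>\<^sup>+y. (indicator A y)\<^sup>2 \<partial>lborel) * (\<integral>\<^sup>+y. (ennreal (p t x y) * indicator A y)\<^sup>2 \<partial>lborel)"
    by (rule Cauchy_Schwarz_nn_integral) measurable
  also have "(\<integral>\<^sup>+y. (indicator A y)\<^sup>2 \<partial>lborel) = emeasure lborel A"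
  proof -
    have "(indicator A y :: ennreal)\<^sup>2 = indicator A y" for y by (simp add: indicator_def)
    then show ?thesis by simp
  qed
  also have "(\<integral>\<^sup>+y. (ennreal (p t x y) * indicator A y)\<^sup>2 \<partial>lborel) = ?I"
    using A(2) kernel_nonneg[OF tx]
    by (intro nn_integral_cong) (auto simp: indicator_def ennreal_power subset_iff)
  also have "emeasure lborel A * ?I \<le> ennreal len * ?I" by (intro mult_right_mono len) simp
  finally have *: "ennreal (m\<^sup>2) \<le> ennreal len * ?I" .
  show ?thesis
  proof (cases "?I = \<infinity>")
    case False
    then obtain i where i: "?I = ennreal i" "0 \<le> i" by (cases ?I) auto
    have "m\<^sup>2 \<le> len * i" using * len(2) i by (simp add: ennreal_mult[symmetric])
    then show ?thesis unfolding i(1) using len(2) by (intro ennreal_leI) (simp add: field_simps)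
  qed simp
qed

text \<open>
  From a point in the left half of the interval jump to the right, and conversely, in order to stay in
  the interval: this has probability at least \<open>3/8\<close>, and at most \<open>1/8\<close> is lost by killing.
\<close>

lemma kernel_square_lower:
  assumes \<delta>: "0 < \<delta>" and cD: "{c - 2 * \<delta>..c + 2 * \<delta>} \<subseteq> ball 0 R"
  obtains \<kappa> t0 where "0 < \<kappa>" "0 < t0"
    "\<And>r x. 0 < r \<Longrightarrow> r \<le> t0 \<Longrightarrow> x \<in> {c - \<delta>..c + \<delta>} - exceptional R \<Longrightarrow>
       ennreal (\<kappa> * r powr (- (1 / \<alpha>))) \<le> square_mass r x {c - \<delta>..c + \<delta>}"
proof -
  obtain q where q: "0 < q"
    "prob (large_move q \<delta>) \<le> 1 / 8"
    using small_oscillation[OF \<delta>, of "1 / 8"] by auto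
  obtain K where K: "0 < K"
    "\<And>r. 0 < r \<Longrightarrow> 3 / 8 \<le> prob {\<omega> \<in> space N. 0 \<le> X r \<omega> \<and> X r \<omega> \<le> K * r powr (1 / \<alpha>)}"
    "\<And>r. 0 < r \<Longrightarrow> 3 / 8 \<le> prob {\<omega> \<in> space N. - (K * r powr (1 / \<alpha>)) \<le> X r \<omega> \<and> X r \<omega> \<le> 0}"
    "\<And>r. 0 < r \<Longrightarrow> prob {\<omega> \<in> space N. \<not> \<bar>X r \<omega>\<bar> \<le> K * r powr (1 / \<alpha>)} \<le> 1 / 8"
    by (rule X_small_range) (rule that, assumption+)
  \<comment> \<open>Before \<open>q\<close> killing is unlikely; before \<open>(\<delta> / K) powr \<alpha>\<close> the range is at most \<open>\<delta>\<close>.\<close>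
  define t0 where "t0 = min (q / 2) ((\<delta> / K) powr \<alpha>)"
  have t0: "0 < t0" using q K \<delta> by (simp add: t0_def)
  have "ennreal (1 / (16 * K) * r powr (- (1 / \<alpha>))) \<le> square_mass r x {c - \<delta>..c + \<delta>}"
    if r: "0 < r" "r \<le> t0" and x: "x \<in> {c - \<delta>..c + \<delta>}" "x \<notin> exceptional R" for r x
  proof -
    define \<rho> where "\<rho> = K * r powr (1 / \<alpha>)"
    have \<rho>0: "0 < \<rho>" using K r by (simp add: \<rho>_def)
    have "r powr (1 / \<alpha>) \<le> ((\<delta> / K) powr \<alpha>) powr (1 / \<alpha>)"
      using r alpha_pos by (intro powr_mono2) (auto simp: t0_def)
    also have "\<dots> = \<delta> / K" using K \<delta> alpha_pos by (simp add: powr_powr)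
    finally have \<rho>: "\<rho> \<le> \<delta>" using K by (simp add: \<rho>_def field_simps)
    have rq: "r < q" using r q by (simp add: t0_def)
    have bx: "ball x \<delta> \<subseteq> ball 0 R"
    proof
      fix y assume "y \<in> ball x \<delta>"
      then have "y \<in> {c - 2 * \<delta>..c + 2 * \<delta>}" using x(1) by (auto simp: dist_real_def abs_less_iff)
      then show "y \<in> ball 0 R" using cD by blast
    qed
    then have xD: "x \<in> ball 0 R" using \<delta> centre_in_ball[of x \<delta>] by blast
    obtain l where l: "{l..l + \<rho>} \<subseteq> {c - \<delta>..c + \<delta>}" "3 / 8 \<le> prob (hit x r {l..l + \<rho>})"
    proof (cases "x \<le> c")
      case True
      have "hit x r {x..x + \<rho>} = {\<omega> \<in> space N. 0 \<le> X r \<omega> \<and> X r \<omega> \<le> K * r powr (1 / \<alpha>)}"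
        by (auto simp: \<rho>_def)
      then show ?thesis using that[of x] True x(1) \<rho> K(2)[OF r(1)] by auto
    next
      case False
      have "hit x r {x - \<rho>..x - \<rho> + \<rho>} = {\<omega> \<in> space N. - (K * r powr (1 / \<alpha>)) \<le> X r \<omega> \<and> X r \<omega> \<le> 0}"
        by (auto simp: \<rho>_def)
      then show ?thesis using that[of "x - \<rho>"] False x(1) \<rho> K(3)[OF r(1)] by auto
    qed
    have lD: "{l..l + \<rho>} \<subseteq> ball 0 R" using l(1) cD \<delta> by (auto simp: subset_iff)
    have "ennreal (1 / 4) \<le> ennreal (prob (hit x r {l..l + \<rho>}) - 1 / 8)"
      using l(2) by (intro ennreal_leI) simp
    also have "\<dots> \<le> mass r x {l..l + \<rho>}"
      by (rule kernel_mass_lower[OF r(1) rq x(2) bx \<delta> _ lD q(2)]) simp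
    finally have "ennreal ((1 / 4)\<^sup>2 / \<rho>) \<le> square_mass r x {l..l + \<rho>}"
      using \<rho>0 lD by (intro kernel_square_mass[OF r(1) xD]) auto
    also have "\<dots> \<le> square_mass r x {c - \<delta>..c + \<delta>}"
      using l(1) by (intro nn_integral_mono) (auto simp: indicator_def)
    also have "(1 / 4)\<^sup>2 / \<rho> = 1 / (16 * K) * r powr (- (1 / \<alpha>))"
      using r K by (simp add: \<rho>_def powr_minus power2_eq_square field_simps)
    finally show ?thesis .
  qed
  then show ?thesis using that[of "1 / (16 * K)" t0] K t0 by auto
qed

section \<open>The action of the kernel on the initial condition\<close>

lemma weighted_kernel_integral:
  assumes tx: "0 < t" "x \<in> ball 0 R" and int: "set_integrable lebesgue (ball 0 R) (\<lambda>y. u0 y * p t x y)"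
    and nn: "\<And>y. y \<in> ball 0 R \<Longrightarrow> 0 \<le> u0 y"
  shows "0 \<le> smoothed u0 t x"
    and "ennreal (smoothed u0 t x)
       = (\<integral>\<^sup>+y. ennreal (indicator (ball 0 R) y * (u0 y * p t x y)) \<partial>lborel)"
proof -
  have n: "0 \<le> indicator (ball 0 R) y * (u0 y * p t x y)" for y
    using nn[of y] kernel_nonneg[OF tx, of y] by (auto simp: indicator_def)
  show "0 \<le> smoothed u0 t x"
    unfolding set_lebesgue_integral_def real_scaleR_def by (rule Bochner_Integration.integral_nonneg) (rule n)
  show "ennreal (smoothed u0 t x)
       = (\<integral>\<^sup>+y. ennreal (indicator (ball 0 R) y * (u0 y * p t x y)) \<partial>lborel)"
    using int n unfolding set_lebesgue_integral_def set_integrable_def real_scaleR_def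
    by (subst nn_integral_eq_integral[symmetric]) (auto simp: nn_integral_completion)
qed

lemma weighted_kernel_upper:
  assumes tx: "0 < t" "x \<in> ball 0 R" and int: "set_integrable lebesgue (ball 0 R) (\<lambda>y. u0 y * p t x y)"
    and nn: "\<And>y. y \<in> ball 0 R \<Longrightarrow> 0 \<le> u0 y" and c: "\<And>y. y \<in> ball 0 R \<Longrightarrow> u0 y \<le> c" "0 \<le> c"
  shows "smoothed u0 t x \<le> c"
proof -
  note [measurable] = kernel_ball_measurable[OF tx]
  have eq: "ennreal (smoothed u0 t x)
       = (\<integral>\<^sup>+y. ennreal (indicator (ball 0 R) y * (u0 y * p t x y)) \<partial>lborel)"
    by (intro weighted_kernel_integral(2) tx int nn)
  have "ennreal (smoothed u0 t x)
    \<le> (\<integral>\<^sup>+y. ennreal c * (ennreal (p t x y) * indicator (ball 0 R) y) \<partial>lborel)"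
    unfolding eq using c kernel_nonneg[OF tx]
    by (intro nn_integral_mono)
      (auto simp: indicator_def ennreal_mult[symmetric] simp del: ennreal_le_iff intro!: ennreal_leI mult_right_mono)
  also have "\<dots> = ennreal c * mass t x (ball 0 R)"
    by (rule nn_integral_cmult) measurable
  also have "\<dots> \<le> ennreal c * 1" by (intro mult_left_mono kernel_total_mass tx) simp
  finally show ?thesis using c(2) by simp
qed

lemma weighted_kernel_lower:
  assumes tx: "0 < t" "x \<in> ball 0 R" and int: "set_integrable lebesgue (ball 0 R) (\<lambda>y. u0 y * p t x y)"
    and nn: "\<And>y. y \<in> ball 0 R \<Longrightarrow> 0 \<le> u0 y"
    and A: "A \<in> sets borel" "A \<subseteq> ball 0 R" and e: "\<And>y. y \<in> A \<Longrightarrow> e \<le> u0 y" "0 \<le> e"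
    and m: "ennreal m \<le> mass t x A"
  shows "e * m \<le> smoothed u0 t x"
proof -
  note [measurable] = kernel_measurable[OF tx A]
  have "ennreal (e * m) = ennreal e * ennreal m" using e(2) by (simp add: ennreal_mult')
  also have "\<dots> \<le> ennreal e * mass t x A"
    using m by (rule mult_left_mono) simp
  also have "\<dots> = (\<integral>\<^sup>+y. ennreal e * (ennreal (p t x y) * indicator A y) \<partial>lborel)"
    by (rule nn_integral_cmult[symmetric]) measurable
  also have "\<dots> \<le> (\<integral>\<^sup>+y. ennreal (indicator (ball 0 R) y * (u0 y * p t x y)) \<partial>lborel)"
    using e A(2) kernel_nonneg[OF tx]
    by (intro nn_integral_mono)
      (auto simp: indicator_def ennreal_mult[symmetric] subset_iff intro!: ennreal_leI mult_right_mono)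
  also have "\<dots> = ennreal (smoothed u0 t x)"
    by (intro weighted_kernel_integral(2)[symmetric] tx int nn)
  finally have "ennreal (e * m) \<le> ennreal (smoothed u0 t x)" .
  moreover have "0 \<le> smoothed u0 t x"
    by (intro weighted_kernel_integral(1) tx int nn)
  ultimately show ?thesis by simp
qed

text \<open>
  Exhaust \<open>{u\<^sub>0 > 0}\<close> by sets on which \<open>u\<^sub>0\<close> is bounded below and which keep away from the boundary;
  one of them has positive measure.
\<close>

lemma bounded_below_on_borel_set:
  fixes u0 :: "real \<Rightarrow> real"
  assumes u0: "u0 \<in> borel_measurable (lebesgue_on (ball 0 R))"
    and pos: "0 < emeasure lebesgue {x \<in> ball 0 R. 0 < u0 x}"
  obtains A e h where "A \<in> sets borel" "A \<subseteq> {- (R - h)..R - h}" "0 < h" "h < R" "0 < e"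
    "0 < emeasure lborel A" "\<And>x. x \<in> A \<Longrightarrow> e \<le> u0 x"
proof -
  \<comment> \<open>The denominator \<open>n + 2\<close> keeps the margin strictly below \<open>R\<close> for \<open>n = 0\<close>.\<close>
  define B where "B n = {x \<in> ball 0 R. 1 / real (Suc n) \<le> u0 x \<and> \<bar>x\<bar> \<le> R - R / (real n + 2)}" for n :: nat
  have Bm: "B n \<in> sets lebesgue" for n
  proof -
    have "{x \<in> space (lebesgue_on (ball 0 R)). 1 / real (Suc n) \<le> u0 x} \<in> sets (lebesgue_on (ball 0 R))"
      using u0 by measurable
    then have "{x \<in> ball 0 R. 1 / real (Suc n) \<le> u0 x} \<in> sets lebesgue"
      by (auto simp: sets_restrict_space_iff)
    moreover have "{x::real. \<bar>x\<bar> \<le> R - R / (real n + 2)} \<in> sets lebesgue" by simp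
    moreover have "B n = {x \<in> ball 0 R. 1 / real (Suc n) \<le> u0 x} \<inter> {x. \<bar>x\<bar> \<le> R - R / (real n + 2)}"
      unfolding B_def by blast
    ultimately show ?thesis by (simp only: sets.Int)
  qed
  have "{x \<in> ball 0 R. 0 < u0 x} \<subseteq> (\<Union>n. B n)"
  proof clarify
    fix x :: real assume x: "x \<in> ball 0 R" "0 < u0 x"
    obtain n1 where n1: "1 / real (Suc n1) < u0 x" using nat_approx_posE[OF x(2)] by blast
    have "0 < (R - \<bar>x\<bar>) / R" using x R by simp
    then obtain n2 where n2: "1 / real (Suc n2) < (R - \<bar>x\<bar>) / R" using nat_approx_posE by blast
    define n where "n = max n1 n2"
    have "1 / real (Suc n) \<le> 1 / real (Suc n1)" by (simp add: n_def frac_le)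
    moreover have "1 / (real n + 2) \<le> 1 / real (Suc n2)" by (simp add: n_def frac_le)
    then have "1 / (real n + 2) < (R - \<bar>x\<bar>) / R" using n2 by simp
    then have "R / (real n + 2) < R - \<bar>x\<bar>" using R by (simp add: field_simps)
    ultimately have "x \<in> B n" using x n1 by (auto simp: B_def)
    then show "x \<in> (\<Union>n. B n)" by blast
  qed
  then have "emeasure lebesgue {x \<in> ball 0 R. 0 < u0 x} \<le> emeasure lebesgue (\<Union>n. B n)"
    using Bm by (intro emeasure_mono) auto
  then have "emeasure lebesgue (\<Union>n. B n) \<noteq> 0" using pos by auto
  then obtain n where n: "emeasure lebesgue (B n) \<noteq> 0"
    using emeasure_UN_eq_0[of lebesgue B] Bm by blast
  obtain S Z Z' where S: "B n = S \<union> Z" "Z \<subseteq> Z'" "Z' \<in> null_sets lborel" "S \<in> sets lborel"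
    by (rule sets_completionE[OF Bm[of n]]) (rule that, assumption+)
  have "emeasure lborel S \<noteq> 0"
  proof
    assume "emeasure lborel S = 0"
    then have "S \<union> Z' \<in> null_sets lborel" using S by (intro null_sets.Un) auto
    then have "B n \<in> null_sets lebesgue"
      unfolding S(1) using S(2) by (subst null_sets_completion_iff2) blast
    then have "emeasure lebesgue (B n) = 0" by (rule null_setsD1)
    with n show False by (rule notE)
  qed
  then have Spos: "0 < emeasure lborel S" by (simp add: zero_less_iff_neq_zero)
  have SB: "x \<in> B n" if "x \<in> S" for x using S(1) that by blast
  show ?thesis
  proof (rule that[of S "R / (real n + 2)" "1 / real (Suc n)"])
    show "S \<in> sets borel" using S(4) by simp
    show "S \<subseteq> {- (R - R / (real n + 2))..R - R / (real n + 2)}"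
    proof
      fix x assume "x \<in> S"
      then have "\<bar>x\<bar> \<le> R - R / (real n + 2)" using SB by (simp add: B_def)
      then show "x \<in> {- (R - R / (real n + 2))..R - R / (real n + 2)}" by auto
    qed
    show "1 / real (Suc n) \<le> u0 x" if "x \<in> S" for x using SB[OF that] by (simp add: B_def)
  qed (use R Spos in \<open>auto simp: field_simps add_pos_nonneg\<close>)
qed

text \<open>
  Take an interval almost filled by a set on which \<open>u0 \<ge> e\<close>, and times \<open>s\<close> for which the range
  \<open>K s powr (1/\<alpha>)\<close> is comparable to the length of the interval. Started in the middle half, the
  process is in the interval at time \<open>s\<close> with probability at least \<open>7/8\<close>; it is in the interval but
  not in the set with probability at most \<open>1/8\<close>, by the bound of
  the density, and is killed with probability at most \<open>1/8\<close>.
\<close>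

lemma initial_lower:
  assumes \<alpha>: "1 < \<alpha>" and u0: "u0 \<in> borel_measurable (lebesgue_on (ball 0 R))"
    and nn: "\<And>y. y \<in> ball 0 R \<Longrightarrow> 0 \<le> u0 y"
    and pos: "0 < emeasure lebesgue {x \<in> ball 0 R. 0 < u0 x}" and T: "0 < T"
    and int: "\<And>t x. 0 < t \<Longrightarrow> x \<in> ball 0 R \<Longrightarrow> set_integrable lebesgue (ball 0 R) (\<lambda>y. u0 y * p t x y)"
  obtains c \<delta> a b m where "0 < \<delta>" "{c - 2 * \<delta>..c + 2 * \<delta>} \<subseteq> ball 0 R" "0 < a" "a < b" "b \<le> T" "0 < m"
    "\<And>s x. s \<in> {a..b} \<Longrightarrow> x \<in> {c - \<delta>..c + \<delta>} - exceptional R \<Longrightarrow> m \<le> smoothed u0 s x"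
proof -
  obtain A e h where A: "A \<in> sets borel" "A \<subseteq> {- (R - h)..R - h}" "0 < h" "h < R" "0 < e"
    "0 < emeasure lborel A" "\<And>x. x \<in> A \<Longrightarrow> e \<le> u0 x"
    by (rule bounded_below_on_borel_set[OF u0 pos]) (rule that, assumption+)
  obtain C where C: "0 < C" "\<And>t x a b A. 0 < t \<Longrightarrow> A \<in> sets borel \<Longrightarrow> A \<subseteq> {a..b} \<Longrightarrow> a < b \<Longrightarrow>
       emeasure N (hit x t A) \<le> ennreal (C * t powr (- (1 / \<alpha>))) * emeasure lborel A"
    using X_density_bound[OF \<alpha>] by blast
  obtain K where K: "0 < K"
    "\<And>r. 0 < r \<Longrightarrow> 3 / 8 \<le> prob {\<omega> \<in> space N. 0 \<le> X r \<omega> \<and> X r \<omega> \<le> K * r powr (1 / \<alpha>)}"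
    "\<And>r. 0 < r \<Longrightarrow> 3 / 8 \<le> prob {\<omega> \<in> space N. - (K * r powr (1 / \<alpha>)) \<le> X r \<omega> \<and> X r \<omega> \<le> 0}"
    "\<And>r. 0 < r \<Longrightarrow> prob {\<omega> \<in> space N. \<not> \<bar>X r \<omega>\<bar> \<le> K * r powr (1 / \<alpha>)} \<le> 1 / 8"
    by (rule X_small_range) (rule that, assumption+)
  obtain q where q: "0 < q"
    "prob (large_move q (h / 2)) \<le> 1 / 8"
    using small_oscillation[of "h / 2" "1 / 8"] A(3) by auto
  define T' where "T' = min T (q / 2)"
  \<comment> \<open>Short enough that the interval keeps the distance \<open>h / 2\<close> from the boundary and that the time
    \<open>b\<close> below is at most \<open>T'\<close>.\<close>
  define \<delta>0 where "\<delta>0 = min (h / 2) (4 * K * T' powr (1 / \<alpha>))"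
  \<comment> \<open>Below, the set is missed with probability at most \<open>8 * C * K * \<eta>\<close>, which shall be \<open>1 / 8\<close>.\<close>
  define \<eta> where "\<eta> = min (1 / 2) (1 / (64 * C * K))"
  have T': "0 < T'" "T' \<le> T" "T' < q" using T q by (auto simp: T'_def)
  have \<delta>0: "0 < \<delta>0" using A K T' by (simp add: \<delta>0_def)
  have \<eta>: "0 < \<eta>" "\<eta> < 1" "8 * C * K * \<eta> \<le> 1 / 8"
    using C K by (auto simp: \<eta>_def min_def field_simps)
  obtain c0 d0 where cd: "c0 < d0" "d0 - c0 \<le> \<delta>0" "(1 - \<eta>) * (d0 - c0) < measure lborel (A \<inter> {c0..d0})"
    "measure lborel ({c0..d0} - A) < \<eta> * (d0 - c0)"
    using interval_of_high_density[OF A(1,2,6) \<delta>0 \<eta>(1,2)] by blast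
  define c where "c = (c0 + d0) / 2"
  define \<delta> where "\<delta> = (d0 - c0) / 4"
  \<comment> \<open>The time at which the range \<open>K * b powr (1 / \<alpha>)\<close> equals \<open>\<delta>\<close>.\<close>
  define b where "b = (\<delta> / K) powr \<alpha>"
  have \<delta>: "0 < \<delta>" using cd by (simp add: \<delta>_def)
  have cd_eq: "{c - 2 * \<delta>..c + 2 * \<delta>} = {c0..d0}" by (auto simp: c_def \<delta>_def field_simps)
  have "A \<inter> {c0..d0} \<noteq> {}"
  proof
    assume "A \<inter> {c0..d0} = {}"
    then have "(1 - \<eta>) * (d0 - c0) < 0" using cd(3) by simp
    then show False using \<eta> cd(1) by (simp add: mult_less_0_iff)
  qed
  then obtain z where z: "z \<in> A" "z \<in> {c0..d0}" by blast
  have margin: "ball x (h / 2) \<subseteq> ball 0 R" if "x \<in> {c0..d0}" for x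
  proof
    fix y assume "y \<in> ball x (h / 2)"
    then have y: "\<bar>y - x\<bar> < h / 2" by (simp add: dist_real_def abs_minus_commute)
    have "z \<in> {- (R - h)..R - h}" using z(1) A(2) by blast
    then have "\<bar>z\<bar> \<le> R - h" unfolding atLeastAtMost_iff by linarith
    moreover have "\<bar>x - z\<bar> \<le> h / 2"
    proof -
      have "d0 - c0 \<le> h / 2" using cd(2) by (simp add: \<delta>0_def)
      then show ?thesis using that z(2) unfolding atLeastAtMost_iff by linarith
    qed
    ultimately have "\<bar>y\<bar> < R" using y by linarith
    then show "y \<in> ball 0 R" by simp
  qed
  have cdD: "{c0..d0} \<subseteq> ball 0 R"
    using margin A(3) centre_in_ball by (metis half_gt_zero subsetD subsetI)
  have b0: "0 < b" using \<delta> K by (simp add: b_def)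
  have bpow: "b powr (1 / \<alpha>) = \<delta> / K" using \<delta> K alpha_pos by (simp add: b_def powr_powr)
  have bT: "b \<le> T'"
  proof -
    have "\<delta> / K \<le> T' powr (1 / \<alpha>)" using cd(2) K by (simp add: \<delta>_def \<delta>0_def field_simps)
    then have "b \<le> (T' powr (1 / \<alpha>)) powr \<alpha>" unfolding b_def using \<delta> K alpha_pos by (intro powr_mono2) auto
    then show ?thesis using T' alpha_pos by (simp add: powr_powr)
  qed
  have main: "e * (1 / 2) \<le> smoothed u0 s x"
    if s: "s \<in> {b / 2..b}" and x: "x \<in> {c - \<delta>..c + \<delta>}" "x \<notin> exceptional R" for s x
  proof -
    have s0: "0 < s" "s < q" using s b0 bT T' by auto
    have xI: "x \<in> {c0..d0}" using x(1) \<delta> unfolding cd_eq[symmetric] by auto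
    then have xD: "x \<in> ball 0 R" using cdD by blast
    let ?A = "A \<inter> {c0..d0}"
    have Am: "?A \<in> sets borel" "?A \<subseteq> ball 0 R" using A(1) cdD by auto
    have [measurable]: "X s \<in> borel_measurable N" using s0 by simp
    have [measurable]: "A \<in> sets borel" by (rule A(1))
    have "K * s powr (1 / \<alpha>) \<le> K * b powr (1 / \<alpha>)"
      using s s0 K alpha_pos by (intro mult_left_mono powr_mono2) auto
    then have Ks: "K * s powr (1 / \<alpha>) \<le> \<delta>" using bpow K by simp
    have "s powr (- (1 / \<alpha>)) \<le> (b / 2) powr (- (1 / \<alpha>))"
      using s b0 alpha_pos by (intro powr_mono2') auto
    also have "\<dots> = 2 powr (1 / \<alpha>) * (K / \<delta>)"
      using b0 bpow K \<delta> by (simp add: powr_divide powr_minus field_simps)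
    also have "\<dots> \<le> 2 powr 1 * (K / \<delta>)"
      using \<alpha> K \<delta> by (intro mult_right_mono powr_mono) auto
    finally have spow: "s powr (- (1 / \<alpha>)) \<le> 2 * (K / \<delta>)" by simp
    let ?near = "{\<omega> \<in> space N. \<not> \<bar>X s \<omega>\<bar> \<le> K * s powr (1 / \<alpha>)}"
    let ?miss = "(hit x s ({c0..d0} - A))"
    let ?hit = "hit x s ?A"
    have "ennreal (prob ?miss) \<le> ennreal (C * s powr (- (1 / \<alpha>))) * emeasure lborel ({c0..d0} - A)"
      using C(2)[OF s0(1), of "{c0..d0} - A" c0 d0 x] cd(1) A(1) by (simp add: emeasure_eq_measure)
    also have "emeasure lborel ({c0..d0} - A) = ennreal (measure lborel ({c0..d0} - A))"
    proof (rule emeasure_eq_ennreal_measure)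
      have "emeasure lborel ({c0..d0} - A) \<le> emeasure lborel {c0..d0}" by (intro emeasure_mono) auto
      then show "emeasure lborel ({c0..d0} - A) \<noteq> top" using cd(1) by (auto simp: top_unique)
    qed
    also have "ennreal (C * s powr (- (1 / \<alpha>))) * \<dots> = ennreal (C * s powr (- (1 / \<alpha>)) * measure lborel ({c0..d0} - A))"
      using C(1) by (simp add: ennreal_mult)
    finally have "prob ?miss \<le> C * s powr (- (1 / \<alpha>)) * measure lborel ({c0..d0} - A)"
      using C(1) by simp
    also have "\<dots> \<le> C * (2 * (K / \<delta>)) * (\<eta> * (4 * \<delta>))"
    proof (intro mult_mono)
      show "measure lborel ({c0..d0} - A) \<le> \<eta> * (4 * \<delta>)" 
      proof -
        have "4 * \<delta> = d0 - c0" by (simp add: \<delta>_def)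
        then show ?thesis using cd(4) by simp
      qed
    qed (use C(1) K(1) \<delta> spow in auto)
    also have "\<dots> = 8 * C * K * \<eta>" using \<delta> by (simp add: field_simps)
    finally have miss: "prob ?miss \<le> 1 / 8" using \<eta>(3) by simp
    have "1 = prob (space N)" by (simp add: prob_space)
    also have "\<dots> \<le> prob (?hit \<union> (?miss \<union> ?near))"
    proof (intro finite_measure_mono subsetI)
      fix \<omega> assume \<omega>: "\<omega> \<in> space N"
      have "x + X s \<omega> \<in> {c0..d0}" if "\<bar>X s \<omega>\<bar> \<le> K * s powr (1 / \<alpha>)"
        using that Ks x(1) unfolding cd_eq[symmetric] by auto
      then show "\<omega> \<in> ?hit \<union> (?miss \<union> ?near)" using \<omega> by auto
    qed measurable
    also have "\<dots> \<le> prob ?hit + prob (?miss \<union> ?near)" by (intro measure_Un_le) measurable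
    also have "\<dots> \<le> prob ?hit + (prob ?miss + prob ?near)" by (intro add_left_mono measure_Un_le) measurable
    finally have hit: "6 / 8 \<le> prob ?hit" using miss K(4)[OF s0(1)] by simp
    have "ennreal (1 / 2) \<le> ennreal (prob ?hit - 1 / 8)" using hit by (intro ennreal_leI) simp
    also have "\<dots> \<le> mass s x ?A"
      by (rule kernel_mass_lower[OF s0 x(2) margin[OF xI] _ Am q(2)]) (use A(3) in simp)
    finally show ?thesis
      by (intro weighted_kernel_lower[OF s0(1) xD int[OF s0(1) xD] nn Am]) (use A in auto)
  qed
  show ?thesis
    by (rule that[of \<delta> c "b / 2" b "e * (1 / 2)"]) (use \<delta> b0 bT T' A(5) cdD cd_eq main in auto)
qed

end

section \<open>The excitation index\<close>

lemma sector_condition: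
  fixes \<sigma> :: "real \<Rightarrow> real"
  assumes "\<sigma> 0 = 0" and low: "0 < (INF x\<in>-{0}. ereal \<bar>\<sigma> x / x\<bar>)" and up: "(SUP x\<in>-{0}. ereal \<bar>\<sigma> x / x\<bar>) < \<infinity>"
  obtains a b where "0 < a" "\<And>x. a * \<bar>x\<bar> \<le> \<bar>\<sigma> x\<bar>" "0 < b" "\<And>x. \<bar>\<sigma> x\<bar> \<le> b * \<bar>x\<bar>"
proof -
  obtain z where z: "0 < z" "z < (INF x\<in>-{0}. ereal \<bar>\<sigma> x / x\<bar>)" using dense[OF low] by blast
  obtain z' where z': "(SUP x\<in>-{0}. ereal \<bar>\<sigma> x / x\<bar>) < z'" "z' < \<infinity>" using dense[OF up] by blast
  have ratio: "z \<le> ereal \<bar>\<sigma> x / x\<bar>" "ereal \<bar>\<sigma> x / x\<bar> \<le> z'" if "x \<noteq> 0" for x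
  proof -
    have "z \<le> (INF x\<in>-{0}. ereal \<bar>\<sigma> x / x\<bar>)" using z(2) by simp
    also have "\<dots> \<le> ereal \<bar>\<sigma> x / x\<bar>" using that by (intro INF_lower) auto
    finally show "z \<le> ereal \<bar>\<sigma> x / x\<bar>" .
    have "ereal \<bar>\<sigma> x / x\<bar> \<le> (SUP x\<in>-{0}. ereal \<bar>\<sigma> x / x\<bar>)" using that by (intro SUP_upper) auto
    then show "ereal \<bar>\<sigma> x / x\<bar> \<le> z'" using z'(1) by simp
  qed
  obtain a where a: "z = ereal a" "0 < a" using z(1) ratio(1)[of 1] by (cases z) auto
  obtain b where b: "z' = ereal b" using z'(2) ratio[of 1] z(1) by (cases z') auto
  have "a \<le> b" using order_trans[OF ratio[of 1]] a b by simp
  show ?thesis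
  proof (rule that[of a b])
    show "a * \<bar>x\<bar> \<le> \<bar>\<sigma> x\<bar>" "\<bar>\<sigma> x\<bar> \<le> b * \<bar>x\<bar>" for x
      using ratio[of x] assms(1) a(1) b by (cases "x = 0"; simp add: field_simps)+
  qed (use a \<open>a \<le> b\<close> in auto)
qed

text \<open>
  The stochastic heat equation with the growth bounds of \<open>\<sigma>\<close> and the bound of \<open>u0\<close> made explicit;
  \<open>u l\<close> is the solution at noise level \<open>l\<close>.
\<close>

locale multiplicative_heat_equation =
  white_noise_space M F "ball 0 R" w + K: killed_stable N \<alpha> X R p
  for M :: "'a measure" and F and R and w and N :: "'b measure" and \<alpha> X p +
  fixes u0 \<sigma> :: "real \<Rightarrow> real" and sl su c :: real
    and u :: "real \<Rightarrow> real \<Rightarrow> real \<Rightarrow> 'a \<Rightarrow> real"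
  assumes alpha: "1 < \<alpha>"
    and \<sigma>_measurable: "\<sigma> \<in> borel_measurable borel"
    and sector: "0 < sl" "\<And>x. sl * \<bar>x\<bar> \<le> \<bar>\<sigma> x\<bar>" "0 < su" "\<And>x. \<bar>\<sigma> x\<bar> \<le> su * \<bar>x\<bar>"
    and u0_measurable: "u0 \<in> borel_measurable (lebesgue_on (ball 0 R))"
    and u0_nonneg: "\<And>x. x \<in> ball 0 R \<Longrightarrow> 0 \<le> u0 x"
    and u0_pos: "0 < emeasure lebesgue {x \<in> ball 0 R. 0 < u0 x}"
    and c: "1 \<le> c" "\<And>x. x \<in> ball 0 R \<Longrightarrow> u0 x \<le> c"
    and solution: "\<And>l. 0 < l \<Longrightarrow> mild_solution M F (ball 0 R) w p \<sigma> u0 l (u l)"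
    and moments: "\<And>l. 0 < l \<Longrightarrow> locally_bounded_moments M (ball 0 R) (u l)"
begin

definition second_moment :: "real \<Rightarrow> real \<Rightarrow> real \<Rightarrow> ennreal" where
  "second_moment l s x = sq_mean (u l s x)"

definition exponent :: real where
  "exponent = 2 * \<alpha> / (\<alpha> - 1)"

lemma exponent_pos: "0 < exponent" and exponent_eq: "exponent * (1 - 1 / \<alpha>) = 2"
  using alpha by (auto simp: exponent_def field_simps)

lemma inverse_alpha: "0 < 1 / \<alpha>" "1 / \<alpha> < 1"
  using alpha by auto

lemma initial_integrable:
  "0 < t \<Longrightarrow> x \<in> ball 0 R \<Longrightarrow> set_integrable lebesgue (ball 0 R) (\<lambda>y. u0 y * p t x y)"
  using solution[OF zero_less_one] unfolding mild_solution_def by blast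

lemma square_kernel_measurable:
  "0 < r \<Longrightarrow> x \<in> ball 0 R \<Longrightarrow> square_kernel p L r x \<in> borel_measurable borel"
  using K.kernel_ball_measurable(2)[of r x] by measurable

lemma mean_square_le:
  assumes "0 < t" "x \<in> ball 0 R"
  shows "(K.smoothed u0 t x)\<^sup>2 \<le> c\<^sup>2"
proof (rule power_mono)
  show "K.smoothed u0 t x \<le> c"
    by (intro K.weighted_kernel_upper assms initial_integrable u0_nonneg c(2)) (use c(1) in auto)
  show "0 \<le> K.smoothed u0 t x"
    by (intro K.weighted_kernel_integral(1) assms initial_integrable u0_nonneg)
qed

lemma ball_measure: "emeasure lborel (ball 0 R :: real set) = ennreal (2 * R)"
proof -
  have "ball 0 R = {-R<..<R}" by (auto simp: abs_less_iff)
  then show ?thesis using K.R by simp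
qed

text \<open>
  The exponent \<open>\<beta> = Ku * l powr (2\<alpha>/(\<alpha> - 1))\<close> is the solution of the smallness condition of
  \<open>volterra_upper\<close> with equality.
\<close>

lemma second_moment_exponential_upper:
  assumes t: "0 < t"
  obtains Ku where "0 < Ku" "\<And>l x. 0 < l \<Longrightarrow> x \<in> ball 0 R \<Longrightarrow>
    second_moment l t x \<le> ennreal (2 * c\<^sup>2 * exp (Ku * l powr exponent * t))"
proof -
  let ?D = "ball 0 R :: real set"
  define \<gamma> where "\<gamma> = 1 / \<alpha>"
  note \<gamma> = inverse_alpha[folded \<gamma>_def]
  obtain C where C: "0 < C" "\<And>t x. 0 < t \<Longrightarrow> x \<in> ?D \<Longrightarrow>
    K.square_mass t x ?D \<le> ennreal (C * t powr (- (1 / \<alpha>)))"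
    by (rule K.kernel_square_upper[OF alpha]) (rule that, assumption+)
  \<comment> \<open>\<open>\<beta> = Ku * l powr exponent\<close> solves \<open>l\<^sup>2 * V * \<beta> powr (\<gamma> - 1) = 1 / 2\<close>.\<close>
  define V where "V = su\<^sup>2 * C * (1 / (1 - \<gamma>) + 1)"
  have V: "0 < V" using sector C \<gamma> by (auto simp: V_def intro!: mult_pos_pos add_pos_pos)
  define Ku where "Ku = (2 * V) powr (1 / (1 - \<gamma>))"
  have Ku: "0 < Ku" using V by (simp add: Ku_def)
  have f_upper: "second_moment l t x \<le> ennreal (2 * c\<^sup>2 * exp (Ku * l powr exponent * t))" if l: "0 < l" and x: "x \<in> ?D" for l x
  proof -
    obtain B where B: "\<And>s x. 0 \<le> s \<Longrightarrow> s \<le> t \<Longrightarrow> x \<in> ?D \<Longrightarrow> second_moment l s x \<le> ennreal B"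
      using locally_bounded_momentsD[OF moments[OF l] t] unfolding second_moment_def by blast
    show ?thesis
    proof (rule volterra_upper[where D="?D" and T=t and C="su\<^sup>2 * C" and \<Lambda>="l\<^sup>2" and B=B
          and k="square_kernel p su", OF \<gamma>])
      show "square_kernel p su r x \<in> borel_measurable borel" if "0 < r" "x \<in> ?D" for r x
        using that by (rule square_kernel_measurable)
      show "(\<integral>\<^sup>+y. square_kernel p su r x y \<partial>lborel) \<le> ennreal (su\<^sup>2 * C * r powr - \<gamma>)"
        if "0 < r" "x \<in> ?D" for r x
      proof -
        note [measurable] = K.kernel_ball_measurable(2)[OF that]
        have "(\<integral>\<^sup>+y. square_kernel p su r x y \<partial>lborel)
          = ennreal (su\<^sup>2) * K.square_mass r x ?D"
          by (rule nn_integral_cmult) measurable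
        also have "\<dots> \<le> ennreal (su\<^sup>2) * ennreal (C * r powr (- (1 / \<alpha>)))"
          by (intro mult_left_mono C(2) that) simp
        also have "\<dots> = ennreal (su\<^sup>2 * C * r powr - \<gamma>)"
          using C(1) by (simp add: ennreal_mult[symmetric] \<gamma>_def mult.assoc)
        finally show ?thesis .
      qed
      show "second_moment l s x \<le> ennreal B" if "0 < s" "s \<le> t" "x \<in> ?D" for s x using B that by simp
      show "second_moment l s x \<le> ennreal (c\<^sup>2) + ennreal (l\<^sup>2) * volterra (square_kernel p su) (second_moment l) s x"
        if "0 < s" "s \<le> t" "x \<in> ?D" for s x
        unfolding second_moment_def using that
        by (intro second_moment_upper[OF solution[OF l] \<sigma>_measurable] sector(4) mean_square_le) auto
      have "(Ku * l powr exponent) powr (\<gamma> - 1) = Ku powr (\<gamma> - 1) * (l powr exponent) powr (\<gamma> - 1)"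
        using Ku l by (simp add: powr_mult)
      also have "(l powr exponent) powr (\<gamma> - 1) = l powr - (exponent * (1 - \<gamma>))" by (simp add: powr_powr algebra_simps)
      also have "\<dots> = 1 / l\<^sup>2" unfolding exponent_eq[folded \<gamma>_def] using l by (simp add: powr_minus_divide)
      also have "Ku powr (\<gamma> - 1) = 1 / (2 * V)"
      proof -
        have "Ku powr (\<gamma> - 1) = (2 * V) powr (1 / (1 - \<gamma>) * (\<gamma> - 1))" by (simp add: Ku_def powr_powr)
        also have "1 / (1 - \<gamma>) * (\<gamma> - 1) = - 1" using \<gamma> by (simp add: field_simps)
        finally show ?thesis using V by (simp add: powr_minus_divide)
      qed
      finally have pw: "(Ku * l powr exponent) powr (\<gamma> - 1) = 1 / (2 * V) * (1 / l\<^sup>2)" .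
      have "l\<^sup>2 * (su\<^sup>2 * C) * ((1 / (1 - \<gamma>) + 1) * (Ku * l powr exponent) powr (\<gamma> - 1)) = l\<^sup>2 * V * (Ku * l powr exponent) powr (\<gamma> - 1)"
        by (simp add: V_def mult_ac)
      also have "\<dots> = 1 / 2" unfolding pw using l V by simp
      finally show "l\<^sup>2 * (su\<^sup>2 * C) * ((1 / (1 - \<gamma>) + 1) * (Ku * l powr exponent) powr (\<gamma> - 1)) \<le> 1 / 2" by simp
    qed (use Ku l C x t c in auto)
  qed
  from that[OF Ku f_upper] show ?thesis .
qed

lemma energy_eq:
  assumes t: "0 < t" and l: "0 < l"
  shows "ennreal ((energy M (ball 0 R) (u l t))\<^sup>2) = (\<integral>\<^sup>+x. second_moment l t x * indicator (ball 0 R) x \<partial>lborel)"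
    and "0 \<le> energy M (ball 0 R) (u l t)"
proof -
  obtain B where B: "\<And>x. x \<in> ball 0 R \<Longrightarrow> sq_mean (u l t x) \<le> ennreal B"
  proof (rule locally_bounded_momentsD[OF moments[OF l] t])
    fix B assume "\<And>s x. 0 \<le> s \<Longrightarrow> s \<le> t \<Longrightarrow> x \<in> ball 0 R \<Longrightarrow> sq_mean (u l s x) \<le> ennreal B"
    then show thesis using t by (intro that[of B]) auto
  qed
  have pu: "predictable M F (ball 0 R) (u l)" using solution[OF l] unfolding mild_solution_def by blast
  show "ennreal ((energy M (ball 0 R) (u l t))\<^sup>2) = (\<integral>\<^sup>+x. second_moment l t x * indicator (ball 0 R) x \<partial>lborel)"
    unfolding second_moment_def
    by (rule energy_square(1)[OF predictable_section_measurable(1)[OF pu t] B]) (simp_all add: ball_measure)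
  show "0 \<le> energy M (ball 0 R) (u l t)"
    by (rule energy_square(2)[OF predictable_section_measurable(1)[OF pu t] B]) (simp_all add: ball_measure)
qed

lemma energy_exponential_upper:
  assumes t: "0 < t"
  obtains A B where "0 < A" "0 < B" "\<And>l. 0 < l \<Longrightarrow> (energy M (ball 0 R) (u l t))\<^sup>2 \<le> B * exp (A * l powr exponent)"
proof -
  let ?D = "ball 0 R :: real set"
  obtain Ku where Ku: "0 < Ku" "\<And>l x. 0 < l \<Longrightarrow> x \<in> ?D \<Longrightarrow>
    second_moment l t x \<le> ennreal (2 * c\<^sup>2 * exp (Ku * l powr exponent * t))"
    by (rule second_moment_exponential_upper[OF t]) (rule that, assumption+)
  show ?thesis
  proof (rule that[of "Ku * t" "4 * R * c\<^sup>2"])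
    show "0 < Ku * t" "0 < 4 * R * c\<^sup>2" using Ku t K.R c(1) by auto
    fix l :: real assume l: "0 < l"
    have "ennreal ((energy M ?D (u l t))\<^sup>2) \<le> (\<integral>\<^sup>+x. ennreal (2 * c\<^sup>2 * exp (Ku * l powr exponent * t)) * indicator ?D x \<partial>lborel)"
      unfolding energy_eq(1)[OF t l] by (intro nn_integral_mono) (auto simp: indicator_def intro: Ku(2)[OF l])
    also have "\<dots> = ennreal (2 * c\<^sup>2 * exp (Ku * l powr exponent * t)) * ennreal (2 * R)"
      by (subst nn_integral_cmult_indicator) (auto simp only: ball_measure sets_lborel borel_open open_ball)
    also have "\<dots> = ennreal (4 * R * c\<^sup>2 * exp (Ku * t * l powr exponent))"
      using K.R by (simp add: ennreal_mult[symmetric] mult_ac)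
    finally show "(energy M ?D (u l t))\<^sup>2 \<le> 4 * R * c\<^sup>2 * exp (Ku * t * l powr exponent)"
      using K.R by (subst (asm) ennreal_le_iff) auto
  qed
qed

text \<open>
  The step \<open>H = Kl * l powr (-2\<alpha>/(\<alpha> - 1))\<close> satisfies the condition of \<open>volterra_lower\<close> with equality.
  It is admissible, that is, short compared with the time scale of the kernel bound and with the
  starting interval, as soon as \<open>l\<close> is large.
\<close>

lemma energy_exponential_lower:
  assumes t: "0 < t"
  obtains A B where "0 < A" "0 < B"
    "eventually (\<lambda>l. B * 2 powr (A * l powr exponent - 1) \<le> (energy M (ball 0 R) (u l t))\<^sup>2) at_top"
proof -
  let ?D = "ball 0 R :: real set"
  define \<gamma> where "\<gamma> = 1 / \<alpha>"
  note \<gamma> = inverse_alpha[folded \<gamma>_def]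
  have half: "0 < t / 2" using t by simp
  obtain c0 \<delta> a b m where J: "0 < \<delta>" "{c0 - 2 * \<delta>..c0 + 2 * \<delta>} \<subseteq> ?D" "0 < a" "a < b" "b \<le> t / 2" "0 < m"
    "\<And>s x. s \<in> {a..b} \<Longrightarrow> x \<in> {c0 - \<delta>..c0 + \<delta>} - K.exceptional R \<Longrightarrow> m \<le> K.smoothed u0 s x"
    by (rule K.initial_lower[OF alpha u0_measurable _ u0_pos half])
      (erule u0_nonneg, rule initial_integrable, assumption+, rule that, assumption+)
  obtain \<kappa> t0 where \<kappa>: "0 < \<kappa>" "0 < t0"
    "\<And>r x. 0 < r \<Longrightarrow> r \<le> t0 \<Longrightarrow> x \<in> {c0 - \<delta>..c0 + \<delta>} - K.exceptional R \<Longrightarrow>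
       ennreal (\<kappa> * r powr (- (1 / \<alpha>))) \<le> K.square_mass r x {c0 - \<delta>..c0 + \<delta>}"
    by (rule K.kernel_square_lower[OF J(1,2)]) (rule that, assumption+)
  let ?J = "{c0 - \<delta>..c0 + \<delta>}" and ?E = "K.exceptional R"
  have JD: "?J \<subseteq> ?D" using J(1,2) by (auto simp: subset_iff)
  have E: "countable ?E" by (rule K.countable_exceptional)
  define \<kappa>' where "\<kappa>' = sl\<^sup>2 * \<kappa>"
  have \<kappa>': "0 < \<kappa>'" using sector \<kappa> by (simp add: \<kappa>'_def)
  \<comment> \<open>\<open>H = Kl * l powr (- exponent)\<close> solves \<open>l\<^sup>2 * H * \<kappa>' * (2 * H) powr (- \<gamma>) = 2\<close>.\<close>
  define Kl where "Kl = (2 * 2 powr \<gamma> / \<kappa>') powr (1 / (1 - \<gamma>))"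
  have Kl: "0 < Kl" using \<kappa>' by (simp add: Kl_def)
  have f_lower: "ennreal (m\<^sup>2 * 2 powr ((t - a) / (Kl * l powr - exponent) - 1)) \<le> second_moment l t x"
    if l: "0 < l" and H: "2 * (Kl * l powr - exponent) \<le> t0" "Kl * l powr - exponent \<le> b - a" and x: "x \<in> ?J - ?E" for l x
  proof (rule volterra_lower[where J="?J" and E="?E" and \<gamma>=\<gamma> and \<kappa>=\<kappa>' and \<Lambda>="l\<^sup>2" and \<tau>=t0
        and k="square_kernel p sl"])
    show "square_kernel p sl r x \<in> borel_measurable borel" if "0 < r" "x \<in> ?J - ?E" for r x
      using that JD by (intro square_kernel_measurable) auto
    show "ennreal (\<kappa>' * r powr - \<gamma>) \<le> (\<integral>\<^sup>+y. square_kernel p sl r x y * indicator ?J y \<partial>lborel)"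
      if r: "0 < r" "r \<le> t0" "x \<in> ?J - ?E" for r x
    proof -
      have xD: "x \<in> ?D" using r JD by blast
      note [measurable] = K.kernel_measurable(2)[OF r(1) xD _ JD]
      have "ennreal (\<kappa>' * r powr - \<gamma>) = ennreal (sl\<^sup>2) * ennreal (\<kappa> * r powr (- (1 / \<alpha>)))"
        using \<kappa>(1) by (simp add: \<kappa>'_def \<gamma>_def ennreal_mult[symmetric] mult.assoc)
      also have "\<dots> \<le> ennreal (sl\<^sup>2) * K.square_mass r x ?J"
        by (intro mult_left_mono \<kappa>(3) r) simp
      also have "\<dots> = (\<integral>\<^sup>+y. ennreal (sl\<^sup>2) * (ennreal ((p r x y)\<^sup>2) * indicator ?J y) \<partial>lborel)"
        by (rule nn_integral_cmult[symmetric]) measurable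
      also have "\<dots> = (\<integral>\<^sup>+y. square_kernel p sl r x y * indicator ?J y \<partial>lborel)"
        using JD by (intro nn_integral_cong) (auto simp: indicator_def)
      finally show ?thesis .
    qed
    show "ennreal (l\<^sup>2) * volterra (square_kernel p sl) (second_moment l) s x \<le> second_moment l s x"
      if "0 < s" "x \<in> ?J - ?E" for s x
      unfolding second_moment_def using that JD sector(1)
      by (intro second_moment_lower(2)[OF solution[OF l] \<sigma>_measurable] sector(2)) auto
    show "ennreal (m\<^sup>2) \<le> second_moment l s x" if "a \<le> s" "s \<le> a + Kl * l powr - exponent" "x \<in> ?J - ?E" for s x
    proof -
      have xD: "x \<in> ?D" using that JD by blast
      have s0: "0 < s" "s \<in> {a..b}" using that J(3) H(2) by auto
      have "ennreal (m\<^sup>2) \<le> ennreal ((K.smoothed u0 s x)\<^sup>2)"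
        using J(6) J(7)[OF s0(2) that(3)] by (intro ennreal_leI power_mono) auto
      also have "\<dots> \<le> second_moment l s x"
        unfolding second_moment_def by (rule second_moment_lower(1)[OF solution[OF l] \<sigma>_measurable sector(2,1) s0(1) xD])
      finally show ?thesis .
    qed
    let ?H = "Kl * l powr - exponent"
    have H0: "0 < ?H" using Kl l by simp
    have "?H * (2 * ?H) powr (- \<gamma>) = 2 powr (- \<gamma>) * (?H powr 1 * ?H powr (- \<gamma>))"
      using H0 by (simp add: powr_mult)
    also have "?H powr 1 * ?H powr (- \<gamma>) = ?H powr (1 - \<gamma>)"
      by (subst powr_add[symmetric]) simp
    also have "\<dots> = Kl powr (1 - \<gamma>) * (l powr - exponent) powr (1 - \<gamma>)" using Kl by (simp add: powr_mult)
    also have "Kl powr (1 - \<gamma>) = 2 * 2 powr \<gamma> / \<kappa>'" using \<gamma> \<kappa>' by (simp add: Kl_def powr_powr)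
    also have "(l powr - exponent) powr (1 - \<gamma>) = l powr - (exponent * (1 - \<gamma>))" by (simp add: powr_powr)
    also have "\<dots> = 1 / l\<^sup>2" unfolding exponent_eq[folded \<gamma>_def] using l by (simp add: powr_minus_divide)
    finally have "?H * (2 * ?H) powr (- \<gamma>) = 2 powr - \<gamma> * (2 * 2 powr \<gamma> / \<kappa>' * (1 / l\<^sup>2))" .
    also have "\<dots> = 2 / (\<kappa>' * l\<^sup>2)" by (simp add: powr_minus field_simps)
    finally have HH: "?H * (2 * ?H) powr (- \<gamma>) = 2 / (\<kappa>' * l\<^sup>2)" .
    have "l\<^sup>2 * (?H * (\<kappa>' * (2 * ?H) powr - \<gamma>)) = l\<^sup>2 * \<kappa>' * (?H * (2 * ?H) powr (- \<gamma>))"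
      by (simp only: mult_ac)
    also have "\<dots> = 2" unfolding HH using l \<kappa>' by simp
    finally show "2 \<le> l\<^sup>2 * (?H * (\<kappa>' * (2 * ?H) powr - \<gamma>))" by simp
  qed (use \<gamma> \<kappa>' E J l H Kl x t in auto)
  show ?thesis
  proof (rule that[of "(t - a) / Kl" "2 * \<delta> * m\<^sup>2"])
    show "0 < (t - a) / Kl" "0 < 2 * \<delta> * m\<^sup>2" using J t Kl by auto
    have lim: "((\<lambda>l. Kl * l powr - exponent) \<longlongrightarrow> Kl * 0) at_top"
      using exponent_pos by (intro tendsto_intros tendsto_neg_powr filterlim_ident) auto
    have "eventually (\<lambda>l. Kl * l powr - exponent < t0 / 2) at_top" "eventually (\<lambda>l. Kl * l powr - exponent < b - a) at_top"
      using order_tendstoD(2)[OF lim, of "t0 / 2"] order_tendstoD(2)[OF lim, of "b - a"] \<kappa>(2) J(4) by auto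
    with eventually_gt_at_top[of "0::real"]
    show "eventually (\<lambda>l. 2 * \<delta> * m\<^sup>2 * 2 powr ((t - a) / Kl * l powr exponent - 1) \<le> (energy M ?D (u l t))\<^sup>2) at_top"
    proof eventually_elim
      case (elim l)
      then have l: "0 < l" and H: "2 * (Kl * l powr - exponent) \<le> t0" "Kl * l powr - exponent \<le> b - a" by auto
      let ?v = "m\<^sup>2 * 2 powr ((t - a) / (Kl * l powr - exponent) - 1)"
      have "ennreal (2 * \<delta> * ?v) = ennreal ?v * emeasure lborel ?J"
        using J(1) by (simp add: ennreal_mult[symmetric] mult_ac)
      also have "\<dots> = (\<integral>\<^sup>+x. ennreal ?v * indicator ?J x \<partial>lborel)"
        by (rule nn_integral_cmult_indicator[symmetric]) simp
      also have "\<dots> \<le> (\<integral>\<^sup>+x. second_moment l t x * indicator ?D x \<partial>lborel)"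
      proof (rule nn_integral_mono_AE)
        have "AE x in lborel. x \<notin> ?E"
          by (rule AE_not_in) (rule countable_imp_null_set_lborel[OF E])
        then show "AE x in lborel. ennreal ?v * indicator ?J x \<le> second_moment l t x * indicator ?D x"
        proof eventually_elim
          case (elim x)
          show ?case
          proof (cases "x \<in> ?J")
            case True
            then have "x \<in> ?D" using JD by blast
            then show ?thesis using f_lower[OF l H, of x] elim True by simp
          qed simp
        qed
      qed
      finally have "2 * \<delta> * ?v \<le> (energy M ?D (u l t))\<^sup>2"
        unfolding energy_eq(1)[OF t l, symmetric] by (subst (asm) ennreal_le_iff) auto
      moreover have "(t - a) / (Kl * l powr - exponent) = (t - a) / Kl * l powr exponent"
        using Kl l by (simp add: powr_minus field_simps)
      ultimately show ?case by (simp add: mult.assoc)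
    qed
  qed
qed

lemma excitation_index_limit:
  assumes t: "0 < t"
  shows "((\<lambda>l. ln (ln (energy M (ball 0 R) (u l t))) / ln l) \<longlongrightarrow> exponent) at_top"
proof -
  let ?e = "\<lambda>l. energy M (ball 0 R) (u l t)"
  obtain A1 B1 where low: "0 < A1" "0 < B1" "eventually (\<lambda>l. B1 * 2 powr (A1 * l powr exponent - 1) \<le> (?e l)\<^sup>2) at_top"
    using energy_exponential_lower[OF t] by blast
  obtain A2 B2 where up: "0 < A2" "0 < B2" "\<And>l. 0 < l \<Longrightarrow> (?e l)\<^sup>2 \<le> B2 * exp (A2 * l powr exponent)"
    using energy_exponential_upper[OF t] by blast
  have ln_sq: "0 < ?e l" "ln ((?e l)\<^sup>2) = 2 * ln (?e l)"
    if "0 < l" "B1 * 2 powr (A1 * l powr exponent - 1) \<le> (?e l)\<^sup>2" for l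
  proof -
    have "0 < B1 * 2 powr (A1 * l powr exponent - 1)" using low(2) by simp
    then have "?e l \<noteq> 0" using that(2) by auto
    then show "0 < ?e l" using energy_eq(2)[OF t that(1)] by simp
    then show "ln ((?e l)\<^sup>2) = 2 * ln (?e l)" by (simp add: ln_realpow)
  qed
  show ?thesis
  proof (rule loglog_limit[OF exponent_pos])
    show "0 < A1 * ln 2 / 2" "0 < A2 / 2" using low up by auto
    show "eventually (\<lambda>l. A1 * ln 2 / 2 * l powr exponent + (ln B1 - ln 2) / 2 \<le> ln (?e l)) at_top"
      using low(3) eventually_gt_at_top[of 0]
    proof eventually_elim
      case (elim l)
      have "ln (B1 * 2 powr (A1 * l powr exponent - 1)) \<le> ln ((?e l)\<^sup>2)"
        using elim low(2) ln_sq(1)[OF elim(2,1)] by (subst ln_le_cancel_iff) auto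
      moreover have "ln (B1 * 2 powr (A1 * l powr exponent - 1)) = ln B1 + (A1 * l powr exponent - 1) * ln 2"
        using low(2) by (subst ln_mult_pos) (auto simp: ln_powr)
      ultimately show ?case using ln_sq(2)[OF elim(2,1)] by (simp add: field_simps)
    qed
    show "eventually (\<lambda>l. ln (?e l) \<le> A2 / 2 * l powr exponent + ln B2 / 2) at_top"
      using low(3) eventually_gt_at_top[of 0]
    proof eventually_elim
      case (elim l)
      have "ln ((?e l)\<^sup>2) \<le> ln (B2 * exp (A2 * l powr exponent))"
        using up(3)[OF elim(2)] up(2) ln_sq(1)[OF elim(2,1)] by (subst ln_le_cancel_iff) auto
      also have "\<dots> = ln B2 + A2 * l powr exponent" using up(2) by (subst ln_mult_pos) auto
      finally show ?case using ln_sq(2)[OF elim(2,1)] by (simp add: field_simps)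
    qed
  qed
qed

end

theorem corollary1p3:
  fixes R \<alpha> :: real
    and u0 \<sigma> :: "real \<Rightarrow> real"
    and N :: "'b measure" and X :: "real \<Rightarrow> 'b \<Rightarrow> real"
    and p :: "real \<Rightarrow> real \<Rightarrow> real \<Rightarrow> real"
    and M :: "'a measure" and F :: "real \<Rightarrow> 'a measure"
    and w :: "(real \<times> real) set \<Rightarrow> 'a \<Rightarrow> real"
    and u :: "real \<Rightarrow> real \<Rightarrow> real \<Rightarrow> 'a \<Rightarrow> real"
  assumes R: "0 < R"
    and alpha: "1 < \<alpha>" "\<alpha> < 2"
    and process: "stable_process N \<alpha> X"
    and heat_kernel: "killed_transition_density N X (ball 0 R) p"
    and u0_measurable: "u0 \<in> borel_measurable (lebesgue_on (ball 0 R))"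
    and u0_nonneg: "\<And>x. x \<in> ball 0 R \<Longrightarrow> 0 \<le> u0 x"
    and u0_pos: "0 < emeasure lebesgue {x \<in> ball 0 R. 0 < u0 x}"
    and sigma_Lipschitz: "\<exists>C. C-lipschitz_on UNIV \<sigma>"
    and sigma_0: "\<sigma> 0 = 0"
    and sigma_lower: "0 < (INF x\<in>-{0}. ereal \<bar>\<sigma> x / x\<bar>)"
    and sigma_upper: "(SUP x\<in>-{0}. ereal \<bar>\<sigma> x / x\<bar>) < \<infinity>"
    and noise: "white_noise M F (ball 0 R) w"
    and solution: "\<And>l. 0 < l \<Longrightarrow> mild_solution M F (ball 0 R) w p \<sigma> u0 l (u l)"
    and moments: "\<And>l. 0 < l \<Longrightarrow> locally_bounded_moments M (ball 0 R) (u l)"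
  shows "\<forall>t>0. ((\<lambda>l. ln (ln (energy M (ball 0 R) (u l t))) / ln l)
           \<longlongrightarrow> 2 * \<alpha> / (\<alpha> - 1)) at_top"
proof -
  interpret white_noise_space M F "ball 0 R" w
    using noise by (auto simp: white_noise_space_def white_noise_space_axioms_def white_noise_def)
  interpret N: prob_space N using process by (simp add: stable_process_def)
  have \<sigma>: "\<sigma> \<in> borel_measurable borel"
    using sigma_Lipschitz by (auto intro: borel_measurable_continuous_onI lipschitz_on_continuous_on)
  obtain sl su where s: "0 < sl" "\<And>x. sl * \<bar>x\<bar> \<le> \<bar>\<sigma> x\<bar>" "0 < su" "\<And>x. \<bar>\<sigma> x\<bar> \<le> su * \<bar>x\<bar>"
    by (rule sector_condition[OF sigma_0 sigma_lower sigma_upper]) (rule that, assumption+)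
  obtain c where c: "1 \<le> c" "\<And>x. x \<in> ball 0 R \<Longrightarrow> u0 x \<le> c"
    using initial_condition_bounded[OF moments[OF zero_less_one] solution[OF zero_less_one]] by blast
  interpret E: multiplicative_heat_equation M F R w N \<alpha> X p u0 \<sigma> sl su c u
    by unfold_locales
      (fact R alpha process heat_kernel u0_measurable u0_nonneg u0_pos solution moments \<sigma> s c
        | use alpha in simp)+
  show ?thesis using E.excitation_index_limit by (simp add: E.exponent_def)
qed

end
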